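(* Suppose $R=k[t^{a_1},\dots,t^{a_n}]$ is a numerical semigroup ring. If $M$ is a homogeneous Ulrich module with minimal homogeneous generating set $x_1,\dots,x_m$, then for each $i$, $$\big((x_1,\dots,\widehat{x_i},\dots,x_m):x_i\big)=(t^{d_ia_1},t^{a_2},\dots,t^{a_n})$$ for some integer $d_i$. Moreover, if $A$ is a minimal homogeneous presentation matrix for $M$, then $$I_1(A)=(t^{\min\{d_1,\dots,d_m\}a_1},t^{a_2},\dots,t^{a_n}).$$ In particular, $\operatorname{tr}_R(\Omega^1_R(M))=(t^{da_1},t^{a_2},\dots,t^{a_n})$ for some integer $1\le d\le\min\{d_1,\dots,d_m\}$.
   Context: Here $k$ is a field and $a_1<\cdots<a_n$ are the minimal generators of a numerical semigroup (so $\gcd(a_1,\dots,a_n)=1$); $R\subseteq k[t]$ is graded with $t$ in degree $1$ and $\mathfrak{m}=(t^{a_1},\dots,t^{a_n})$. All modules are finitely generated and graded ("homogeneous"). An $R$-module $M$ is Ulrich if it is maximal Cohen-Macaulay and $e_R(M)=\mu_R(M)$, where $e_R(M)$ is the Hilbert-Samuel multiplicity of $M$ (with respect to $\mathfrak{m}$) and $\mu_R(M)=\dim_k(M/\mathfrak{m}M)$. For a submodule $N\subseteq M$ and $x\in M$, $(N:x)=\{r\in R\mid rx\in N\}$; $(x_1,\dots,\widehat{x_i},\dots,x_m)$ is the submodule of $M$ generated by all $x_j$ with $j\ne i$. The trace ideal of a module $N$ is $\operatorname{tr}_R(N)=\langle f(x)\mid f\in\operatorname{Hom}_R(N,R),\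 x\in N\rangle$. $\Omega^1_R(M)$ is the first syzygy of $M$, i.e. the kernel of $R^{\oplus m}\to M$, $e_i\mapsto x_i$. A minimal homogeneous presentation matrix of $M$ is the matrix $A$ in a minimal graded presentation $R^{\oplus q}\xrightarrow{A}R^{\oplus m}\to M\to0$, and $I_1(A)$ is the ideal generated by its entries.
   Formalization: The formal theorem assumes n ≥ 2, so R is not k[t]; for n = 1 the claim fails, since for M = k[t] the colon ideal is 0, which is not of the form (t^{d a_1}). *)

theory Defs
  imports
    "HOL-Library.Extended_Nat"
    "HOL-Algebra.Generated_Rings"
    "HOL-Algebra.Ideal_Product"
    "Jordan_Normal_Form.VS_Connect"
begin

section \<open>Numerical semigroup rings\<close>

definition gen_submonoid :: "nat set \<Rightarrow> nat set" where
  "gen_submonoid A = {\<Sum>s\<in>A. c s * s | c. True}"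

text \<open>The generators are indexed from 0, so \<open>a 0\<close> is the multiplicity of the semigroup. As
  \<open>0\<close> lies in every submonoid, irredundancy forces all generators to be positive.\<close>

definition minimal_semigroup_generators :: "nat \<Rightarrow> (nat \<Rightarrow> nat) \<Rightarrow> bool" where
  "minimal_semigroup_generators n a \<longleftrightarrow>
     strict_mono_on {..<n} a \<and>
     Gcd (a ` {..<n}) = 1 \<and>
     (\<forall>i<n. a i \<notin> gen_submonoid (a ` ({..<n} - {i})))"

definition semigroup_ring :: "nat set \<Rightarrow> 'k::field poly ring" where
  "semigroup_ring A = class_ring\<lparr>carrier :=
     generate_ring class_ring (range (\<lambda>c. [:c:]) \<union> Polynomial.monom 1 ` A)\<rparr>"

definition semigroup_ring_grading :: "nat set \<Rightarrow> int \<Rightarrow> 'k::field poly set" where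
  "semigroup_ring_grading A d =
     {p \<in> carrier (semigroup_ring A). \<forall>i. poly.coeff p i \<noteq> 0 \<longrightarrow> int i = d}"

definition irrelevant_ideal :: "nat set \<Rightarrow> 'k::field poly set" where
  "irrelevant_ideal A = Idl\<^bsub>semigroup_ring A\<^esub> (Polynomial.monom 1 ` A)"

definition power_ideal :: "nat \<Rightarrow> (nat \<Rightarrow> nat) \<Rightarrow> nat \<Rightarrow> 'k::field poly set" where
  "power_ideal n a d = Idl\<^bsub>semigroup_ring (a ` {..<n})\<^esub>
     (insert (Polynomial.monom 1 (d * a 0)) ((\<lambda>j. Polynomial.monom 1 (a j)) ` {1..<n}))"


section \<open>Modules\<close>

locale graded_module = Module.module R M for R (structure) and M (structure) +
  fixes RR :: "int \<Rightarrow> 'a set" and MM :: "int \<Rightarrow> 'c set"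
  assumes component_subgroup: "additive_subgroup (MM d) M"
    and smult_component: "r \<in> RR d \<Longrightarrow> x \<in> MM e \<Longrightarrow> r \<odot>\<^bsub>M\<^esub> x \<in> MM (d + e)"
    and decomposition: "x \<in> carrier M \<Longrightarrow>
      \<exists>!f. (\<forall>d. f d \<in> MM d) \<and> finite {d. f d \<noteq> \<zero>\<^bsub>M\<^esub>} \<and>
           (\<Oplus>\<^bsub>M\<^esub>d\<in>{d. f d \<noteq> \<zero>\<^bsub>M\<^esub>}. f d) = x"

definition minimal_homogeneous_generators ::
  "('r, 'b) ring_scheme \<Rightarrow> ('r, 'm, 'c) module_scheme \<Rightarrow> (int \<Rightarrow> 'm set)
     \<Rightarrow> nat \<Rightarrow> (nat \<Rightarrow> 'm) \<Rightarrow> bool" where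
  "minimal_homogeneous_generators R M MM m x \<longleftrightarrow>
     (\<forall>i<m. \<exists>d. x i \<in> MM d) \<and>
     module.span R M (x ` {..<m}) = carrier M \<and>
     (\<forall>J. J \<subset> {..<m} \<longrightarrow> module.span R M (x ` J) \<noteq> carrier M)"

definition colon :: "('r, 'b) ring_scheme \<Rightarrow> ('r, 'm, 'c) module_scheme \<Rightarrow> 'm set \<Rightarrow> 'm \<Rightarrow> 'r set" where
  "colon R M N x = {r \<in> carrier R. r \<odot>\<^bsub>M\<^esub> x \<in> N}"

definition ideal_smult :: "('r, 'b) ring_scheme \<Rightarrow> 'r set \<Rightarrow> ('r, 'm, 'c) module_scheme \<Rightarrow> 'm set" where
  "ideal_smult R I M = module.span R M {r \<odot>\<^bsub>M\<^esub> x | r x. r \<in> I \<and> x \<in> carrier M}"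

text \<open>A module is a record extending rings; the fields \<open>mult\<close> and \<open>one\<close> carry no meaning.\<close>

definition quot_module :: "('r, 'm, 'c) module_scheme \<Rightarrow> 'm set \<Rightarrow> ('r, 'm set) module" where
  "quot_module M N =
     \<lparr>carrier = a_rcosets\<^bsub>M\<^esub> N, mult = (\<lambda>C D. N), one = N, zero = N, add = set_add M,
      smult = (\<lambda>r C. \<Union>x\<in>C. N +>\<^bsub>M\<^esub> (r \<odot>\<^bsub>M\<^esub> x))\<rparr>"

definition restrict_scalars :: "('k \<Rightarrow> 'r) \<Rightarrow> ('r, 'm, 'c) module_scheme \<Rightarrow> ('k, 'm) module" where
  "restrict_scalars \<phi> M =
     \<lparr>carrier = carrier M, mult = mult M, one = one M, zero = zero M, add = add M,
      smult = (\<lambda>c. smult M (\<phi> c))\<rparr>"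

definition ring_as_module :: "('r, 'b) ring_scheme \<Rightarrow> ('r, 'r) module" where
  "ring_as_module R =
     \<lparr>carrier = carrier R, mult = mult R, one = one R, zero = zero R, add = add R,
      smult = mult R\<rparr>"

definition trace_ideal :: "('r, 'b) ring_scheme \<Rightarrow> ('r, 'm, 'c) module_scheme \<Rightarrow> 'r set" where
  "trace_ideal R N =
     Idl\<^bsub>R\<^esub> {f y | f y. f \<in> module_hom R N (ring_as_module R) \<and> y \<in> carrier N}"


section \<open>Ulrich modules\<close>

definition krull_dim :: "('r, 'b) ring_scheme \<Rightarrow> enat" where
  "krull_dim R = (SUP n\<in>{n. \<exists>P. (\<forall>i\<le>n. primeideal (P i) R) \<and> (\<forall>i<n. P i \<subset> P (Suc i))}. enat n)"

definition regular_sequence :: "('r, 'b) ring_scheme \<Rightarrow> ('r, 'm, 'c) module_scheme \<Rightarrow> 'r list \<Rightarrow> bool" where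
  "regular_sequence R M rs \<longleftrightarrow>
     set rs \<subseteq> carrier R \<and>
     (\<forall>i<length rs. \<forall>x\<in>carrier M.
        rs ! i \<odot>\<^bsub>M\<^esub> x \<in> ideal_smult R (Idl\<^bsub>R\<^esub> (set (take i rs))) M \<longrightarrow>
        x \<in> ideal_smult R (Idl\<^bsub>R\<^esub> (set (take i rs))) M) \<and>
     ideal_smult R (Idl\<^bsub>R\<^esub> (set rs)) M \<noteq> carrier M"

definition depth :: "('r, 'b) ring_scheme \<Rightarrow> 'r set \<Rightarrow> ('r, 'm, 'c) module_scheme \<Rightarrow> enat" where
  "depth R I M = (SUP rs\<in>{rs. set rs \<subseteq> I \<and> regular_sequence R M rs}. enat (length rs))"

text \<open>Here \<open>I\<close> is the (graded) maximal ideal. With this definition of depth the zero module has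
  depth \<open>0\<close>, as not even the empty sequence is regular on it; so it is not maximal
  Cohen-Macaulay over a ring of positive dimension.\<close>

definition maximal_Cohen_Macaulay ::
  "('r, 'b) ring_scheme \<Rightarrow> 'r set \<Rightarrow> ('r, 'm, 'c) module_scheme \<Rightarrow> bool" where
  "maximal_Cohen_Macaulay R I M \<longleftrightarrow>
     (\<exists>X. finite X \<and> X \<subseteq> carrier M \<and> module.span R M X = carrier M) \<and>
     depth R I M = krull_dim R"

definition module_length :: "('r, 'b) ring_scheme \<Rightarrow> ('r, 'm, 'c) module_scheme \<Rightarrow> enat" where
  "module_length R M =
     (SUP n\<in>{n. \<exists>N. (\<forall>i\<le>n. submodule R (N i) M) \<and> (\<forall>i<n. N i \<subset> N (Suc i))}. enat n)"

definition hilbert_samuel_multiplicity ::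
  "('r, 'b) ring_scheme \<Rightarrow> 'r set \<Rightarrow> ('r, 'm, 'c) module_scheme \<Rightarrow> real" where
  "hilbert_samuel_multiplicity R I M =
     (let d = the_enat (krull_dim R) in
      lim (\<lambda>s::nat. fact d *
        real (the_enat (module_length R (quot_module M
          (ideal_smult R (I [^]\<^bsub>ideals_set R\<^esub> s) M)))) / real s ^ d))"

text \<open>The map \<open>\<phi>\<close> embeds the residue field into the ring.\<close>

definition num_generators ::
  "('k::field \<Rightarrow> 'r) \<Rightarrow> ('r, 'b) ring_scheme \<Rightarrow> 'r set \<Rightarrow> ('r, 'm, 'c) module_scheme \<Rightarrow> nat" where
  "num_generators \<phi> R I M =
     vectorspace.dim (class_ring :: 'k ring)
       (restrict_scalars \<phi> (quot_module M (ideal_smult R I M)))"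

definition Ulrich_module ::
  "('k::field \<Rightarrow> 'r) \<Rightarrow> ('r, 'b) ring_scheme \<Rightarrow> 'r set \<Rightarrow> ('r, 'm, 'c) module_scheme \<Rightarrow> bool" where
  "Ulrich_module \<phi> R I M \<longleftrightarrow>
     maximal_Cohen_Macaulay R I M \<and>
     hilbert_samuel_multiplicity R I M = real (num_generators \<phi> R I M)"


section \<open>Syzygies and presentation matrices\<close>

definition syzygy_module ::
  "('r, 'b) ring_scheme \<Rightarrow> ('r, 'm, 'c) module_scheme \<Rightarrow> nat \<Rightarrow> (nat \<Rightarrow> 'm)
     \<Rightarrow> ('r, nat \<Rightarrow> 'r) module" where
  "syzygy_module R M m x = (ring.func_space R {..<m})\<lparr>carrier :=
     {c \<in> {..<m} \<rightarrow>\<^sub>E carrier R. (\<Oplus>\<^bsub>M\<^esub>i\<in>{..<m}. c i \<odot>\<^bsub>M\<^esub> x i) = \<zero>\<^bsub>M\<^esub>}\<rparr>"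

text \<open>The grading induced by the free module whose \<open>i\<close>-th basis vector has degree \<open>e i\<close>.\<close>

definition syzygy_grading ::
  "('r, 'b) ring_scheme \<Rightarrow> (int \<Rightarrow> 'r set) \<Rightarrow> ('r, 'm, 'c) module_scheme \<Rightarrow> nat
     \<Rightarrow> (nat \<Rightarrow> 'm) \<Rightarrow> (nat \<Rightarrow> int) \<Rightarrow> int \<Rightarrow> (nat \<Rightarrow> 'r) set" where
  "syzygy_grading R RR M m x e d =
     {c \<in> carrier (syzygy_module R M m x). \<forall>i<m. c i \<in> RR (d - e i)}"

text \<open>The rows of \<open>A\<close> correspond to a minimal homogeneous generating system \<open>y\<close> of \<open>M\<close>, not
  necessarily one fixed in advance, and its columns to a minimal homogeneous generating system
  of the syzygies of \<open>y\<close>.\<close>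

definition minimal_presentation_matrix ::
  "('r, 'b) ring_scheme \<Rightarrow> (int \<Rightarrow> 'r set) \<Rightarrow> ('r, 'm, 'c) module_scheme \<Rightarrow> (int \<Rightarrow> 'm set)
     \<Rightarrow> 'r mat \<Rightarrow> bool" where
  "minimal_presentation_matrix R RR M MM A \<longleftrightarrow>
     (\<exists>y e. minimal_homogeneous_generators R M MM (dim_row A) y \<and>
        (\<forall>i<dim_row A. y i \<in> MM (e i)) \<and>
        minimal_homogeneous_generators R
          (syzygy_module R M (dim_row A) y) (syzygy_grading R RR M (dim_row A) y e)
          (dim_col A) (\<lambda>j. \<lambda>i\<in>{..<dim_row A}. A $$ (i, j)))"

definition entry_ideal :: "('r, 'b) ring_scheme \<Rightarrow> 'r mat \<Rightarrow> 'r set" where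
  "entry_ideal R A = Idl\<^bsub>R\<^esub> (elements_mat A)"

end

theory Submission
  imports Defs
begin

text \<open>
  Write \<open>\<tau> = t\<^bsup>a 0\<^esup>\<close> and \<open>\<mm>\<close> for the graded maximal ideal. The Ulrich property enters through a
  single consequence: \<open>\<mm> M = \<tau> M\<close>. Indeed \<open>\<mm>\<^bsup>s+1\<^esup> = \<tau> \<mm>\<^sup>s\<close> for large \<open>s\<close>, and \<open>\<tau>\<close> is regular on \<open>M\<close>.
  So the length of \<open>M / \<mm>\<^sup>s M\<close> eventually grows by the length of \<open>M / \<tau> M\<close> in each step, and the
  latter is the multiplicity (\<open>multiplicity_eq\<close>; the ring has dimension one by \<open>krull_dim_R\<close>). The
  number of generators is the length of \<open>M / \<mm> M\<close> (\<open>num_generators_eq\<close>). If they agree, the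
  submodules \<open>\<tau> M \<subseteq> \<mm> M\<close> coincide (\<open>Ulrich_max_ideal_smult\<close>).

  The colon ideal of \<open>x i\<close> is the set of \<open>i\<close>-th coordinates of syzygies of \<open>x\<close>. For \<open>j \<ge> 1\<close> the element
  \<open>t\<^bsup>a j\<^esup> x i\<close> lies in \<open>\<tau> M\<close>, and the homogeneous part of the resulting relation is a syzygy with
  \<open>i\<close>-th coordinate \<open>t\<^bsup>a j\<^esup>\<close>, because \<open>a j - a 0\<close> is not in the semigroup
  (\<open>generator_is_coordinate\<close>). So the colon ideal contains \<open>t\<^bsup>a j\<^esup>\<close> for all \<open>j \<ge> 1\<close>. Modulo these
  elements \<open>R\<close> is \<open>k[\<tau>] / (\<tau>\<^sup>N)\<close>, which leaves only the ideals of the claimed form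
  (\<open>ideal_eq_power_ideal\<close>). They form a chain, so the coordinates of all syzygies make up the
  ideal with the least exponent.

  The entries of a presentation matrix generate the ideal of coordinates for the generators
  that belong to the matrix, and this ideal is the same for all minimal homogeneous generators
  (\<open>coord_ideal_le\<close>). The trace ideal contains it, by the coordinate projections, and so has the
  claimed form as well. It is proper: a socle element \<open>\<sigma>\<close> of \<open>R / \<tau> R\<close> maps the syzygies into \<open>\<tau>\<close> times
  syzygies, so \<open>\<sigma> f z \<in> \<tau> R\<close> for each functional \<open>f\<close> and syzygy \<open>z\<close>
  (\<open>syzygy_functional_max_ideal\<close>).

  Monomial ideals are handled through their sets of exponents (\<open>mon_span\<close>), and lengths of
  quotients as lengths of chains of submodules of one fixed module (\<open>interval_length\<close>).
\<close>

section \<open>Numerical semigroups\<close>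

lemma gen_submonoid_zero: "0 \<in> gen_submonoid A"
  unfolding gen_submonoid_def by (intro CollectI exI[of _ "\<lambda>_. 0"]) simp

lemma gen_submonoid_add:
  assumes "x \<in> gen_submonoid A" "y \<in> gen_submonoid A"
  shows "x + y \<in> gen_submonoid A"
proof -
  obtain c d where "x = (\<Sum>s\<in>A. c s * s)" "y = (\<Sum>s\<in>A. d s * s)"
    using assms unfolding gen_submonoid_def by blast
  then have "x + y = (\<Sum>s\<in>A. (c s + d s) * s)"
    by (simp add: sum.distrib algebra_simps)
  then show ?thesis unfolding gen_submonoid_def by (intro CollectI exI[of _ "\<lambda>s. c s + d s"]) simp
qed

lemma gen_submonoid_mult: "x \<in> gen_submonoid A \<Longrightarrow> k * x \<in> gen_submonoid A"
  by (induction k) (auto simp: gen_submonoid_zero intro: gen_submonoid_add)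

lemma gen_submonoid_generator:
  assumes "finite A" "s \<in> A" shows "s \<in> gen_submonoid A"
  unfolding gen_submonoid_def using assms
  by (intro CollectI exI[of _ "\<lambda>x. if x = s then 1 else 0"]) (simp add: if_distrib[of "\<lambda>c. c * _"] sum.delta cong: if_cong)

lemma gen_submonoid_cases:
  assumes "finite A" "x \<in> gen_submonoid A" "x \<noteq> 0"
  obtains s y where "s \<in> A" "s \<noteq> 0" "y \<in> gen_submonoid A" "x = s + y"
proof -
  obtain c where c: "x = (\<Sum>s\<in>A. c s * s)" using assms unfolding gen_submonoid_def by blast
  obtain s where s: "s \<in> A" "c s * s \<noteq> 0" using assms c by (metis (no_types, lifting) sum.neutral)
  let ?d = "c(s := c s - 1)"
  have "x = c s * s + (\<Sum>r\<in>A - {s}. c r * r)" using c s assms by (simp add: sum.remove)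
  also have "c s * s = s + ?d s * s" using s by (cases "c s") auto
  also have "(\<Sum>r\<in>A - {s}. c r * r) = (\<Sum>r\<in>A - {s}. ?d r * r)" by (intro sum.cong) auto
  also have "s + ?d s * s + (\<Sum>r\<in>A - {s}. ?d r * r) = s + (\<Sum>r\<in>A. ?d r * r)"
    using s assms by (simp add: sum.remove)
  finally have "x = s + (\<Sum>r\<in>A. ?d r * r)" .
  moreover have "(\<Sum>r\<in>A. ?d r * r) \<in> gen_submonoid A" unfolding gen_submonoid_def by blast
  ultimately show ?thesis using s that by simp
qed

text \<open>The least positive difference \<open>\<delta>\<close> of two semigroup elements divides every generator, hence
  is \<open>1\<close>. So the semigroup contains neighbours \<open>v\<close> and \<open>v + 1\<close>, and \<open>u = q v + r\<close> with
  \<open>r < v \<le> q\<close> is \<open>(q - r) v + r (v + 1)\<close>.\<close>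

lemma gen_submonoid_conductor:
  assumes "finite A" "Gcd A = 1"
  obtains c where "\<And>u. u \<ge> c \<Longrightarrow> u \<in> gen_submonoid A"
proof -
  let ?S = "gen_submonoid A"
  define P where "P \<delta> \<longleftrightarrow> \<delta> > 0 \<and> (\<exists>v\<in>?S. v + \<delta> \<in> ?S)" for \<delta>
  obtain s0 where "s0 \<in> A" "s0 > 0" 
  proof (atomize_elim, rule ccontr)
    assume "\<not> (\<exists>s0. s0 \<in> A \<and> 0 < s0)"
    then have "A \<subseteq> {0}" by auto
    then have "Gcd A = 0" by (simp add: Gcd_0_iff)
    with assms show False by simp
  qed
  then have "0 + s0 \<in> ?S" using assms by (simp add: gen_submonoid_generator)
  then have "P s0" using gen_submonoid_zero \<open>s0 > 0\<close> unfolding P_def by blast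
  define \<delta> where "\<delta> = (LEAST \<delta>. P \<delta>)"
  have "P \<delta>" unfolding \<delta>_def using \<open>P s0\<close> by (rule LeastI)
  then obtain v where v: "v \<in> ?S" "v + \<delta> \<in> ?S" "\<delta> > 0" unfolding P_def by auto
  have "\<delta> dvd s" if "s \<in> A" for s
  proof (rule ccontr)
    assume "\<not> \<delta> dvd s"
    then have "s mod \<delta> > 0" by (simp add: mod_greater_zero_iff_not_dvd)
    moreover have "(s div \<delta>) * (v + \<delta>) + s mod \<delta> = s + (s div \<delta>) * v" by (simp add: algebra_simps)
    moreover have "s + (s div \<delta>) * v \<in> ?S" "(s div \<delta>) * (v + \<delta>) \<in> ?S"
      using v gen_submonoid_generator[OF assms(1) that]
      by (simp_all add: gen_submonoid_add gen_submonoid_mult)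
    ultimately have "P (s mod \<delta>)" unfolding P_def by metis
    then have "\<delta> \<le> s mod \<delta>" unfolding \<delta>_def by (rule Least_le)
    then show False using v mod_less_divisor[of \<delta> s] by linarith
  qed
  then have "\<delta> dvd Gcd A" by (rule Gcd_greatest)
  then have [simp]: "\<delta> = 1" using assms by simp
  show ?thesis
  proof (rule that)
    fix u assume u: "u \<ge> v * v"
    show "u \<in> ?S"
    proof (cases "v = 0")
      case True
      then have "u * (v + \<delta>) \<in> ?S" using v by (intro gen_submonoid_mult) simp
      with True show ?thesis by simp
    next
      case False
      have "u mod v \<le> u div v"
        using u False by (metis less_imp_le_nat div_le_mono le_trans mod_less_divisor neq0_conv nonzero_mult_div_cancel_right)
      then have "u = (u div v - u mod v) * v + u mod v * (v + \<delta>)"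
        by (simp add: algebra_simps)
      then show ?thesis using v by (metis gen_submonoid_add gen_submonoid_mult)
    qed
  qed
qed

section \<open>Spans of monomials\<close>

abbreviation tpow :: "nat \<Rightarrow> 'k::field poly" where
  "tpow \<equiv> Polynomial.monom 1"

definition mon_span :: "nat set \<Rightarrow> 'k::field poly set" where
  "mon_span E = {p. \<forall>i. poly.coeff p i \<noteq> 0 \<longrightarrow> i \<in> E}"

lemma mon_spanD: "p \<in> mon_span E \<Longrightarrow> poly.coeff p i \<noteq> 0 \<Longrightarrow> i \<in> E"
  unfolding mon_span_def by auto

lemma mon_span_coeff: "p \<in> mon_span E \<Longrightarrow> i \<notin> E \<Longrightarrow> poly.coeff p i = 0"
  unfolding mon_span_def by auto

lemma mon_span_mono: "E \<subseteq> F \<Longrightarrow> mon_span E \<subseteq> mon_span F"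
  unfolding mon_span_def by auto

lemma mon_span_zero [simp]: "0 \<in> mon_span E" unfolding mon_span_def by auto

lemma mon_span_monom: "i \<in> E \<Longrightarrow> Polynomial.monom c i \<in> mon_span E"
  unfolding mon_span_def by (auto split: if_splits)

lemma mon_span_monom_iff [simp]: "c \<noteq> 0 \<Longrightarrow> Polynomial.monom c i \<in> mon_span E \<longleftrightarrow> i \<in> E"
  unfolding mon_span_def by (auto split: if_splits)

lemma mon_span_add: "p \<in> mon_span E \<Longrightarrow> q \<in> mon_span E \<Longrightarrow> p + q \<in> mon_span E"
  unfolding mon_span_def by (simp, metis add.right_neutral)

lemma mon_span_uminus: "p \<in> mon_span E \<Longrightarrow> - p \<in> mon_span E"
  unfolding mon_span_def by auto

lemma mon_span_diff: "p \<in> mon_span E \<Longrightarrow> q \<in> mon_span E \<Longrightarrow> p - q \<in> mon_span E"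
  unfolding mon_span_def by (simp, metis diff_zero)

lemma mon_span_sum: "(\<And>i. i \<in> I \<Longrightarrow> f i \<in> mon_span E) \<Longrightarrow> sum f I \<in> mon_span E"
  by (induction I rule: infinite_finite_induct) (auto intro: mon_span_add)

lemma mon_span_mult:
  assumes "p \<in> mon_span E" "q \<in> mon_span F" "\<And>i j. i \<in> E \<Longrightarrow> j \<in> F \<Longrightarrow> i + j \<in> G"
  shows "p * q \<in> mon_span G"
  unfolding mon_span_def
proof (intro CollectI allI impI)
  fix k assume "poly.coeff (p * q) k \<noteq> 0"
  then obtain i where "i \<le> k" "poly.coeff p i * poly.coeff q (k - i) \<noteq> 0"
    unfolding coeff_mult by (metis (no_types, lifting) atMost_iff sum.neutral)
  then show "k \<in> G" using assms mon_spanD[of p E i] mon_spanD[of q F "k - i"] by fastforce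
qed

lemma mon_span_pow:
  assumes "p \<in> mon_span E" "0 \<in> E" "\<And>i j. i \<in> E \<Longrightarrow> j \<in> E \<Longrightarrow> i + j \<in> E"
  shows "p ^ k \<in> mon_span E"
proof (induction k)
  case 0
  then show ?case using mon_span_monom[of 0 E 1] assms by (simp add: monom_eq_1)
next
  case (Suc k)
  then show ?case using assms by (auto intro: mon_span_mult)
qed

text \<open>A polynomial is the sum of its terms; this reduces membership in ideals, subspaces and spans
  to monomials.\<close>

lemma poly_in_by_terms:
  assumes "0 \<in> I" "\<And>p q. p \<in> I \<Longrightarrow> q \<in> I \<Longrightarrow> p + q \<in> I"
    and "\<And>i. poly.coeff p i \<noteq> 0 \<Longrightarrow> Polynomial.monom (poly.coeff p i) i \<in> I"
  shows "p \<in> I"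
proof -
  have "(\<Sum>i\<in>K. Polynomial.monom (poly.coeff p i) i) \<in> I" if "finite K" for K
    using that by induction (use assms in \<open>auto, metis add_0 monom_eq_0\<close>)
  then show ?thesis using poly_as_sum_of_monoms[of p] by (metis finite_atMost)
qed

text \<open>This turns inclusions between sets of exponents into divisibility by a monomial.\<close>

lemma mon_span_shift:
  assumes "p \<in> mon_span E" "\<And>i. i \<in> E \<Longrightarrow> e \<le> i \<and> i - e \<in> F"
  obtains q where "q \<in> mon_span F" "p = tpow e * q"
proof
  let ?q = "poly_shift e p"
  show "?q \<in> mon_span F"
    using assms unfolding mon_span_def by (fastforce simp: coeff_poly_shift)
  show "p = tpow e * ?q"
  proof (rule poly_eqI)
    fix i
    show "poly.coeff p i = poly.coeff (tpow e * ?q) i"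
      using mon_span_coeff[OF assms(1)] assms(2)
      by (simp add: coeff_monom_mult coeff_poly_shift) (metis not_le)
  qed
qed

lemma mon_span_split:
  assumes "p \<in> mon_span E"
  obtains q r where "q \<in> mon_span (E \<inter> F)" "r \<in> mon_span (E - F)" "p = q + r"
proof
  let ?q = "\<Sum>i\<le>degree p. if i \<in> F then Polynomial.monom (poly.coeff p i) i else 0"
  let ?r = "\<Sum>i\<le>degree p. if i \<notin> F then Polynomial.monom (poly.coeff p i) i else 0"
  have *: "Polynomial.monom (poly.coeff p i) i \<in> mon_span G" if "i \<in> E \<Longrightarrow> i \<in> G" for i G
    using that assms by (cases "poly.coeff p i = 0") (auto simp: mon_span_def split: if_splits)
  show "?q \<in> mon_span (E \<inter> F)" "?r \<in> mon_span (E - F)"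
    by (rule mon_span_sum, simp add: *)+
  show "p = ?q + ?r"
    unfolding sum.distrib[symmetric]
    by (subst poly_as_sum_of_monoms[of p, symmetric]) (rule sum.cong, auto)
qed

section \<open>Lengths of intervals of submodules\<close>

text \<open>This is the length of \<open>B / A\<close>. Avoiding the quotient keeps all chains inside one module, where
  they can be intersected and compared.\<close>

definition interval_length ::
  "('r, 'b) ring_scheme \<Rightarrow> ('r, 'm, 'c) module_scheme \<Rightarrow> 'm set \<Rightarrow> 'm set \<Rightarrow> enat" where
  "interval_length R M A B =
     (SUP k\<in>{k. \<exists>N. (\<forall>i\<le>k. submodule R (N i) M \<and> A \<subseteq> N i \<and> N i \<subseteq> B) \<and> (\<forall>i<k. N i \<subset> N (Suc i))}. enat k)"

lemma interval_length_ge: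
  assumes "\<And>i. i \<le> k \<Longrightarrow> submodule R (N i) M \<and> A \<subseteq> N i \<and> N i \<subseteq> B" "\<And>i. i < k \<Longrightarrow> N i \<subset> N (Suc i)"
  shows "enat k \<le> interval_length R M A B"
  unfolding interval_length_def using assms by (intro SUP_upper) auto

lemma interval_length_le:
  assumes "\<And>k N. (\<And>i. i \<le> k \<Longrightarrow> submodule R (N i) M \<and> A \<subseteq> N i \<and> N i \<subseteq> B) \<Longrightarrow>
      (\<And>i. i < k \<Longrightarrow> N i \<subset> N (Suc i)) \<Longrightarrow> enat k \<le> c"
  shows "interval_length R M A B \<le> c"
  unfolding interval_length_def
proof (rule SUP_least)
  fix k assume "k \<in> {k. \<exists>N. (\<forall>i\<le>k. submodule R (N i) M \<and> A \<subseteq> N i \<and> N i \<subseteq> B) \<and> (\<forall>i<k. N i \<subset> N (Suc i))}"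
  then obtain N where N: "\<forall>i\<le>k. submodule R (N i) M \<and> A \<subseteq> N i \<and> N i \<subseteq> B" "\<forall>i<k. N i \<subset> N (Suc i)"
    by blast
  show "enat k \<le> c" by (rule assms[of k N]) (use N in simp_all)
qed

lemma interval_length_mono:
  "A' \<subseteq> A \<Longrightarrow> B \<subseteq> B' \<Longrightarrow> interval_length R M A B \<le> interval_length R M A' B'"
proof (rule interval_length_le)
  fix k N
  assume "A' \<subseteq> A" "B \<subseteq> B'"
    and "\<And>i. i \<le> k \<Longrightarrow> submodule R (N i) M \<and> A \<subseteq> N i \<and> N i \<subseteq> B" "\<And>i. i < k \<Longrightarrow> N i \<subset> N (Suc i)"
  then show "enat k \<le> interval_length R M A' B'"
    by (intro interval_length_ge[of k R N]) (meson subset_trans, simp)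
qed

lemma SUP_enat_add_le:
  assumes "X \<noteq> {}" "\<And>k. k \<in> X \<Longrightarrow> enat k + c \<le> d"
  shows "(SUP k\<in>X. enat k) + c \<le> d"
proof (cases c)
  case (enat c')
  obtain k where "k \<in> X" using assms(1) by blast
  have "c \<le> enat k + c" by simp
  also have "\<dots> \<le> d" using \<open>k \<in> X\<close> by (rule assms(2))
  finally have "c \<le> d" .
  have "(SUP k\<in>X. enat k) \<le> d - c"
  proof (rule SUP_least)
    fix k assume "k \<in> X"
    from assms(2)[OF this] show "enat k \<le> d - c" using enat by (cases d) auto
  qed
  then have "(SUP k\<in>X. enat k) + c \<le> d - c + c" by (rule add_right_mono)
  then show ?thesis using \<open>c \<le> d\<close> enat by (cases d) auto
next
  case infinity
  obtain k where "k \<in> X" using assms(1) by blast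
  from assms(2)[OF this] infinity show ?thesis by simp
qed

lemma interval_length_add_le:
  assumes "submodule R A M" "A \<subseteq> B"
    and "\<And>k N. (\<And>i. i \<le> k \<Longrightarrow> submodule R (N i) M \<and> A \<subseteq> N i \<and> N i \<subseteq> B) \<Longrightarrow>
      (\<And>i. i < k \<Longrightarrow> N i \<subset> N (Suc i)) \<Longrightarrow> enat k + c \<le> d"
  shows "interval_length R M A B + c \<le> d"
  unfolding interval_length_def
proof (rule SUP_enat_add_le)
  show "{k. \<exists>N. (\<forall>i\<le>k. submodule R (N i) M \<and> A \<subseteq> N i \<and> N i \<subseteq> B) \<and> (\<forall>i<k. N i \<subset> N (Suc i))} \<noteq> {}"
  proof -
    have "\<exists>N. (\<forall>i\<le>0. submodule R (N i) M \<and> A \<subseteq> N i \<and> N i \<subseteq> B) \<and> (\<forall>i<0. N i \<subset> N (Suc i))"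
      using assms(1,2) by (intro exI[of _ "\<lambda>_. A"]) simp
    then show ?thesis by blast
  qed
next
  fix k assume "k \<in> {k. \<exists>N. (\<forall>i\<le>k. submodule R (N i) M \<and> A \<subseteq> N i \<and> N i \<subseteq> B) \<and> (\<forall>i<k. N i \<subset> N (Suc i))}"
  then obtain N where N: "\<forall>i\<le>k. submodule R (N i) M \<and> A \<subseteq> N i \<and> N i \<subseteq> B" "\<forall>i<k. N i \<subset> N (Suc i)"
    by blast
  show "enat k + c \<le> d" by (rule assms(3)[of k N]) (use N in simp_all)
qed

text \<open>This transports lengths to quotients, to the coefficient field, and along multiplication by a
  regular element.\<close>

lemma interval_length_le_map:
  assumes "\<And>X. submodule R X M \<Longrightarrow> A \<subseteq> X \<Longrightarrow> X \<subseteq> B \<Longrightarrow>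
      submodule R' (F X) M' \<and> A' \<subseteq> F X \<and> F X \<subseteq> B'"
    and "\<And>X Y. submodule R X M \<Longrightarrow> submodule R Y M \<Longrightarrow> A \<subseteq> X \<Longrightarrow> X \<subset> Y \<Longrightarrow> Y \<subseteq> B \<Longrightarrow> F X \<subset> F Y"
  shows "interval_length R M A B \<le> interval_length R' M' A' B'"
proof (rule interval_length_le)
  fix k N
  assume N: "\<And>i. i \<le> k \<Longrightarrow> submodule R (N i) M \<and> A \<subseteq> N i \<and> N i \<subseteq> B" "\<And>i. i < k \<Longrightarrow> N i \<subset> N (Suc i)"
  show "enat k \<le> interval_length R' M' A' B'"
  proof (rule interval_length_ge)
    fix i assume "i \<le> k"
    then show "submodule R' (F (N i)) M' \<and> A' \<subseteq> F (N i) \<and> F (N i) \<subseteq> B'"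
      using N(1)[of i] assms(1)[of "N i"] by simp
  next
    fix i assume "i < k"
    then show "F (N i) \<subset> F (N (Suc i))"
      using N(1)[of i] N(1)[of "Suc i"] N(2)[of i] by (intro assms(2)) simp_all
  qed
qed

lemma module_length_eq:
  "module_length R M = interval_length R M {\<zero>\<^bsub>M\<^esub>} (carrier M)"
proof -
  have "submodule R N M \<and> {\<zero>\<^bsub>M\<^esub>} \<subseteq> N \<and> N \<subseteq> carrier M \<longleftrightarrow> submodule R N M" for N
    by (auto dest: submodule.subset submodule.zero_closed)
  then show ?thesis unfolding module_length_def interval_length_def by simp
qed

lemma interval_length_step:
  assumes "submodule R X M" "submodule R Y M" "A \<subseteq> X" "X \<subset> Y" "submodule R A M"
  shows "interval_length R M A X + 1 \<le> interval_length R M A Y"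
proof (rule interval_length_add_le[OF assms(5,3)])
  fix k N
  assume N: "\<And>i. i \<le> k \<Longrightarrow> submodule R (N i) M \<and> A \<subseteq> N i \<and> N i \<subseteq> X" "\<And>i. i < k \<Longrightarrow> N i \<subset> N (Suc i)"
  have "enat (Suc k) \<le> interval_length R M A Y"
  proof (rule interval_length_ge)
    fix i assume "i \<le> Suc k"
    then show "submodule R ((N(Suc k := Y)) i) M \<and> A \<subseteq> (N(Suc k := Y)) i \<and> (N(Suc k := Y)) i \<subseteq> Y"
      using N(1)[of i] assms by (cases "i = Suc k") auto
  next
    fix i assume "i < Suc k"
    then show "(N(Suc k := Y)) i \<subset> (N(Suc k := Y)) (Suc i)"
      using N(1)[of i] N(2)[of i] assms(4) by (cases "i = k") auto
  qed
  then show "enat k + 1 \<le> interval_length R M A Y" by (simp add: one_enat_def)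
qed

context Module.module
begin

lemma submodule_uminus:
  assumes "submodule R N M" "v \<in> N"
  shows "\<ominus>\<^bsub>M\<^esub> v \<in> N"
proof -
  have "v \<in> carrier M" using submodule.subset[OF assms(1)] assms(2) by blast
  then show ?thesis
    using submodule.smult_closed[OF assms(1) _ assms(2), of "\<ominus> \<one>"] by (simp add: smult_minus_1)
qed

lemma submodule_minus: "submodule R N M \<Longrightarrow> v \<in> N \<Longrightarrow> w \<in> N \<Longrightarrow> v \<ominus>\<^bsub>M\<^esub> w \<in> N"
  unfolding a_minus_def by (simp add: submodule_uminus submodule.m_closed)

lemma submodule_Int: "submodule R X M \<Longrightarrow> submodule R Y M \<Longrightarrow> submodule R (X \<inter> Y) M"
  unfolding submodule_def by auto

lemma submodule_zero: "submodule R {\<zero>\<^bsub>M\<^esub>} M"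
  using module_axioms unfolding submodule_def by auto

lemma submodule_carrier: "submodule R (carrier M) M"
  using module_axioms unfolding submodule_def by auto

lemma submodule_set_add:
  assumes "submodule R X M" "submodule R Y M"
  shows "submodule R (X <+>\<^bsub>M\<^esub> Y) M"
proof -
  note X = submodule.subset[OF assms(1)] submodule.zero_closed[OF assms(1)]
    submodule.m_closed[OF assms(1)] submodule.smult_closed[OF assms(1)]
  note Y = submodule.subset[OF assms(2)] submodule.zero_closed[OF assms(2)]
    submodule.m_closed[OF assms(2)] submodule.smult_closed[OF assms(2)]
  show ?thesis
    unfolding submodule_def
  proof (intro conjI allI impI)
    show "Module.module R M" by (rule module_axioms)
    show "X <+>\<^bsub>M\<^esub> Y \<subseteq> carrier M" using X(1) Y(1) unfolding set_add_def' by auto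
    show "\<zero>\<^bsub>M\<^esub> \<in> X <+>\<^bsub>M\<^esub> Y" using X(2) Y(2) unfolding set_add_def' by force
    fix v w assume "v \<in> X <+>\<^bsub>M\<^esub> Y" "w \<in> X <+>\<^bsub>M\<^esub> Y"
    then obtain x y x' y' where xy: "x \<in> X" "y \<in> Y" "x' \<in> X" "y' \<in> Y" "v = x \<oplus>\<^bsub>M\<^esub> y" "w = x' \<oplus>\<^bsub>M\<^esub> y'"
      unfolding set_add_def' by auto
    have "x \<in> carrier M" "x' \<in> carrier M" "y \<in> carrier M" "y' \<in> carrier M"
      using xy X(1) Y(1) by auto
    then have "v \<oplus>\<^bsub>M\<^esub> w = (x \<oplus>\<^bsub>M\<^esub> x') \<oplus>\<^bsub>M\<^esub> (y \<oplus>\<^bsub>M\<^esub> y')"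
      unfolding xy by (simp add: M.a_ac)
    then show "v \<oplus>\<^bsub>M\<^esub> w \<in> X <+>\<^bsub>M\<^esub> Y" using X(3)[OF xy(1,3)] Y(3)[OF xy(2,4)] unfolding set_add_def' by blast
  next
    fix c v assume c: "c \<in> carrier R" and "v \<in> X <+>\<^bsub>M\<^esub> Y"
    then obtain x y where xy: "x \<in> X" "y \<in> Y" "v = x \<oplus>\<^bsub>M\<^esub> y" unfolding set_add_def' by auto
    then have "c \<odot>\<^bsub>M\<^esub> v = c \<odot>\<^bsub>M\<^esub> x \<oplus>\<^bsub>M\<^esub> c \<odot>\<^bsub>M\<^esub> y"
      using X(1) Y(1) c by (simp add: subset_iff smult_r_distr)
    then show "c \<odot>\<^bsub>M\<^esub> v \<in> X <+>\<^bsub>M\<^esub> Y" using X(4)[OF c xy(1)] Y(4)[OF c xy(2)] unfolding set_add_def' by blast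
  qed
qed

lemma set_add_upper:
  assumes "submodule R X M" "submodule R Y M"
  shows "X \<subseteq> X <+>\<^bsub>M\<^esub> Y" "Y \<subseteq> X <+>\<^bsub>M\<^esub> Y"
  using submodule.subset[OF assms(1)] submodule.zero_closed[OF assms(1)]
    submodule.subset[OF assms(2)] submodule.zero_closed[OF assms(2)]
  unfolding set_add_def' by (force simp: subset_iff)+

lemma set_add_least:
  assumes "submodule R Z M" "X \<subseteq> Z" "Y \<subseteq> Z"
  shows "X <+>\<^bsub>M\<^esub> Y \<subseteq> Z"
  using submodule.m_closed[OF assms(1)] assms unfolding set_add_def' by auto

lemma submodule_modular:
  assumes "submodule R X M" "submodule R Y M" "submodule R B M" "X \<subseteq> Y"
    and "X \<inter> B = Y \<inter> B" "X <+>\<^bsub>M\<^esub> B = Y <+>\<^bsub>M\<^esub> B"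
  shows "X = Y"
proof
  show "Y \<subseteq> X"
  proof
    fix y assume y: "y \<in> Y"
    then have "y \<in> X <+>\<^bsub>M\<^esub> B" using set_add_upper(1)[OF assms(2,3)] assms(6) by auto
    then obtain x b where xb: "x \<in> X" "b \<in> B" "y = x \<oplus>\<^bsub>M\<^esub> b" unfolding set_add_def' by auto
    have c: "x \<in> carrier M" "b \<in> carrier M"
      using xb assms(1,3) by (auto dest: submodule.subset)
    then have "b = y \<ominus>\<^bsub>M\<^esub> x" unfolding xb(3) by (simp add: a_minus_def M.a_ac M.r_neg M.r_neg1 M.r_neg2)
    then have "b \<in> Y" using submodule_minus[OF assms(2) y, of x] xb(1) assms(4) by auto
    then have "b \<in> X" using xb(2) assms(5) by auto
    then show "y \<in> X" using submodule.m_closed[OF assms(1)] xb by auto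
  qed
qed (rule assms)

text \<open>By the modular law each step of a chain between \<open>A\<close> and \<open>C\<close> is visible after intersecting
  with \<open>B\<close> or after adding \<open>B\<close>. Conversely, chains above and below \<open>B\<close> can be concatenated.\<close>

lemma interval_length_add:
  assumes "submodule R A M" "submodule R B M" "submodule R C M" "A \<subseteq> B" "B \<subseteq> C"
  shows "interval_length R M A C = interval_length R M A B + interval_length R M B C"
proof (rule antisym)
  let ?L = "interval_length R M"
  show "?L A C \<le> ?L A B + ?L B C"
  proof (rule interval_length_le)
    fix k N
    assume N: "\<And>i. i \<le> k \<Longrightarrow> submodule R (N i) M \<and> A \<subseteq> N i \<and> N i \<subseteq> C" "\<And>i. i < k \<Longrightarrow> N i \<subset> N (Suc i)"
    have "i \<le> k \<Longrightarrow> enat i \<le> ?L A (N i \<inter> B) + ?L B (N i <+>\<^bsub>M\<^esub> B)" for i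
    proof (induction i)
      case 0
      then show ?case by (simp add: enat_0)
    next
      case (Suc i)
      then have Ni: "submodule R (N i) M" "A \<subseteq> N i" "submodule R (N (Suc i)) M" "N i \<subset> N (Suc i)"
        using N by auto
      have IH: "enat i \<le> ?L A (N i \<inter> B) + ?L B (N i <+>\<^bsub>M\<^esub> B)" using Suc by simp
      have le: "N i \<inter> B \<subseteq> N (Suc i) \<inter> B" "N i <+>\<^bsub>M\<^esub> B \<subseteq> N (Suc i) <+>\<^bsub>M\<^esub> B"
        using Ni unfolding set_add_def' by auto
      have "enat (Suc i) = enat i + 1" by (simp add: one_enat_def)
      also have "\<dots> \<le> ?L A (N i \<inter> B) + ?L B (N i <+>\<^bsub>M\<^esub> B) + 1" using IH by (rule add_right_mono)
      also have "\<dots> \<le> ?L A (N (Suc i) \<inter> B) + ?L B (N (Suc i) <+>\<^bsub>M\<^esub> B)"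
      proof (cases "N i \<inter> B = N (Suc i) \<inter> B")
        case True
        then have "N i <+>\<^bsub>M\<^esub> B \<noteq> N (Suc i) <+>\<^bsub>M\<^esub> B"
          using submodule_modular[OF Ni(1,3) assms(2)] Ni(4) by auto
        then have "?L B (N i <+>\<^bsub>M\<^esub> B) + 1 \<le> ?L B (N (Suc i) <+>\<^bsub>M\<^esub> B)"
          using le Ni assms
          by (intro interval_length_step submodule_set_add set_add_upper(2)[OF Ni(1)]) auto
        then show ?thesis using True by (simp add: add.assoc add_left_mono)
      next
        case False
        then have step: "?L A (N i \<inter> B) + 1 \<le> ?L A (N (Suc i) \<inter> B)"
          using le Ni assms(1,4)
          by (intro interval_length_step submodule_Int[OF Ni(1) assms(2)] submodule_Int[OF Ni(3) assms(2)]) auto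
        have "?L A (N i \<inter> B) + ?L B (N i <+>\<^bsub>M\<^esub> B) + 1 = (?L A (N i \<inter> B) + 1) + ?L B (N i <+>\<^bsub>M\<^esub> B)"
          by (simp add: ac_simps)
        also have "\<dots> \<le> ?L A (N (Suc i) \<inter> B) + ?L B (N (Suc i) <+>\<^bsub>M\<^esub> B)"
          by (rule add_mono[OF step interval_length_mono[OF order_refl le(2)]])
        finally show ?thesis .
      qed
      finally show ?case .
    qed
    from this[of k] have "enat k \<le> ?L A (N k \<inter> B) + ?L B (N k <+>\<^bsub>M\<^esub> B)" by simp
    also have "\<dots> \<le> ?L A B + ?L B C"
      using N(1)[of k] assms by (intro add_mono interval_length_mono set_add_least) auto
    finally show "enat k \<le> ?L A B + ?L B C" .
  qed
  have "?L B C + ?L A B \<le> ?L A C"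
  proof (rule interval_length_add_le[OF assms(2,5)])
    fix k N
    assume N: "\<And>i. i \<le> k \<Longrightarrow> submodule R (N i) M \<and> B \<subseteq> N i \<and> N i \<subseteq> C" "\<And>i. i < k \<Longrightarrow> N i \<subset> N (Suc i)"
    have "i \<le> k \<Longrightarrow> enat i + ?L A B \<le> ?L A (N i)" for i
    proof (induction i)
      case 0
      then show ?case using N(1)[of 0] by (simp add: enat_0 interval_length_mono)
    next
      case (Suc i)
      have "enat (Suc i) + ?L A B = (enat i + ?L A B) + 1" by (simp add: eSuc_enat[symmetric] eSuc_plus_1 ac_simps)
      also have "\<dots> \<le> ?L A (N i) + 1" using Suc by (intro add_right_mono) simp
      also have "\<dots> \<le> ?L A (N (Suc i))"
        using Suc.prems N(1)[of i] N(1)[of "Suc i"] N(2)[of i] assms(1,4) by (intro interval_length_step) auto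
      finally show ?case .
    qed
    from this[of k] show "enat k + ?L A B \<le> ?L A C"
      using N(1)[of k] by (meson interval_length_mono le_refl order_trans subset_refl)
  qed
  then show "?L A B + ?L B C \<le> ?L A C" by (simp add: add.commute)
qed

subsection \<open>Quotient modules\<close>

lemma quot_module_simps [simp]:
  "carrier (quot_module M N) = a_rcosets\<^bsub>M\<^esub> N" "zero (quot_module M N) = N"
  "add (quot_module M N) = set_add M"
  "smult (quot_module M N) = (\<lambda>r C. \<Union>x\<in>C. N +>\<^bsub>M\<^esub> (r \<odot>\<^bsub>M\<^esub> x))"
  by (simp_all add: quot_module_def)

context
  fixes N assumes N: "submodule R N M"
begin

abbreviation MN :: "('a, 'c set) module" where
  "MN \<equiv> quot_module M N"

lemma submodule_abelian_subgroup: "abelian_subgroup N M"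
proof (rule abelian_subgroupI3)
  show "additive_subgroup N M"
    using submodule.subset[OF N] submodule.m_closed[OF N] submodule.zero_closed[OF N] submodule_uminus[OF N]
    by (auto intro!: additive_subgroup.intro M.add.subgroupI)
qed (rule M.abelian_group_axioms)

interpretation N: abelian_subgroup N M by (rule submodule_abelian_subgroup)

lemma coset_repr: "y \<in> N +>\<^bsub>M\<^esub> x \<Longrightarrow> x \<in> carrier M \<Longrightarrow> N +>\<^bsub>M\<^esub> y = N +>\<^bsub>M\<^esub> x"
  using M.a_repr_independence[of y N x] N.a_subgroup by simp

lemma coset_smult:
  assumes "r \<in> carrier R" "x \<in> carrier M"
  shows "smult MN r (N +>\<^bsub>M\<^esub> x) = N +>\<^bsub>M\<^esub> (r \<odot>\<^bsub>M\<^esub> x)"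
proof -
  have "N +>\<^bsub>M\<^esub> (r \<odot>\<^bsub>M\<^esub> y) = N +>\<^bsub>M\<^esub> (r \<odot>\<^bsub>M\<^esub> x)" if y: "y \<in> N +>\<^bsub>M\<^esub> x" for y
  proof -
    obtain v where v: "v \<in> N" "y = v \<oplus>\<^bsub>M\<^esub> x" using y unfolding a_r_coset_def' by auto
    then have "r \<odot>\<^bsub>M\<^esub> y = r \<odot>\<^bsub>M\<^esub> v \<oplus>\<^bsub>M\<^esub> r \<odot>\<^bsub>M\<^esub> x"
      using submodule.subset[OF N] assms by (auto simp: smult_r_distr)
    then have "r \<odot>\<^bsub>M\<^esub> y \<in> N +>\<^bsub>M\<^esub> (r \<odot>\<^bsub>M\<^esub> x)"
      using submodule.smult_closed[OF N] v assms unfolding a_r_coset_def' by auto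
    then show ?thesis using coset_repr[of "r \<odot>\<^bsub>M\<^esub> y" "r \<odot>\<^bsub>M\<^esub> x"] assms by auto
  qed
  moreover have "N +>\<^bsub>M\<^esub> x \<noteq> {}" using N.a_rcos_self[OF assms(2)] by blast
  ultimately show ?thesis unfolding quot_module_simps by (intro SUP_eq_const)
qed

lemma coset_add:
  assumes "x \<in> carrier M" "y \<in> carrier M"
  shows "(N +>\<^bsub>M\<^esub> x) <+>\<^bsub>M\<^esub> (N +>\<^bsub>M\<^esub> y) = N +>\<^bsub>M\<^esub> (x \<oplus>\<^bsub>M\<^esub> y)"
  using N.a_rcos_sum assms by auto

lemma coset_carrier: "C \<in> a_rcosets\<^bsub>M\<^esub> N \<longleftrightarrow> (\<exists>x\<in>carrier M. C = N +>\<^bsub>M\<^esub> x)"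
  unfolding A_RCOSETS_def' by auto

lemma coset_eq_iff:
  assumes "x \<in> carrier M" "y \<in> carrier M"
  shows "N +>\<^bsub>M\<^esub> x = N +>\<^bsub>M\<^esub> y \<longleftrightarrow> x \<ominus>\<^bsub>M\<^esub> y \<in> N"
proof
  assume "N +>\<^bsub>M\<^esub> x = N +>\<^bsub>M\<^esub> y"
  then have "x \<in> N +>\<^bsub>M\<^esub> y" using N.a_rcos_self assms by auto
  then show "x \<ominus>\<^bsub>M\<^esub> y \<in> N" using N.a_rcos_module assms by (auto simp: a_minus_def)
next
  assume "x \<ominus>\<^bsub>M\<^esub> y \<in> N"
  then have "x \<in> N +>\<^bsub>M\<^esub> y" using N.a_rcos_module assms by (auto simp: a_minus_def)
  then show "N +>\<^bsub>M\<^esub> x = N +>\<^bsub>M\<^esub> y" using coset_repr[of x y] assms by auto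
qed

lemma coset_zero: "x \<in> N \<Longrightarrow> N +>\<^bsub>M\<^esub> x = N"
  using N.a_rcos_const by auto

lemma quot_ops:
  "x \<in> carrier M \<Longrightarrow> N +>\<^bsub>M\<^esub> x \<in> carrier MN"
  "\<zero>\<^bsub>MN\<^esub> = N +>\<^bsub>M\<^esub> \<zero>\<^bsub>M\<^esub>"
  "x \<in> carrier M \<Longrightarrow> y \<in> carrier M \<Longrightarrow>
     (N +>\<^bsub>M\<^esub> x) \<oplus>\<^bsub>MN\<^esub> (N +>\<^bsub>M\<^esub> y) = N +>\<^bsub>M\<^esub> (x \<oplus>\<^bsub>M\<^esub> y)"
proof -
  show "x \<in> carrier M \<Longrightarrow> N +>\<^bsub>M\<^esub> x \<in> carrier MN"
    unfolding quot_module_simps coset_carrier by blast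
  show "\<zero>\<^bsub>MN\<^esub> = N +>\<^bsub>M\<^esub> \<zero>\<^bsub>M\<^esub>"
    unfolding quot_module_simps by (rule coset_zero[OF submodule.zero_closed[OF N], symmetric])
  show "x \<in> carrier M \<Longrightarrow> y \<in> carrier M \<Longrightarrow>
     (N +>\<^bsub>M\<^esub> x) \<oplus>\<^bsub>MN\<^esub> (N +>\<^bsub>M\<^esub> y) = N +>\<^bsub>M\<^esub> (x \<oplus>\<^bsub>M\<^esub> y)"
    unfolding quot_module_simps by (rule coset_add)
qed

lemma quot_carrierE:
  assumes "v \<in> carrier MN"
  obtains x where "x \<in> carrier M" "v = N +>\<^bsub>M\<^esub> x"
  using assms that by (simp only: quot_module_simps coset_carrier) (erule bexE)

lemma quot_module_module: "Module.module R MN"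
proof (rule module_criteria)
  note ops = quot_ops coset_smult
  show "cring R" by (rule R.cring_axioms)
  show "\<zero>\<^bsub>MN\<^esub> \<in> carrier MN"
    using ops(1)[of "\<zero>\<^bsub>M\<^esub>"] unfolding ops(2) by simp
  show "\<forall>v\<in>carrier MN. \<exists>w\<in>carrier MN.
      v \<oplus>\<^bsub>MN\<^esub> w = \<zero>\<^bsub>MN\<^esub>"
  proof
    fix v assume "v \<in> carrier MN"
    then obtain x where x: "x \<in> carrier M" "v = N +>\<^bsub>M\<^esub> x" by (rule quot_carrierE)
    then have "v \<oplus>\<^bsub>MN\<^esub> (N +>\<^bsub>M\<^esub> (\<ominus>\<^bsub>M\<^esub> x)) = \<zero>\<^bsub>MN\<^esub>"
      by (simp only: ops M.a_inv_closed M.r_neg)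
    moreover have "N +>\<^bsub>M\<^esub> (\<ominus>\<^bsub>M\<^esub> x) \<in> carrier MN"
      using x by (intro ops M.a_inv_closed)
    ultimately show "\<exists>w\<in>carrier MN. v \<oplus>\<^bsub>MN\<^esub> w = \<zero>\<^bsub>MN\<^esub>"
      by blast
  qed
next
  show "\<forall>v w. v \<in> carrier MN \<and> w \<in> carrier MN \<longrightarrow>
      v \<oplus>\<^bsub>MN\<^esub> w \<in> carrier MN"
    by (intro allI impI, elim conjE quot_carrierE, simp only: quot_ops M.add.m_closed)
  show "\<forall>c v. c \<in> carrier R \<and> v \<in> carrier MN \<longrightarrow>
      c \<odot>\<^bsub>MN\<^esub> v \<in> carrier MN"
    by (intro allI impI, elim conjE quot_carrierE, simp only: quot_ops coset_smult smult_closed)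
  show "\<forall>v w. v \<in> carrier MN \<and> w \<in> carrier MN \<longrightarrow>
      v \<oplus>\<^bsub>MN\<^esub> w = w \<oplus>\<^bsub>MN\<^esub> v"
  proof (intro allI impI, elim conjE quot_carrierE)
    fix v w x y assume "x \<in> carrier M" "v = N +>\<^bsub>M\<^esub> x" "y \<in> carrier M" "w = N +>\<^bsub>M\<^esub> y"
    then show "v \<oplus>\<^bsub>MN\<^esub> w = w \<oplus>\<^bsub>MN\<^esub> v"
      using M.a_comm[of x y] by (simp only: quot_ops)
  qed
  show "\<forall>v w u. v \<in> carrier MN \<and> w \<in> carrier MN \<and> u \<in> carrier MN \<longrightarrow>
      v \<oplus>\<^bsub>MN\<^esub> w \<oplus>\<^bsub>MN\<^esub> u = v \<oplus>\<^bsub>MN\<^esub> (w \<oplus>\<^bsub>MN\<^esub> u)"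
    by (intro allI impI, elim conjE quot_carrierE, simp only: quot_ops M.add.m_closed M.a_assoc)
  show "\<forall>v\<in>carrier MN. v \<oplus>\<^bsub>MN\<^esub> \<zero>\<^bsub>MN\<^esub> = v"
    by (intro ballI, elim quot_carrierE, simp only: quot_ops M.zero_closed M.r_zero)
  show "\<forall>b c v. b \<in> carrier R \<and> c \<in> carrier R \<and> v \<in> carrier MN \<longrightarrow>
      b \<otimes> c \<odot>\<^bsub>MN\<^esub> v = b \<odot>\<^bsub>MN\<^esub> (c \<odot>\<^bsub>MN\<^esub> v)"
    by (intro allI impI, elim conjE quot_carrierE,
        simp only: quot_ops coset_smult smult_closed R.m_closed smult_assoc1)
  show "\<forall>v\<in>carrier MN. \<one> \<odot>\<^bsub>MN\<^esub> v = v"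
    by (intro ballI, elim quot_carrierE, simp only: coset_smult R.one_closed smult_one)
  show "\<forall>b c v. b \<in> carrier R \<and> c \<in> carrier R \<and> v \<in> carrier MN \<longrightarrow>
      (b \<oplus> c) \<odot>\<^bsub>MN\<^esub> v =
      b \<odot>\<^bsub>MN\<^esub> v \<oplus>\<^bsub>MN\<^esub> c \<odot>\<^bsub>MN\<^esub> v"
    by (intro allI impI, elim conjE quot_carrierE,
        simp only: quot_ops coset_smult smult_closed R.a_closed smult_l_distr)
  show "\<forall>c v w. c \<in> carrier R \<and> v \<in> carrier MN \<and> w \<in> carrier MN \<longrightarrow>
      c \<odot>\<^bsub>MN\<^esub> (v \<oplus>\<^bsub>MN\<^esub> w) =
      c \<odot>\<^bsub>MN\<^esub> v \<oplus>\<^bsub>MN\<^esub> c \<odot>\<^bsub>MN\<^esub> w"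
    by (intro allI impI, elim conjE quot_carrierE,
        simp only: quot_ops coset_smult smult_closed M.add.m_closed smult_r_distr)
qed

text \<open>Preimages and images under \<open>M \<rightarrow> M / N\<close> identify the submodules of \<open>M / N\<close> with those of \<open>M\<close> that
  contain \<open>N\<close>, and thereby the length of \<open>M / N\<close> with that of an interval.\<close>

lemma submodule_preimage_coset:
  assumes "submodule R Q MN"
  shows "submodule R {x \<in> carrier M. N +>\<^bsub>M\<^esub> x \<in> Q} M"
  unfolding submodule_def
proof (intro conjI allI impI)
  show "Module.module R M" by (rule module_axioms)
  show "{x \<in> carrier M. N +>\<^bsub>M\<^esub> x \<in> Q} \<subseteq> carrier M" by blast
  show "\<zero>\<^bsub>M\<^esub> \<in> {x \<in> carrier M. N +>\<^bsub>M\<^esub> x \<in> Q}"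
    using submodule.zero_closed[OF assms] unfolding quot_ops(2) by simp
  fix x y assume "x \<in> {x \<in> carrier M. N +>\<^bsub>M\<^esub> x \<in> Q}" "y \<in> {x \<in> carrier M. N +>\<^bsub>M\<^esub> x \<in> Q}"
  then show "x \<oplus>\<^bsub>M\<^esub> y \<in> {x \<in> carrier M. N +>\<^bsub>M\<^esub> x \<in> Q}"
    using submodule.m_closed[OF assms, of "N +>\<^bsub>M\<^esub> x" "N +>\<^bsub>M\<^esub> y"]
    by (simp add: quot_ops del: quot_module_simps)
next
  fix r x assume "r \<in> carrier R" "x \<in> {x \<in> carrier M. N +>\<^bsub>M\<^esub> x \<in> Q}"
  then show "r \<odot>\<^bsub>M\<^esub> x \<in> {x \<in> carrier M. N +>\<^bsub>M\<^esub> x \<in> Q}"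
    using submodule.smult_closed[OF assms, of r "N +>\<^bsub>M\<^esub> x"]
    by (simp add: coset_smult del: quot_module_simps)
qed

lemma submodule_image_coset:
  assumes "submodule R X M"
  shows "submodule R ((+>\<^bsub>M\<^esub>) N ` X) MN"
  unfolding submodule_def
proof (intro conjI allI impI)
  note X = submodule.subset[OF assms] submodule.m_closed[OF assms] submodule.smult_closed[OF assms]
  show "Module.module R MN" by (rule quot_module_module)
  show "(+>\<^bsub>M\<^esub>) N ` X \<subseteq> carrier MN" using X(1) by (simp add: coset_carrier subset_iff) blast
  show "\<zero>\<^bsub>MN\<^esub> \<in> (+>\<^bsub>M\<^esub>) N ` X"
    using coset_zero[OF submodule.zero_closed[OF N]] submodule.zero_closed[OF assms] by force
  fix v w assume "v \<in> (+>\<^bsub>M\<^esub>) N ` X" "w \<in> (+>\<^bsub>M\<^esub>) N ` X"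
  then obtain x y where xy: "x \<in> X" "y \<in> X" "v = N +>\<^bsub>M\<^esub> x" "w = N +>\<^bsub>M\<^esub> y" by auto
  then show "v \<oplus>\<^bsub>MN\<^esub> w \<in> (+>\<^bsub>M\<^esub>) N ` X"
    using X by (auto simp: coset_add subset_iff)
next
  note X = submodule.subset[OF assms] submodule.m_closed[OF assms] submodule.smult_closed[OF assms]
  fix c v assume c: "c \<in> carrier R" "v \<in> (+>\<^bsub>M\<^esub>) N ` X"
  then obtain x where "x \<in> X" "v = N +>\<^bsub>M\<^esub> x" by auto
  then show "c \<odot>\<^bsub>MN\<^esub> v \<in> (+>\<^bsub>M\<^esub>) N ` X"
    using X c by (subst \<open>v = _\<close>, subst coset_smult) auto
qed

lemma module_length_quot:
  "module_length R MN = interval_length R M N (carrier M)"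
  unfolding module_length_eq
proof (rule antisym)
  let ?P = "\<lambda>Q. {x \<in> carrier M. N +>\<^bsub>M\<^esub> x \<in> Q}" and ?I = "\<lambda>X. (+>\<^bsub>M\<^esub>) N ` X"
  show "interval_length R MN {\<zero>\<^bsub>MN\<^esub>} (carrier MN)
      \<le> interval_length R M N (carrier M)"
  proof (rule interval_length_le_map[where F = ?P], goal_cases)
    case (1 Q)
    have "N \<in> Q" using 1(2) by simp
    then have "N \<subseteq> ?P Q" using submodule.subset[OF N] coset_zero by (intro subsetI CollectI conjI) auto
    then show ?case using submodule_preimage_coset[OF 1(1)] by blast
  next
    case (2 Q Q')
    then obtain C where C: "C \<in> Q'" "C \<notin> Q" by blast
    then have "C \<in> a_rcosets\<^bsub>M\<^esub> N" using submodule.subset[OF 2(2)] by auto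
    then obtain x where "x \<in> carrier M" "C = N +>\<^bsub>M\<^esub> x" unfolding coset_carrier by blast
    then have "x \<in> ?P Q'" "x \<notin> ?P Q" using C by auto
    then show ?case using 2(4) by blast
  qed
  show "interval_length R M N (carrier M)
      \<le> interval_length R MN {\<zero>\<^bsub>MN\<^esub>} (carrier MN)"
  proof (rule interval_length_le_map[where F = ?I], goal_cases)
    case (1 X)
    note sub = submodule_image_coset[OF 1(1)]
    show ?case using sub submodule.subset[OF sub] submodule.zero_closed[OF sub] by blast
  next
    case (2 X Y)
    then obtain y where y: "y \<in> Y" "y \<notin> X" by blast
    have yc: "y \<in> carrier M" using y 2(2) submodule.subset by blast
    have "N +>\<^bsub>M\<^esub> y \<notin> ?I X"
    proof
      assume "N +>\<^bsub>M\<^esub> y \<in> ?I X"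
      then obtain x where x: "x \<in> X" "N +>\<^bsub>M\<^esub> y = N +>\<^bsub>M\<^esub> x" by auto
      have xc: "x \<in> carrier M" using x 2(1) submodule.subset by blast
      then have "y \<ominus>\<^bsub>M\<^esub> x \<in> X" using x yc coset_eq_iff 2(3) by auto
      then have "(y \<ominus>\<^bsub>M\<^esub> x) \<oplus>\<^bsub>M\<^esub> x \<in> X" using x submodule.m_closed[OF 2(1)] by auto
      then show False using y xc yc by (simp add: a_minus_def M.a_assoc M.l_neg)
    qed
    then show ?case using 2(4) y by blast
  qed
qed

end

lemma submodule_smult_image:
  assumes "r \<in> carrier R" "submodule R X M"
  shows "submodule R ((\<odot>\<^bsub>M\<^esub>) r ` X) M"
  unfolding submodule_def
proof (intro conjI allI impI)
  note X = submodule.subset[OF assms(2)] submodule.m_closed[OF assms(2)] submodule.smult_closed[OF assms(2)]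
  show "Module.module R M" by (rule module_axioms)
  show "(\<odot>\<^bsub>M\<^esub>) r ` X \<subseteq> carrier M" using X(1) assms by auto
  show "\<zero>\<^bsub>M\<^esub> \<in> (\<odot>\<^bsub>M\<^esub>) r ` X" using submodule.zero_closed[OF assms(2)] assms by (intro image_eqI[of _ _ "\<zero>\<^bsub>M\<^esub>"]) auto
  fix v w assume "v \<in> (\<odot>\<^bsub>M\<^esub>) r ` X" "w \<in> (\<odot>\<^bsub>M\<^esub>) r ` X"
  then obtain x y where xy: "x \<in> X" "y \<in> X" "v = r \<odot>\<^bsub>M\<^esub> x" "w = r \<odot>\<^bsub>M\<^esub> y" by auto
  then have "v \<oplus>\<^bsub>M\<^esub> w = r \<odot>\<^bsub>M\<^esub> (x \<oplus>\<^bsub>M\<^esub> y)"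
    using X(1) smult_r_distr[OF assms(1), of x y] by (simp add: subset_iff)
  then show "v \<oplus>\<^bsub>M\<^esub> w \<in> (\<odot>\<^bsub>M\<^esub>) r ` X" using X xy by auto
next
  note X = submodule.subset[OF assms(2)] submodule.m_closed[OF assms(2)] submodule.smult_closed[OF assms(2)]
  fix c v assume c: "c \<in> carrier R" "v \<in> (\<odot>\<^bsub>M\<^esub>) r ` X"
  then obtain x where x: "x \<in> X" "v = r \<odot>\<^bsub>M\<^esub> x" by auto
  have "c \<odot>\<^bsub>M\<^esub> v = r \<odot>\<^bsub>M\<^esub> (c \<odot>\<^bsub>M\<^esub> x)"
    using x c assms X(1) by (auto simp flip: smult_assoc1 simp: R.m_comm)
  then show "c \<odot>\<^bsub>M\<^esub> v \<in> (\<odot>\<^bsub>M\<^esub>) r ` X" using X x c by auto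
qed

lemma submodule_smult_vimage:
  assumes "r \<in> carrier R" "submodule R X M"
  shows "submodule R {x \<in> carrier M. r \<odot>\<^bsub>M\<^esub> x \<in> X} M"
proof -
  have "r \<odot>\<^bsub>M\<^esub> (c \<odot>\<^bsub>M\<^esub> v) = c \<odot>\<^bsub>M\<^esub> (r \<odot>\<^bsub>M\<^esub> v)" if "c \<in> carrier R" "v \<in> carrier M" for c v
    using that assms(1) R.m_comm[of r c] by (simp flip: smult_assoc1)
  then show ?thesis
    using module_axioms submodule.zero_closed[OF assms(2)] submodule.m_closed[OF assms(2)]
      submodule.smult_closed[OF assms(2)] assms(1)
    unfolding submodule_def by (simp add: smult_r_distr)
qed

text \<open>An injective multiplication by \<open>r\<close> identifies the submodules between \<open>A\<close> and \<open>B\<close> with those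
  between \<open>r A\<close> and \<open>r B\<close>; every submodule of \<open>r B\<close> is the image of its preimage.\<close>

lemma interval_length_smult:
  assumes r: "r \<in> carrier R" "\<And>x. x \<in> carrier M \<Longrightarrow> r \<odot>\<^bsub>M\<^esub> x = \<zero>\<^bsub>M\<^esub> \<Longrightarrow> x = \<zero>\<^bsub>M\<^esub>"
    and AB: "A \<subseteq> carrier M" "B \<subseteq> carrier M"
  shows "interval_length R M ((\<odot>\<^bsub>M\<^esub>) r ` A) ((\<odot>\<^bsub>M\<^esub>) r ` B) = interval_length R M A B"
proof (rule antisym)
  let ?F = "(`) ((\<odot>\<^bsub>M\<^esub>) r)" and ?G = "\<lambda>X. {x \<in> carrier M. r \<odot>\<^bsub>M\<^esub> x \<in> X}"
  have inj: "x = y" if "x \<in> carrier M" "y \<in> carrier M" "r \<odot>\<^bsub>M\<^esub> x = r \<odot>\<^bsub>M\<^esub> y" for x y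
  proof -
    have "r \<odot>\<^bsub>M\<^esub> (x \<ominus>\<^bsub>M\<^esub> y) = r \<odot>\<^bsub>M\<^esub> x \<ominus>\<^bsub>M\<^esub> r \<odot>\<^bsub>M\<^esub> y"
      using that r(1) by (simp add: a_minus_def smult_r_distr smult_r_minus)
    also have "\<dots> = \<zero>\<^bsub>M\<^esub>" using that r(1) by (simp add: a_minus_def M.r_neg)
    finally have "x \<ominus>\<^bsub>M\<^esub> y = \<zero>\<^bsub>M\<^esub>" using r(2)[of "x \<ominus>\<^bsub>M\<^esub> y"] that by blast
    then show ?thesis using that by simp
  qed
  show "interval_length R M A B \<le> interval_length R M (?F A) (?F B)"
  proof (rule interval_length_le_map[where F = ?F], goal_cases)
    case (1 X)
    then show ?case using submodule_smult_image[OF r(1) 1(1)] by blast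
  next
    case (2 X Y)
    then obtain y where y: "y \<in> Y" "y \<notin> X" by blast
    have "X \<subseteq> carrier M" "y \<in> carrier M" using y 2(1,2) submodule.subset by blast+
    then have "r \<odot>\<^bsub>M\<^esub> y \<notin> ?F X" using inj[of y] y by blast
    then show ?case using 2(4) y by blast
  qed
  show "interval_length R M (?F A) (?F B) \<le> interval_length R M A B"
  proof (rule interval_length_le_map[where F = ?G], goal_cases)
    case (1 X)
    have "A \<subseteq> ?G X" using 1(2) AB by blast
    moreover have "?G X \<subseteq> B"
    proof
      fix x assume x: "x \<in> ?G X"
      then have "r \<odot>\<^bsub>M\<^esub> x \<in> ?F B" by (intro subsetD[OF 1(3)]) simp
      then obtain b where b: "b \<in> B" "r \<odot>\<^bsub>M\<^esub> x = r \<odot>\<^bsub>M\<^esub> b" unfolding image_iff by (rule bexE)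
      have "x = b" using x b(1) AB by (intro inj[OF _ _ b(2)]) auto
      with b show "x \<in> B" by simp
    qed
    ultimately show ?case using submodule_smult_vimage[OF r(1) 1(1)] by blast
  next
    case (2 X Y)
    then obtain y where y: "y \<in> Y" "y \<notin> X" by blast
    then have "y \<in> ?F B" by (intro subsetD[OF 2(5)])
    then obtain b where "b \<in> B" "y = r \<odot>\<^bsub>M\<^esub> b" unfolding image_iff by (rule bexE)
    then have "b \<in> ?G Y" "b \<notin> ?G X" using y AB by auto
    then show ?case using 2(4) by blast
  qed
qed

end

subsection \<open>Vector spaces\<close>

context vectorspace
begin

lemma span_insert_elem:
  assumes "U \<subseteq> carrier V" "g \<in> carrier V" "x \<in> span (insert g U)"
  obtains w c where "w \<in> span U" "c \<in> carrier K" "x = w \<oplus>\<^bsub>V\<^esub> c \<odot>\<^bsub>V\<^esub> g"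
proof -
  let ?W = "span U <+>\<^bsub>V\<^esub> span {g}"
  have sub: "submodule K (span U) V" "submodule K (span {g}) V"
    using assms by (auto intro!: span_is_submodule)
  have "insert g U \<subseteq> ?W"
    using set_add_upper[OF sub] in_own_span[of U] in_own_span[of "{g}"] assms by auto
  then have "span (insert g U) \<subseteq> ?W" by (rule span_is_subset) (rule submodule_set_add[OF sub])
  then obtain w y where wy: "w \<in> span U" "y \<in> span {g}" "x = w \<oplus>\<^bsub>V\<^esub> y"
    using assms unfolding set_add_def' by auto
  obtain b where "b \<in> {g} \<rightarrow> carrier K" "lincomb b {g} = y"
    using finite_in_span[of "{g}" y] wy assms by auto
  then have "b g \<in> carrier K" "y = b g \<odot>\<^bsub>V\<^esub> g" using assms by (auto simp: lincomb_def)
  then show ?thesis using wy that by auto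
qed

text \<open>A vector of \<open>U + k g\<close> outside \<open>U\<close> has an invertible coefficient at \<open>g\<close>, so together with \<open>U\<close> it
  already generates \<open>g\<close>.\<close>

lemma interval_length_span_insert:
  assumes "U \<subseteq> carrier V" "g \<in> carrier V"
  shows "interval_length K V (span U) (span (insert g U)) \<le> 1"
proof (rule interval_length_le)
  fix k N
  assume N: "\<And>i. i \<le> k \<Longrightarrow> submodule K (N i) V \<and> span U \<subseteq> N i \<and> N i \<subseteq> span (insert g U)"
    "\<And>i. i < k \<Longrightarrow> N i \<subset> N (Suc i)"
  have "k < 2"
  proof (rule ccontr)
    assume "\<not> k < 2"
    then have lt: "N 0 \<subset> N 1" "N 1 \<subset> N 2"
      and sub: "submodule K (N 0) V" "submodule K (N 1) V" "span U \<subseteq> N 0" "span U \<subseteq> N 1"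
        "N 1 \<subseteq> span (insert g U)" "N 2 \<subseteq> span (insert g U)"
      using N(1)[of 0] N(1)[of 1] N(1)[of 2] N(2)[of 0] N(2)[of 1] by (auto simp: numeral_2_eq_2)
    obtain y where y: "y \<in> N 1" "y \<notin> N 0" using lt by auto
    then obtain w c where wc: "w \<in> span U" "c \<in> carrier K" "y = w \<oplus>\<^bsub>V\<^esub> c \<odot>\<^bsub>V\<^esub> g"
      using span_insert_elem[OF assms] sub by blast
    have wcar: "w \<in> carrier V" using wc(1) sub submodule.subset by blast
    have "c \<noteq> \<zero>\<^bsub>K\<^esub>" using y wc wcar sub assms by auto
    have ycar: "y \<in> carrier V" using y sub submodule.subset by blast
    have "c \<odot>\<^bsub>V\<^esub> g = y \<ominus>\<^bsub>V\<^esub> w" using wc wcar assms by (simp add: a_minus_def M.a_ac M.r_neg M.r_neg1 M.r_neg2)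
    then have "c \<odot>\<^bsub>V\<^esub> g \<in> N 1" using submodule_minus[OF sub(2) y(1), of w] sub(4) wc(1) by (metis subsetD)
    moreover have "c \<in> Units K" using wc \<open>c \<noteq> _\<close> by (simp add: field_Units)
    ultimately have "inv\<^bsub>K\<^esub> c \<odot>\<^bsub>V\<^esub> (c \<odot>\<^bsub>V\<^esub> g) \<in> N 1"
      using submodule.smult_closed[OF sub(2)] R.Units_inv_closed by blast
    moreover have "inv\<^bsub>K\<^esub> c \<odot>\<^bsub>V\<^esub> (c \<odot>\<^bsub>V\<^esub> g) = g"
      using wc assms \<open>c \<in> Units K\<close> smult_assoc1[of "inv\<^bsub>K\<^esub> c" c g] by simp
    ultimately have "g \<in> N 1" by simp
    moreover have "U \<subseteq> N 1" using in_own_span[OF assms(1)] sub by auto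
    ultimately have "span (insert g U) \<subseteq> N 1" by (intro span_is_subset sub) auto
    then show False using lt sub by auto
  qed
  then show "enat k \<le> 1" by (simp add: one_enat_def)
qed

lemma interval_length_le_card:
  assumes "finite G" "G \<subseteq> carrier V" "submodule K A V"
  shows "interval_length K V A (span (A \<union> G)) \<le> enat (card G)"
  using assms(1,2)
proof induction
  case empty
  have "span A \<subseteq> A" by (rule span_is_subset[OF order_refl assms(3)])
  show ?case
  proof (rule interval_length_le)
    fix k N
    assume N: "\<And>i. i \<le> k \<Longrightarrow> submodule K (N i) V \<and> A \<subseteq> N i \<and> N i \<subseteq> span (A \<union> {})"
      "\<And>i. i < k \<Longrightarrow> N i \<subset> N (Suc i)"
    have "k = 0"
    proof (rule ccontr)
      assume "k \<noteq> 0"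
      then show False using N(1)[of 0] N(1)[of 1] N(2)[of 0] \<open>span A \<subseteq> A\<close> by auto
    qed
    then show "enat k \<le> enat (card {})" by simp
  qed
next
  case (insert g G)
  let ?W = "span (A \<union> G)" and ?W' = "span (A \<union> insert g G)"
  have Acar: "A \<subseteq> carrier V" by (rule submodule.subset[OF assms(3)])
  have sub: "submodule K ?W V" "submodule K ?W' V" using Acar insert by (auto intro!: span_is_submodule)
  have "A \<subseteq> ?W" using in_own_span[of "A \<union> G"] Acar insert by auto
  moreover have "?W \<subseteq> ?W'" by (rule span_is_monotone) auto
  ultimately have "interval_length K V A ?W' = interval_length K V A ?W + interval_length K V ?W ?W'"
    by (intro interval_length_add assms sub)
  also have "\<dots> \<le> enat (card G) + 1"
    using insert Acar interval_length_span_insert[of "A \<union> G" g] by (intro add_mono) auto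
  also have "\<dots> = enat (card (insert g G))" using insert by (simp add: one_enat_def)
  finally show ?case .
qed

lemma interval_length_finite:
  assumes "finite G" "G \<subseteq> carrier V" "submodule K A V" "B \<subseteq> span (A \<union> G)"
  shows "interval_length K V A B < \<infinity>"
  using interval_length_le_card[OF assms(1-3)] interval_length_mono[OF order_refl assms(4), of K V A]
  by (meson enat_ord_code(4) le_less_trans)

lemma card_le_interval_length:
  assumes "finite G" "G \<subseteq> carrier V" "lin_indpt G"
  shows "enat (card G) \<le> interval_length K V {\<zero>\<^bsub>V\<^esub>} (span G)"
  using assms
proof induction
  case empty
  then show ?case by (simp add: enat_0)
next
  case (insert g G)
  have li: "lin_indpt G" using insert.prems subset_li_is_li[of "insert g G" G] by auto
  have g: "g \<notin> span G" using lin_dep_iff_in_span[of G g] insert li by auto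
  have sub: "submodule K (span G) V" "submodule K (span (insert g G)) V"
    using insert by (auto intro!: span_is_submodule)
  have "span G \<subset> span (insert g G)"
    using g span_is_monotone[of G "insert g G"] in_own_span[of "insert g G"] insert by auto
  then have "interval_length K V {\<zero>\<^bsub>V\<^esub>} (span G) + 1 \<le> interval_length K V {\<zero>\<^bsub>V\<^esub>} (span (insert g G))"
    using submodule.zero_closed[OF sub(1)] by (intro interval_length_step sub submodule_zero) auto
  moreover have "enat (card (insert g G)) = enat (card G) + 1" using insert by (simp add: one_enat_def)
  ultimately show ?case using insert li by (metis add_right_mono insert_subset order_trans)
qed

text \<open>A finite basis bounds the length from above as a spanning set and from below as an
  independent set.\<close>

lemma module_length_eq_dim:
  assumes "fin_dim"
  shows "module_length K V = enat dim"
proof -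
  obtain \<beta> where \<beta>: "finite \<beta>" "lin_indpt \<beta>" "span \<beta> = carrier V" "\<beta> \<subseteq> carrier V"
    using finite_basis_exists[OF assms] unfolding basis_def by auto
  then have dim: "dim = card \<beta>" using dim_basis unfolding basis_def by auto
  have "carrier V \<subseteq> span ({\<zero>\<^bsub>V\<^esub>} \<union> \<beta>)"
    using span_is_monotone[of \<beta> "{\<zero>\<^bsub>V\<^esub>} \<union> \<beta>"] \<beta> by auto
  then have "interval_length K V {\<zero>\<^bsub>V\<^esub>} (carrier V) \<le> interval_length K V {\<zero>\<^bsub>V\<^esub>} (span ({\<zero>\<^bsub>V\<^esub>} \<union> \<beta>))"
    by (rule interval_length_mono[OF order_refl])
  also have "\<dots> \<le> enat (card \<beta>)" by (rule interval_length_le_card[OF \<beta>(1,4) submodule_zero])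
  finally have "interval_length K V {\<zero>\<^bsub>V\<^esub>} (carrier V) \<le> enat (card \<beta>)" .
  moreover have "enat (card \<beta>) \<le> interval_length K V {\<zero>\<^bsub>V\<^esub>} (carrier V)"
    using card_le_interval_length[OF \<beta>(1,4,2)] unfolding \<beta>(3) .
  ultimately show ?thesis unfolding module_length_eq dim by (rule antisym)
qed

end

section \<open>Numerical semigroup rings and their monomial ideals\<close>

locale numerical_semigroup_ring =
  fixes n :: nat and a :: "nat \<Rightarrow> nat" and R :: "'k::field poly ring"
  assumes minimal_gens: "minimal_semigroup_generators n a" and two_gens: "n \<ge> 2"
    and R_eq: "R = semigroup_ring (a ` {..<n})"
begin

abbreviation S :: "nat set" where "S \<equiv> gen_submonoid (a ` {..<n})"

lemma S_add: "x \<in> S \<Longrightarrow> y \<in> S \<Longrightarrow> x + y \<in> S"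
  by (rule gen_submonoid_add)

lemma S_zero [simp]: "0 \<in> S"
  by (rule gen_submonoid_zero)

lemma S_mult: "x \<in> S \<Longrightarrow> k * x \<in> S"
  by (rule gen_submonoid_mult)

lemma a_in_S: "i < n \<Longrightarrow> a i \<in> S"
  by (auto intro: gen_submonoid_generator)

lemma a0_in_S [simp]: "a 0 \<in> S"
  using a_in_S[of 0] two_gens by simp

lemma a_pos: "i < n \<Longrightarrow> a i > 0"
  using minimal_gens gen_submonoid_zero unfolding minimal_semigroup_generators_def by (metis gr0I)

lemma a0_pos [simp]: "a 0 > 0"
  using a_pos[of 0] two_gens by simp

lemma a_strict_mono: "i < j \<Longrightarrow> j < n \<Longrightarrow> a i < a j"
  using minimal_gens unfolding minimal_semigroup_generators_def strict_mono_on_def by auto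

lemma S_cases:
  assumes "s \<in> S" "s \<noteq> 0"
  obtains j y where "j < n" "y \<in> S" "s = a j + y"
proof -
  obtain g y where "g \<in> a ` {..<n}" "y \<in> S" "s = g + y"
    using gen_submonoid_cases[OF _ assms] by (metis finite_imageI finite_lessThan)
  with that show ?thesis by auto
qed

lemma S_multiplicity: assumes "s \<in> S" "s \<noteq> 0" shows "s = a 0 \<or> a 0 < s"
proof -
  obtain j y where "j < n" "s = a j + y" using S_cases[OF assms] by metis
  then show ?thesis using a_strict_mono[of 0 j] by (cases "j = 0") auto
qed

lemma conductor: obtains c where "\<And>u. u \<ge> c \<Longrightarrow> u \<in> S"
  using gen_submonoid_conductor[of "a ` {..<n}"] minimal_gens
  unfolding minimal_semigroup_generators_def by auto

text \<open>Otherwise \<open>a j\<close> would be a combination of \<open>a 0\<close> and smaller generators that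
  occur in \<open>x\<close>, hence redundant.\<close>

lemma generator_not_shifted:
  assumes "0 < j" "j < n" "x \<in> S"
  shows "a j \<noteq> a 0 + x"
proof
  assume eq: "a j = a 0 + x"
  let ?G = "a ` {..<n}" and ?H = "a ` ({..<n} - {j})"
  have H: "?H = ?G - {a j}"
    using a_strict_mono assms by (auto simp: image_iff) (metis nat_neq_iff less_irrefl)
  obtain c where c: "x = (\<Sum>s\<in>?G. c s * s)" using assms unfolding gen_submonoid_def by blast
  have "x = c (a j) * a j + (\<Sum>s\<in>?H. c s * s)"
    unfolding H c using assms by (subst sum.remove[of _ "a j"]) auto
  moreover from this have "c (a j) = 0"
    using eq a0_pos
    by (metis add_gr_0 le_add2 le_add_same_cancel1 linorder_not_less mult_eq_if neq0_conv not_less_zero trans_le_add1 less_add_same_cancel2)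
  ultimately have "x \<in> gen_submonoid ?H" unfolding gen_submonoid_def by auto
  moreover have "a 0 \<in> gen_submonoid ?H"
    using assms two_gens by (intro gen_submonoid_generator) auto
  ultimately have "a j \<in> gen_submonoid ?H" unfolding eq by (intro gen_submonoid_add)
  then show False using minimal_gens assms unfolding minimal_semigroup_generators_def by auto
qed

text \<open>The witness is the largest element of the Apery set of \<open>a 0\<close>. Its monomial lies in the socle
  of \<open>R / t\<^bsup>a 0\<^esup> R\<close>.\<close>

lemma socle_exponent:
  obtains w where "w \<in> S" "\<And>x. x \<in> S \<Longrightarrow> w \<noteq> a 0 + x"
    "\<And>s. s \<in> S \<Longrightarrow> s \<noteq> 0 \<Longrightarrow> \<exists>x\<in>S. w + s = a 0 + x"
proof -
  define P where "P = {w \<in> S. \<forall>x\<in>S. w \<noteq> a 0 + x}"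
  obtain c where c: "\<And>u. u \<ge> c \<Longrightarrow> u \<in> S" using conductor by blast
  have "P \<subseteq> {..<c + a 0}"
  proof
    fix w assume "w \<in> P"
    then have "w - a 0 \<notin> S \<or> w < a 0" unfolding P_def using le_add_diff_inverse by force
    then show "w \<in> {..<c + a 0}" using c[of "w - a 0"] by force
  qed
  then have fin: "finite P" by (rule finite_subset) simp
  have "0 \<in> P" unfolding P_def using a0_pos by simp
  show ?thesis
  proof (rule that)
    have Mx: "Max P \<in> P" using fin \<open>0 \<in> P\<close> by (intro Max_in) auto
    then show "Max P \<in> S" "\<And>x. x \<in> S \<Longrightarrow> Max P \<noteq> a 0 + x" unfolding P_def by auto
    fix s assume "s \<in> S" "s \<noteq> 0"
    then have "Max P + s \<in> S" using Mx unfolding P_def by (simp add: S_add)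
    moreover have "Max P + s \<notin> P" using Max_ge[OF fin, of "Max P + s"] \<open>s \<noteq> 0\<close> by auto
    ultimately show "\<exists>x\<in>S. Max P + s = a 0 + x" unfolding P_def by blast
  qed
qed

subsection \<open>The ring\<close>

lemma R_simps [simp]:
  "mult R = (*)" "add R = (+)" "zero R = 0" "one R = 1"
  by (simp_all add: R_eq semigroup_ring_def)

lemma monom_in_generated_ring:
  "s \<in> S \<Longrightarrow> tpow s \<in>
     generate_ring class_ring (range (\<lambda>c::'k. [:c:]) \<union> tpow ` a ` {..<n})"
  (is "_ \<Longrightarrow> _ \<in> ?G")
proof (induction s rule: less_induct)
  case (less s)
  show ?case
  proof (cases "s = 0")
    case True
    then show ?thesis by (auto simp: monom_0 intro: generate_ring.incl)
  next
    case False
    then obtain j y where jy: "j < n" "y \<in> S" "s = a j + y" using S_cases less by metis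
    then have "tpow s = tpow (a j) * (tpow y :: 'k poly)"
      by (simp add: mult_monom)
    moreover have "y < s" using a_pos jy by simp
    moreover have "tpow (a j) \<in> ?G" using jy by (intro generate_ring.incl) auto
    ultimately show ?thesis
      using generate_ring.eng_mult[OF _ less.IH[of y], of "tpow (a j)"] jy by simp
  qed
qed

lemma carrier_R [simp]: "carrier R = mon_span S"
proof -
  let ?C = "class_ring :: 'k poly ring"
  let ?G = "generate_ring ?C (range (\<lambda>c::'k. [:c:]) \<union> tpow ` a ` {..<n})"
  have "p \<in> mon_span S" if "p \<in> ?G" for p
    using that
  proof induction
    case one
    then show ?case using mon_span_monom[of 0 S 1] by (simp add: monom_eq_1)
  next
    case (incl h)
    then show ?case using mon_span_monom[of 0 S]
      by (auto simp: monom_0 intro!: mon_span_monom a_in_S)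
  next
    case (a_inv h)
    then show ?case by (simp add: class_ring_simps mon_span_uminus)
  next
    case (eng_add h1 h2)
    then show ?case by (simp add: mon_span_add)
  next
    case (eng_mult h1 h2)
    then show ?case by (auto intro: mon_span_mult S_add)
  qed
  moreover have "p \<in> ?G" if "p \<in> mon_span S" for p
  proof (rule poly_in_by_terms)
    have "0 \<in> range (\<lambda>c::'k. [:c:])" by (metis pCons_0_0 rangeI)
    then show "0 \<in> ?G" by (intro generate_ring.incl) auto
    show "p + q \<in> ?G" if "p \<in> ?G" "q \<in> ?G" for p q
      using generate_ring.eng_add[OF that] by simp
    show "Polynomial.monom (poly.coeff p i) i \<in> ?G" if "poly.coeff p i \<noteq> 0" for i
    proof -
      have "[:poly.coeff p i:] \<in> ?G" by (intro generate_ring.incl) auto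
      moreover have "tpow i \<in> ?G"
        using that \<open>p \<in> mon_span S\<close> by (intro monom_in_generated_ring) (simp add: mon_spanD)
      ultimately have "[:poly.coeff p i:] * tpow i \<in> ?G"
        using generate_ring.eng_mult[of _ ?C] by fastforce
      then show ?thesis by (simp add: Polynomial.smult_monom)
    qed
  qed
  ultimately have "?G = mon_span S" by blast
  then show ?thesis by (simp add: R_eq semigroup_ring_def)
qed

lemma one_in_R [simp]: "1 \<in> mon_span S"
  using mon_span_monom[of 0 S 1] by (simp add: monom_eq_1)

lemma const_in_R [simp]: "[:c:] \<in> mon_span S"
  using mon_span_monom[of 0 S c] by (simp add: monom_0)

lemma mult_in_R: "p \<in> mon_span S \<Longrightarrow> q \<in> mon_span S \<Longrightarrow> p * q \<in> mon_span S"
  by (rule mon_span_mult) (auto intro: S_add)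

sublocale R: cring R
proof (rule cringI)
  show "abelian_group R"
    by (rule abelian_groupI) (auto simp: mon_span_add algebra_simps intro: bexI[OF _ mon_span_uminus])
  show "Group.comm_monoid R"
    by (rule comm_monoidI) (auto simp: mult_in_R algebra_simps)
qed (auto simp: algebra_simps)

lemma R_a_inv [simp]: "p \<in> mon_span S \<Longrightarrow> \<ominus>\<^bsub>R\<^esub> p = - p"
  using R.minus_equality[of "- p" p] by (simp add: mon_span_uminus)

lemma mon_span_ideal:
  assumes "E \<subseteq> S" "\<And>i s. i \<in> E \<Longrightarrow> s \<in> S \<Longrightarrow> i + s \<in> E"
  shows "ideal (mon_span E) R"
proof (rule idealI)
  show "ring R" by (rule R.ring_axioms)
  have sub: "mon_span E \<subseteq> mon_span S" by (rule mon_span_mono) (rule assms)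
  moreover have "mon_span E \<noteq> ({} :: 'k poly set)" using mon_span_zero by blast
  ultimately show "subgroup (mon_span E) (add_monoid R)"
    by (intro R.add.subgroupI) (auto simp: mon_span_add mon_span_uminus subset_iff)
  fix p q :: "'k poly" assume "p \<in> mon_span E" "q \<in> carrier R"
  then show "q \<otimes>\<^bsub>R\<^esub> p \<in> mon_span E" "p \<otimes>\<^bsub>R\<^esub> q \<in> mon_span E"
    using assms(2) by (auto intro!: mon_span_mult[of _ E _ S] simp: mult.commute[of q])
qed

lemma ideal_facts:
  assumes "ideal I R"
  shows "I \<subseteq> mon_span S" "0 \<in> I" "p \<in> I \<Longrightarrow> q \<in> I \<Longrightarrow> p + q \<in> I"
    "p \<in> I \<Longrightarrow> q \<in> I \<Longrightarrow> p - q \<in> I" "p \<in> I \<Longrightarrow> r \<in> mon_span S \<Longrightarrow> r * p \<in> I"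
proof -
  interpret I: ideal I R by fact
  show "I \<subseteq> mon_span S" using I.a_subset by simp
  then have sub: "p \<in> I \<Longrightarrow> p \<in> mon_span S" for p by auto
  show "0 \<in> I" using I.zero_closed by simp
  show "p \<in> I \<Longrightarrow> q \<in> I \<Longrightarrow> p + q \<in> I" using I.a_closed[of p q] by simp
  show "p \<in> I \<Longrightarrow> q \<in> I \<Longrightarrow> p - q \<in> I"
    using I.a_closed[of p "- q"] I.a_inv_closed[of q] sub by simp
  show "p \<in> I \<Longrightarrow> r \<in> mon_span S \<Longrightarrow> r * p \<in> I" using I.I_l_closed[of p r] by simp
qed

lemma ideal_contains_mon_span:
  assumes "ideal I R" "E \<subseteq> S" "\<And>i. i \<in> E \<Longrightarrow> tpow i \<in> I"
  shows "mon_span E \<subseteq> I"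
proof
  fix p :: "'k poly" assume p: "p \<in> mon_span E"
  show "p \<in> I"
  proof (rule poly_in_by_terms)
    fix i assume "poly.coeff p i \<noteq> 0"
    then have "tpow i \<in> I" using p assms(3) by (auto dest: mon_spanD)
    then have "[:poly.coeff p i:] * tpow i \<in> I"
      by (rule ideal_facts[OF assms(1)]) simp
    then show "Polynomial.monom (poly.coeff p i) i \<in> I" by (simp add: Polynomial.smult_monom)
  qed (use ideal_facts[OF assms(1)] in auto)
qed

lemma genideal_monomials:
  assumes "G \<subseteq> S"
  shows "Idl\<^bsub>R\<^esub> (tpow ` G) = mon_span {g + s | g s. g \<in> G \<and> s \<in> S}"
proof
  let ?E = "{g + s | g s. g \<in> G \<and> s \<in> S}"
  have E: "?E \<subseteq> S" using assms S_add by auto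
  have "ideal (mon_span ?E :: 'k poly set) R"
  proof (rule mon_span_ideal[OF E])
    fix i s assume "i \<in> ?E" "s \<in> S"
    then show "i + s \<in> ?E" using S_add by (auto simp: add.assoc) blast
  qed
  moreover have "tpow ` G \<subseteq> (mon_span ?E :: 'k poly set)"
    by (auto intro!: mon_span_monom) (metis S_zero add.right_neutral)
  ultimately show "Idl\<^bsub>R\<^esub> (tpow ` G) \<subseteq> mon_span ?E"
    by (rule R.genideal_minimal)
  have sub: "tpow ` G \<subseteq> carrier R" using assms by (auto intro!: mon_span_monom)
  show "mon_span ?E \<subseteq> Idl\<^bsub>R\<^esub> (tpow ` G)"
  proof (rule ideal_contains_mon_span[OF R.genideal_ideal[OF sub] E])
    fix i assume "i \<in> ?E"
    then obtain g s where gs: "g \<in> G" "s \<in> S" "i = g + s" by auto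
    have "tpow g \<in> Idl\<^bsub>R\<^esub> (tpow ` G)"
      using R.genideal_self[OF sub] gs by auto
    then have "tpow s * tpow g \<in> Idl\<^bsub>R\<^esub> (tpow ` G)"
      by (rule ideal_facts[OF R.genideal_ideal[OF sub]]) (use gs mon_span_monom in auto)
    then show "tpow i \<in> Idl\<^bsub>R\<^esub> (tpow ` G)"
      using gs by (simp add: mult_monom add.commute)
  qed
qed

lemma ideal_prod_mon_span:
  "ideal_prod R (mon_span E) (mon_span F) = mon_span {i + j | i j. i \<in> E \<and> j \<in> F}"
proof (intro equalityI subsetI)
  fix p assume "p \<in> ideal_prod R (mon_span E) (mon_span F)"
  then show "p \<in> mon_span {i + j | i j. i \<in> E \<and> j \<in> F}"
    by induction (auto intro!: mon_span_add mon_span_mult[of _ E _ F])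
next
  fix p :: "'k poly" assume p: "p \<in> mon_span {i + j | i j. i \<in> E \<and> j \<in> F}"
  show "p \<in> ideal_prod R (mon_span E) (mon_span F)"
  proof (rule poly_in_by_terms)
    show "0 \<in> ideal_prod R (mon_span E) (mon_span F)"
      using ideal_prod.prod[of 0 "mon_span E" 0 "mon_span F" R] by simp
    show "p + q \<in> ideal_prod R (mon_span E) (mon_span F)"
      if "p \<in> ideal_prod R (mon_span E) (mon_span F)" "q \<in> ideal_prod R (mon_span E) (mon_span F)" for p q
      using ideal_prod.sum[OF that] by simp
    fix k assume "poly.coeff p k \<noteq> 0"
    then obtain i j where "i \<in> E" "j \<in> F" "k = i + j" using mon_spanD[OF p, of k] by auto
    then show "Polynomial.monom (poly.coeff p k) k \<in> ideal_prod R (mon_span E) (mon_span F)"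
      using ideal_prod.prod[of "Polynomial.monom (poly.coeff p k) i" "mon_span E"
          "tpow j" "mon_span F" R]
      by (simp add: mult_monom mon_span_monom)
  qed
qed

subsection \<open>The maximal ideal and its powers\<close>

lemma irrelevant_ideal_eq: "irrelevant_ideal (a ` {..<n}) = (mon_span (S - {0}) :: 'k poly set)"
proof -
  have "{g + s | g s. g \<in> a ` {..<n} \<and> s \<in> S} = S - {0}"
  proof (intro equalityI subsetI)
    fix u assume "u \<in> {g + s | g s. g \<in> a ` {..<n} \<and> s \<in> S}"
    then obtain j s where "j < n" "s \<in> S" "u = a j + s" by auto
    then show "u \<in> S - {0}" using S_add a_in_S a_pos[of j] by auto
  next
    fix u assume "u \<in> S - {0}"
    then obtain j y where "j < n" "y \<in> S" "u = a j + y" using S_cases by (metis Diff_iff singletonI)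
    then show "u \<in> {g + s | g s. g \<in> a ` {..<n} \<and> s \<in> S}" by blast
  qed
  then show ?thesis
    unfolding irrelevant_ideal_def R_eq[symmetric]
    using genideal_monomials[of "a ` {..<n}"] a_in_S by auto
qed

fun max_ideal_pow_exps :: "nat \<Rightarrow> nat set" where
  "max_ideal_pow_exps 0 = S"
| "max_ideal_pow_exps (Suc s) = {i + j | i j. i \<in> max_ideal_pow_exps s \<and> j \<in> S - {0}}"

lemma max_ideal_ideal: "ideal (mon_span (S - {0})) R"
  by (rule mon_span_ideal) (auto intro: S_add)

lemma max_ideal_pow:
  "mon_span (S - {0}) [^]\<^bsub>ideals_set R\<^esub> s = (mon_span (max_ideal_pow_exps s) :: 'k poly set)"
proof -
  interpret I: Group.comm_monoid "ideals_set R" by (rule R.ideals_set_is_comm_monoid)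
  have ops: "mult (ideals_set R) = ideal_prod R" "one (ideals_set R) = mon_span S"
    by (simp_all add: ideals_set_def)
  show ?thesis
    by (induction s) (simp_all only: max_ideal_pow_exps.simps I.nat_pow_0 I.nat_pow_Suc ops ideal_prod_mon_span)
qed

text \<open>For \<open>s > 0\<close> the exponents in \<open>max_ideal_pow_exps s\<close> are the sums of \<open>s\<close> positive semigroup
  elements. If none of these is the multiplicity \<open>a 0\<close>, then each is at least \<open>a 0 + 1\<close>.\<close>

lemma max_ideal_pow_exps_cases:
  "u \<in> max_ideal_pow_exps s \<Longrightarrow>
     u \<ge> s * (a 0 + 1) \<or> (s > 0 \<and> (\<exists>v\<in>max_ideal_pow_exps (s - 1). u = a 0 + v))"
proof (induction s arbitrary: u)
  case (Suc s)
  then obtain i j where ij: "i \<in> max_ideal_pow_exps s" "j \<in> S" "j \<noteq> 0" "u = i + j" by auto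
  show ?case
  proof (cases "j = a 0")
    case True
    with ij show ?thesis by auto
  next
    case False
    then have "j \<ge> a 0 + 1" using S_multiplicity ij by fastforce
    show ?thesis
    proof (cases "i \<ge> s * (a 0 + 1)")
      case True
      with \<open>j \<ge> a 0 + 1\<close> ij show ?thesis by simp
    next
      case False
      then obtain v where v: "s > 0" "v \<in> max_ideal_pow_exps (s - 1)" "i = a 0 + v"
        using Suc.IH[OF ij(1)] by auto
      then have "v + j \<in> max_ideal_pow_exps s" using ij by (cases s) auto
      then show ?thesis using ij v by (auto simp: add.assoc)
    qed
  qed
qed auto

lemma max_ideal_pow_exps_large:
  "w \<in> S \<Longrightarrow> w > 0 \<Longrightarrow> s * a 0 + w \<in> max_ideal_pow_exps (Suc s)"
proof (induction s)
  case 0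
  then show ?case by auto (metis S_zero add_0 gr_implies_not0)
next
  case (Suc s)
  then have "s * a 0 + w + a 0 \<in> max_ideal_pow_exps (Suc (Suc s))"
    by (subst max_ideal_pow_exps.simps, intro CollectI exI[of _ "s * a 0 + w"] exI[of _ "a 0"])
      (simp del: max_ideal_pow_exps.simps)
  then show ?case by (simp add: ac_simps)
qed

text \<open>In ideal terms \<open>\<mm>\<^bsup>s+1\<^esup> = t\<^bsup>a 0\<^esup> \<mm>\<^sup>s\<close>: the monomial \<open>t\<^bsup>a 0\<^esup>\<close> generates a reduction of \<open>\<mm>\<close>. If
  \<open>u \<ge> (s + 1) (a 0 + 1)\<close> and \<open>s\<close> is beyond the conductor, then \<open>u - a 0\<close> exceeds \<open>(s - 1) a 0\<close> by a number beyond the conductor, and so is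
  a sum of \<open>s\<close> positive semigroup elements.\<close>

lemma max_ideal_pow_exps_shift:
  obtains c where "\<And>s u. s \<ge> c \<Longrightarrow> u \<in> max_ideal_pow_exps (Suc s) \<Longrightarrow>
      a 0 \<le> u \<and> u - a 0 \<in> max_ideal_pow_exps s"
proof -
  obtain c where c: "\<And>u. u \<ge> c \<Longrightarrow> u \<in> S" using conductor by blast
  show ?thesis
  proof (rule that[of "Suc c"])
    fix s u assume s: "s \<ge> Suc c" and u: "u \<in> max_ideal_pow_exps (Suc s)"
    show "a 0 \<le> u \<and> u - a 0 \<in> max_ideal_pow_exps s"
    proof (cases "\<exists>v\<in>max_ideal_pow_exps s. u = a 0 + v")
      case False
      then have "u \<ge> Suc s * (a 0 + 1)" using max_ideal_pow_exps_cases[OF u] by auto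
      obtain r where [simp]: "s = Suc r" using s by (cases s) auto
      define w where "w = u - a 0 - r * a 0"
      have "u = a 0 + r * a 0 + w" "w \<ge> Suc c"
        using \<open>u \<ge> Suc s * (a 0 + 1)\<close> s by (auto simp: w_def algebra_simps)
      then show ?thesis using max_ideal_pow_exps_large[of w r] c[of w] by (simp del: max_ideal_pow_exps.simps)
    qed auto
  qed
qed

lemma max_ideal_pow_exps_sub: "max_ideal_pow_exps s \<subseteq> S"
  by (induction s) (auto intro: S_add)

subsection \<open>The ideals containing all generators but the multiplicity\<close>

definition pow_exps :: "nat \<Rightarrow> nat set" where
  "pow_exps d = {g + s | g s. g \<in> insert (d * a 0) (a ` {1..<n}) \<and> s \<in> S}"

lemma pow_exps_sub: "pow_exps d \<subseteq> S"
  unfolding pow_exps_def by (auto intro!: S_add S_mult[OF a0_in_S] a_in_S)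

lemma power_ideal_eq: "power_ideal n a d = (mon_span (pow_exps d) :: 'k poly set)"
proof -
  have "insert (d * a 0) (a ` {1..<n}) \<subseteq> S" by (auto intro: S_mult a_in_S)
  then show ?thesis
    using genideal_monomials[of "insert (d * a 0) (a ` {1..<n})"]
    unfolding power_ideal_def R_eq[symmetric] pow_exps_def by (simp add: image_image)
qed

lemma pow_exps_mult: "d * a 0 \<in> pow_exps d"
  unfolding pow_exps_def by (intro CollectI exI[of _ "d * a 0"] exI[of _ 0]) simp

lemma pow_exps_generator: "1 \<le> j \<Longrightarrow> j < n \<Longrightarrow> a j \<in> pow_exps d"
  unfolding pow_exps_def by (intro CollectI exI[of _ "a j"] exI[of _ 0]) simp

lemma pow_exps_add: assumes "i \<in> pow_exps d" "s \<in> S" shows "i + s \<in> pow_exps d"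
proof -
  obtain g r where "g \<in> insert (d * a 0) (a ` {1..<n})" "r \<in> S" "i = g + r"
    using assms unfolding pow_exps_def by blast
  then show ?thesis unfolding pow_exps_def using assms
    by (intro CollectI exI[of _ g] exI[of _ "r + s"]) (simp add: S_add add.assoc)
qed

lemma power_ideal_ideal: "ideal (power_ideal n a d) R"
  unfolding power_ideal_eq by (rule mon_span_ideal[OF pow_exps_sub]) (rule pow_exps_add)

lemma pow_exps_antimono: assumes "d \<le> d'" shows "pow_exps d' \<subseteq> pow_exps d"
proof -
  have "d' * a 0 = d * a 0 + (d' - d) * a 0" using assms by (simp flip: distrib_right)
  then have "d' * a 0 \<in> pow_exps d" by (simp add: pow_exps_add pow_exps_mult S_mult)
  then show ?thesis using pow_exps_add[of _ d] pow_exps_generator[of _ d]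
    by (subst pow_exps_def) auto
qed

lemma power_ideal_antimono: "d \<le> d' \<Longrightarrow> power_ideal n a d' \<subseteq> (power_ideal n a d :: 'k poly set)"
  unfolding power_ideal_eq by (intro mon_span_mono pow_exps_antimono)

lemma S_outside_pow_exps:
  assumes "s \<in> S" "s \<notin> pow_exps d"
  obtains l where "l < d" "s = l * a 0"
proof -
  have "(\<exists>l. s = l * a 0) \<or> s \<in> pow_exps d" if "s \<in> S" for s
    using that
  proof (induction s rule: less_induct)
    case (less s)
    show ?case
    proof (cases "s = 0")
      case False
      then obtain j y where jy: "j < n" "y \<in> S" "s = a j + y" using S_cases less by metis
      show ?thesis
      proof (cases "j = 0")
        case True
        then have "(\<exists>l. y = l * a 0) \<or> y \<in> pow_exps d" using less.IH[of y] jy by simp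
        then show ?thesis
        proof
          assume "\<exists>l. y = l * a 0"
          then have "\<exists>l. s = Suc l * a 0" using jy True by auto
          then show ?thesis by blast
        qed (use jy True pow_exps_add[of y d "a 0"] in \<open>simp add: add.commute\<close>)
      next
        case False
        then show ?thesis using jy pow_exps_add[OF pow_exps_generator[of j]] by simp
      qed
    qed auto
  qed
  then obtain l where l: "s = l * a 0" using assms by auto
  have "l < d"
  proof (rule ccontr)
    assume "\<not> l < d"
    then have "s \<in> pow_exps d" using pow_exps_mult[of l] pow_exps_antimono[of d l] l by auto
    with assms show False by simp
  qed
  with l that show ?thesis by blast
qed

text \<open>Modulo \<open>(t\<^bsup>a 1\<^esup>, \<dots>)\<close> the ring is a quotient \<open>k[T]/(T\<^sup>N)\<close> with \<open>T = t\<^bsup>a 0\<^esup>\<close>, whose only ideals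
  are the powers of \<open>T\<close>. Concretely, take \<open>d\<close> least with \<open>T\<^sup>d \<in> I\<close>. An element of \<open>I\<close> with a term
  \<open>T\<^sup>l\<close>, where \<open>l < d\<close> is least, would yield \<open>T\<^bsup>d-1\<^esup> \<in> I\<close> after multiplication by \<open>T\<^bsup>d-1-l\<^esup>\<close>, since all other
  terms fall into \<open>I\<close>.\<close>

lemma ideal_eq_power_ideal:
  assumes I: "ideal I R" and gens: "\<And>j. 1 \<le> j \<Longrightarrow> j < n \<Longrightarrow> tpow (a j) \<in> I"
  obtains d where "I = power_ideal n a d"
proof -
  note If = ideal_facts[OF I]
  define T where "T l \<longleftrightarrow> tpow (l * a 0) \<in> I" for l
  define d where "d = (LEAST l. T l)"
  \<comment> \<open>The exponent \<open>a 1\<close> is admissible because \<open>T\<^bsup>a 1\<^esup> = (t\<^bsup>a 1\<^esup>)\<^bsup>a 0\<^esup>\<close>.\<close>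
  have "tpow ((a 0 - 1) * a 1) * tpow (a 1) \<in> I"
    by (rule If(5)[OF gens]) (use two_gens in \<open>auto intro!: mon_span_monom S_mult a_in_S\<close>)
  moreover have "(a 0 - 1) * a 1 + a 1 = a 1 * a 0"
    using a0_pos by (cases "a 0") auto
  ultimately have "T (a 1)" unfolding T_def by (simp add: mult_monom)
  then have "T d" unfolding d_def by (rule LeastI)
  have least: "\<not> T l" if "l < d" for l using that unfolding d_def by (rule not_less_Least)
  have sub: "mon_span (pow_exps d) \<subseteq> I"
  proof (rule ideal_contains_mon_span[OF I pow_exps_sub])
    fix i assume "i \<in> pow_exps d"
    then obtain g s where gs: "g \<in> insert (d * a 0) (a ` {1..<n})" "s \<in> S" "i = s + g"
      unfolding pow_exps_def by (auto simp: add.commute)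
    then have "tpow g \<in> I" using \<open>T d\<close> gens unfolding T_def by auto
    then have "tpow s * tpow g \<in> I"
      by (rule If(5)) (use gs mon_span_monom in auto)
    then show "tpow i \<in> I" using gs by (simp add: mult_monom)
  qed
  have "I \<subseteq> mon_span (pow_exps d)"
  proof (rule ccontr)
    assume "\<not> I \<subseteq> mon_span (pow_exps d)"
    then obtain p where p: "p \<in> I" "p \<notin> mon_span (pow_exps d)" by auto
    obtain q r where qr: "q \<in> mon_span (S \<inter> pow_exps d)" "r \<in> mon_span (S - pow_exps d)" "p = q + r"
      using mon_span_split p If(1) by blast
    have "q \<in> mon_span (pow_exps d)" using qr mon_span_mono[of "S \<inter> pow_exps d" "pow_exps d"] by auto
    then have "r \<in> I" "r \<noteq> 0" using qr p If(4)[of p q] sub by auto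
    have exps: "\<exists>l<d. i = l * a 0" if "poly.coeff r i \<noteq> 0" for i
      using mon_spanD[OF qr(2) that] S_outside_pow_exps by (metis Diff_iff)
    define l where "l = (LEAST l. poly.coeff r (l * a 0) \<noteq> 0)"
    have "\<exists>l. poly.coeff r (l * a 0) \<noteq> 0" using exps \<open>r \<noteq> 0\<close> by (metis leading_coeff_0_iff)
    then have l: "poly.coeff r (l * a 0) \<noteq> 0" unfolding l_def by (rule LeastI_ex)
    have l_least: "l \<le> l'" if "poly.coeff r (l' * a 0) \<noteq> 0" for l'
      unfolding l_def using that by (rule Least_le)
    have "l < d" using exps[OF l] a0_pos by auto
    define k where "k = (d - 1 - l) * a 0"
    define b where "b = poly.coeff r (l * a 0)"
    have k: "l * a 0 + k = (d - 1) * a 0" using \<open>l < d\<close> by (simp add: k_def flip: distrib_right)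
    have "tpow k * r - Polynomial.monom b ((d - 1) * a 0) \<in> mon_span (pow_exps d)"
      unfolding mon_span_def
    proof (intro CollectI allI impI)
      fix i assume i: "poly.coeff (tpow k * r - Polynomial.monom b ((d - 1) * a 0)) i \<noteq> 0"
      have ne: "i \<noteq> (d - 1) * a 0"
      proof
        assume "i = (d - 1) * a 0"
        then have "k \<le> i" "i - k = l * a 0" using k by auto
        then show False using i \<open>i = (d - 1) * a 0\<close> by (auto simp: coeff_monom_mult b_def)
      qed
      then have "k \<le> i" "poly.coeff r (i - k) \<noteq> 0"
        using i by (auto simp: coeff_monom_mult split: if_splits)
      then obtain l' where l': "i - k = l' * a 0" "l \<le> l'" using exps l_least by metis
      have "l \<noteq> l'" using ne l' k \<open>k \<le> i\<close> by auto
      then obtain q where q: "l' = l + 1 + q" using l'(2) by (metis Suc_eq_plus1 le_neq_implies_less less_iff_Suc_add add_Suc)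
      obtain r where r: "d = l + 1 + r" using \<open>l < d\<close> by (metis Suc_eq_plus1 less_iff_Suc_add add_Suc)
      have "i = l' * a 0 + k" using l'(1) \<open>k \<le> i\<close> by simp
      also have "\<dots> = d * a 0 + q * a 0" by (simp add: k_def q r algebra_simps)
      finally show "i \<in> pow_exps d" by (simp add: pow_exps_add pow_exps_mult S_mult)
    qed
    then have "tpow k * r - Polynomial.monom b ((d - 1) * a 0) \<in> I" using sub by auto
    moreover have "tpow k * r \<in> I"
      using \<open>r \<in> I\<close> by (rule If(5)) (auto simp: k_def intro!: mon_span_monom S_mult)
    ultimately have "Polynomial.monom b ((d - 1) * a 0) \<in> I" using If(4) by fastforce
    then have "[:inverse b:] * Polynomial.monom b ((d - 1) * a 0) \<in> I" by (rule If(5)) simp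
    then have "T (d - 1)" unfolding T_def using l by (simp add: Polynomial.smult_monom b_def)
    then show False using least[of "d - 1"] \<open>l < d\<close> by simp
  qed
  then show ?thesis using sub that power_ideal_eq by blast
qed

end

section \<open>Restriction of scalars to the coefficient field\<close>

lemma restrict_scalars_simps [simp]:
  "carrier (restrict_scalars \<phi> M) = carrier M" "zero (restrict_scalars \<phi> M) = zero M"
  "add (restrict_scalars \<phi> M) = add M" "smult (restrict_scalars \<phi> M) c = smult M (\<phi> c)"
  by (simp_all add: restrict_scalars_def)

lemma ring_as_module_simps [simp]:
  "carrier (ring_as_module R) = carrier R" "zero (ring_as_module R) = zero R"
  "add (ring_as_module R) = add R" "smult (ring_as_module R) = mult R"
  by (simp_all add: ring_as_module_def)

lemma (in cring) ring_as_module_module: "Module.module R (ring_as_module R)"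
  by (rule module_criteria) (auto simp: cring_axioms a_ac m_ac l_distr r_distr intro: r_neg)

lemma finsum_in_subset:
  assumes "abelian_monoid M" "W \<subseteq> carrier M" "\<zero>\<^bsub>M\<^esub> \<in> W" "\<And>x y. x \<in> W \<Longrightarrow> y \<in> W \<Longrightarrow> x \<oplus>\<^bsub>M\<^esub> y \<in> W"
    and "finite A" "\<And>v. v \<in> A \<Longrightarrow> f v \<in> W"
  shows "finsum M f A \<in> W"
proof -
  interpret abelian_monoid M by fact
  show ?thesis using assms(5,6)
  proof induction
    case (insert v A)
    then have "f \<in> insert v A \<rightarrow> carrier M" using assms(2) by blast
    then have "finsum M f (insert v A) = f v \<oplus>\<^bsub>M\<^esub> finsum M f A"
      using insert by (intro finsum_insert) (auto simp: Pi_iff)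
    then show ?case using insert assms(4) by simp
  qed (simp add: assms)
qed

context numerical_semigroup_ring
begin

abbreviation k_space :: "('k poly, 'm, 'c) module_scheme \<Rightarrow> ('k, 'm) module" where
  "k_space M \<equiv> restrict_scalars (\<lambda>c. [:c:]) M"

lemma k_space_vectorspace:
  assumes "Module.module R M"
  shows "vectorspace class_ring (k_space M)"
proof -
  interpret Module.module R M by fact
  have l_distr: "[:b + c:] \<odot>\<^bsub>M\<^esub> v = [:b:] \<odot>\<^bsub>M\<^esub> v \<oplus>\<^bsub>M\<^esub> [:c:] \<odot>\<^bsub>M\<^esub> v" if "v \<in> carrier M" for b c v
    using smult_l_distr[of "[:b:]" "[:c:]" v] that by simp
  have assoc: "[:b * c:] \<odot>\<^bsub>M\<^esub> v = [:b:] \<odot>\<^bsub>M\<^esub> ([:c:] \<odot>\<^bsub>M\<^esub> v)" if "v \<in> carrier M" for b c v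
    using smult_assoc1[of "[:b:]" "[:c:]" v] that by (simp add: mult.commute)
  have one: "[:1:] \<odot>\<^bsub>M\<^esub> v = v" if "v \<in> carrier M" for v
    using smult_one[OF that] by (simp add: one_pCons)
  have neg: "\<exists>w\<in>carrier M. v \<oplus>\<^bsub>M\<^esub> w = \<zero>\<^bsub>M\<^esub>" if "v \<in> carrier M" for v
    using that M.r_neg by (intro bexI[of _ "\<ominus>\<^bsub>M\<^esub> v"]) simp_all
  have "Module.module class_ring (k_space M)"
    by (rule module_criteria[OF class_cring.cring_axioms])
      (simp_all add: smult_r_distr M.a_ac l_distr assoc one neg)
  then show ?thesis by (intro vectorspace.intro class_field)
qed

lemma submodule_k_space:
  assumes "submodule R X M"
  shows "submodule class_ring X (k_space M)"
proof -
  interpret vectorspace class_ring "k_space M"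
    by (rule k_space_vectorspace) (rule submodule.module[OF assms])
  show ?thesis unfolding submodule_def
    using submodule.subset[OF assms] submodule.m_closed[OF assms] submodule.zero_closed[OF assms]
      submodule.smult_closed[OF assms] module_axioms by simp
qed

lemma interval_length_k_space:
  "interval_length R M A B \<le> interval_length class_ring (k_space M) A B"
  by (rule interval_length_le_map[where F = "\<lambda>X. X"]) (simp_all add: submodule_k_space)

section \<open>The Krull dimension\<close>

text \<open>Division with remainder by \<open>t\<^sup>c f\<close> stays within \<open>R\<close> if \<open>c\<close> is beyond the conductor, because then
  \<open>t\<^sup>c q \<in> R\<close> for every polynomial \<open>q\<close>. So finitely many monomials span \<open>R / P\<close> over \<open>k\<close>.\<close>

lemma ideal_finite_codimension:
  assumes "ideal P R" "f \<in> P" "f \<noteq> 0"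
  shows "interval_length class_ring (k_space (ring_as_module R)) P (carrier R) < \<infinity>"
proof -
  let ?V = "k_space (ring_as_module R)"
  interpret V: vectorspace class_ring ?V
    by (rule k_space_vectorspace) (rule R.ring_as_module_module)
  note Pf = ideal_facts[OF assms(1)]
  obtain c where c: "\<And>u. u \<ge> c \<Longrightarrow> u \<in> S" using conductor by blast
  define F where "F = tpow c * f"
  define G where "G = (tpow :: nat \<Rightarrow> 'k poly) ` (S \<inter> {..<degree F})"
  have "F \<noteq> 0" unfolding F_def using assms by simp
  have G: "finite G" "G \<subseteq> carrier ?V" unfolding G_def by (auto intro: mon_span_monom)
  have P: "submodule class_ring P ?V"
    unfolding submodule_def
  proof (intro conjI allI impI)
    fix b v assume "v \<in> P"
    then show "b \<odot>\<^bsub>?V\<^esub> v \<in> P" using Pf(5)[of v "[:b:]"] by simp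
  qed (use Pf V.module_axioms in auto)
  have PG: "P \<union> G \<subseteq> carrier ?V" using G Pf(1) by simp
  have sub: "submodule class_ring (V.span (P \<union> G)) ?V" by (rule V.span_is_submodule[OF PG])
  have own: "P \<union> G \<subseteq> V.span (P \<union> G)" by (rule V.in_own_span[OF PG])
  have add: "p + q \<in> V.span (P \<union> G)" if "p \<in> V.span (P \<union> G)" "q \<in> V.span (P \<union> G)" for p q
    using submodule.m_closed[OF sub that] by simp
  have "p \<in> V.span (P \<union> G)" if p: "p \<in> mon_span S" for p
  proof -
    define q r where "q = p div F" and "r = p mod F"
    have "tpow c * q \<in> mon_span S"
      unfolding mon_span_def using c by (auto simp: coeff_monom_mult split: if_splits)
    then have Fq: "F * q \<in> P"
      using Pf(5)[OF assms(2), of "tpow c * q"] unfolding F_def by (simp add: ac_simps)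
    have pqr: "p = F * q + r" unfolding q_def r_def by simp
    then have "r = p - F * q" by simp
    then have rS: "r \<in> mon_span S" using p Fq Pf(1) mon_span_diff[of p S "F * q"] by auto
    have "r \<in> V.span (P \<union> G)"
    proof (rule poly_in_by_terms)
      show "0 \<in> V.span (P \<union> G)" using submodule.zero_closed[OF sub] by simp
      fix i assume i: "poly.coeff r i \<noteq> 0"
      then have "i \<in> S" using rS by (auto dest: mon_spanD)
      moreover have "i < degree F"
        using i degree_mod_less[OF \<open>F \<noteq> 0\<close>, of p] le_degree[OF i] unfolding r_def by auto
      ultimately have "tpow i \<in> G" unfolding G_def by simp
      then have "poly.coeff r i \<odot>\<^bsub>?V\<^esub> tpow i \<in> V.span (P \<union> G)"
        using own by (intro submodule.smult_closed[OF sub]) auto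
      then show "Polynomial.monom (poly.coeff r i) i \<in> V.span (P \<union> G)"
        by (simp add: Polynomial.smult_monom)
    qed (rule add)
    moreover have "F * q \<in> V.span (P \<union> G)" using Fq own by auto
    ultimately show ?thesis using pqr add by simp
  qed
  then show ?thesis by (intro V.interval_length_finite[OF G P]) auto
qed

text \<open>For \<open>g \<in> Q - P\<close> the descending chain \<open>P + g\<^sup>i R\<close> becomes stationary, since \<open>P\<close> has finite
  codimension. So \<open>g\<^sup>i (1 - g h) \<in> P\<close> for some \<open>h\<close>, and then \<open>1 \<in> Q\<close>.\<close>

lemma nonzero_prime_maximal:
  assumes P: "primeideal P R" and Q: "primeideal Q R" and "P \<subset> Q" and f: "f \<in> P" "f \<noteq> 0"
  shows False
proof -
  interpret P: primeideal P R by (rule P)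
  interpret Q: primeideal Q R by (rule Q)
  note Pf = ideal_facts[OF P.is_ideal] and Qf = ideal_facts[OF Q.is_ideal]
  let ?V = "k_space (ring_as_module R)"
  interpret V: vectorspace class_ring ?V
    by (rule k_space_vectorspace) (rule R.ring_as_module_module)
  obtain g where g: "g \<in> Q" "g \<notin> P" using \<open>P \<subset> Q\<close> by blast
  then have gS: "g \<in> mon_span S" using Qf(1) by auto
  have gpow: "g ^ i \<in> mon_span S" for i
    by (rule mon_span_pow[OF gS]) (auto intro: S_add)
  define I where "I i = {p + g ^ i * q | p q. p \<in> P \<and> q \<in> mon_span S}" for i
  have "submodule class_ring (I i) ?V" for i
    unfolding submodule_def
  proof (intro conjI allI impI)
    show "Module.module class_ring ?V" by (rule V.module_axioms)
    show "I i \<subseteq> carrier ?V"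
      unfolding I_def using Pf(1) gpow by (auto intro!: mon_span_add mult_in_R)
    show "\<zero>\<^bsub>?V\<^esub> \<in> I i" unfolding I_def using Pf(2) by (intro CollectI exI[of _ 0]) simp
    fix v w assume "v \<in> I i" "w \<in> I i"
    then obtain p q p' q' where "p \<in> P" "q \<in> mon_span S" "p' \<in> P" "q' \<in> mon_span S"
      "v = p + g ^ i * q" "w = p' + g ^ i * q'" unfolding I_def by blast
    then show "v \<oplus>\<^bsub>?V\<^esub> w \<in> I i"
      unfolding I_def using Pf(3) by (intro CollectI exI[of _ "p + p'"] exI[of _ "q + q'"])
        (simp add: mon_span_add algebra_simps)
  next
    fix b v assume "v \<in> I i"
    then obtain p q where "p \<in> P" "q \<in> mon_span S" "v = p + g ^ i * q" unfolding I_def by blast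
    then show "b \<odot>\<^bsub>?V\<^esub> v \<in> I i"
      unfolding I_def using Pf(5)[of p "[:b:]"] mult_in_R[of "[:b:]" q]
      by (intro CollectI exI[of _ "[:b:] * p"] exI[of _ "[:b:] * q"]) (simp add: algebra_simps smult_add_right)
  qed
  note sub = this
  have step: "I (Suc i) \<subseteq> I i" for i
  proof
    fix v assume "v \<in> I (Suc i)"
    then obtain p q where "p \<in> P" "q \<in> mon_span S" "v = p + g ^ Suc i * q" unfolding I_def by blast
    then show "v \<in> I i" unfolding I_def using gS
      by (intro CollectI exI[of _ p] exI[of _ "g * q"]) (simp add: mult_in_R ac_simps)
  qed
  have "\<exists>i. I (Suc i) = I i"
  proof (rule ccontr)
    assume "\<nexists>i. I (Suc i) = I i"
    then have strict: "I (Suc i) \<subset> I i" for i using step[of i] by blast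
    have "enat k \<le> interval_length class_ring ?V P (carrier R)" for k
    proof (rule interval_length_ge[of k class_ring "\<lambda>j. I (k - j)"])
      fix i
      have "P \<subseteq> I (k - i)" unfolding I_def
      proof
        fix p assume "p \<in> P"
        then show "p \<in> {p + g ^ (k - i) * q | p q. p \<in> P \<and> q \<in> mon_span S}"
          by (intro CollectI exI[of _ p] exI[of _ 0]) simp
      qed
      then show "submodule class_ring (I (k - i)) ?V \<and> P \<subseteq> I (k - i) \<and> I (k - i) \<subseteq> carrier R"
        using sub[of "k - i"] submodule.subset[OF sub[of "k - i"]] by simp
    next
      fix i assume "i < k"
      then have "k - i = Suc (k - Suc i)" by simp
      then show "I (k - i) \<subset> I (k - Suc i)" using strict[of "k - Suc i"] by simp
    qed
    note unbounded = this
    have "interval_length class_ring ?V P (carrier R) < \<infinity>"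
      by (rule ideal_finite_codimension[OF P.is_ideal f])
    then obtain l where "interval_length class_ring ?V P (carrier R) = enat l"
      by (cases "interval_length class_ring ?V P (carrier R)") auto
    then show False using unbounded[of "Suc l"] by simp
  qed
  then obtain i where i: "I (Suc i) = I i" by blast
  have "g ^ i \<in> I i" unfolding I_def using Pf(2) by (intro CollectI exI[of _ 0] exI[of _ 1]) simp
  then have "g ^ i \<in> I (Suc i)" by (simp only: i)
  then obtain p h where ph: "p \<in> P" "h \<in> mon_span S" "g ^ i = p + g ^ Suc i * h"
    unfolding I_def by blast
  then have "g ^ i * (1 - g * h) = p" by (simp add: algebra_simps)
  moreover have gh: "g * h \<in> Q" using Qf(5)[OF g(1) ph(2)] by (simp add: mult.commute)
  moreover have "1 - g * h \<in> mon_span S" using mult_in_R[OF gS ph(2)] by (intro mon_span_diff) simp_all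
  ultimately have "g ^ i \<in> P \<or> 1 - g * h \<in> P"
    using P.I_prime[of "g ^ i" "1 - g * h"] gpow ph(1) by simp
  moreover have "g ^ j \<notin> P" for j
  proof (induction j)
    case 0
    show ?case using Pf(5)[of 1 g] gS g by auto
  next
    case (Suc j)
    then show ?case using P.I_prime[of g "g ^ j"] gS gpow[of j] g by auto
  qed
  ultimately have "1 - g * h \<in> Q" using \<open>P \<subset> Q\<close> by blast
  then have "1 \<in> Q" using Qf(3)[OF _ gh, of "1 - g * h"] by simp
  then have "mon_span S \<subseteq> Q" using Qf(5)[of 1] by auto
  then show False using Q.I_notcarr Qf(1) by auto
qed

lemma max_ideal_coeff: "p \<in> mon_span S \<Longrightarrow> p \<in> mon_span (S - {0}) \<longleftrightarrow> poly.coeff p 0 = 0"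
  unfolding mon_span_def by (auto, metis gr0I)

lemma max_ideal_prime: "primeideal (mon_span (S - {0})) R"
proof (rule primeidealI[OF max_ideal_ideal R.cring_axioms])
  have "(1 :: 'k poly) \<notin> mon_span (S - {0})" using max_ideal_coeff[of 1] by simp
  then show "carrier R \<noteq> mon_span (S - {0})" using one_in_R by auto
  fix p q :: "'k poly" assume "p \<in> carrier R" "q \<in> carrier R" "p \<otimes>\<^bsub>R\<^esub> q \<in> mon_span (S - {0})"
  then show "p \<in> mon_span (S - {0}) \<or> q \<in> mon_span (S - {0})"
    using max_ideal_coeff[OF mult_in_R[of p q]] by (simp add: max_ideal_coeff coeff_mult)
qed

lemma zero_ideal_prime: "primeideal {0} R"
proof (rule primeidealI[OF _ R.cring_axioms])
  show "ideal {0} R" using R.zeroideal by simp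
  show "carrier R \<noteq> {0}"
  proof
    assume "carrier R = {0}"
    then have "(1 :: 'k poly) \<in> {0}" using one_in_R carrier_R by blast
    then show False by simp
  qed
qed auto

lemma krull_dim_R: "krull_dim R = 1"
proof (rule antisym)
  show "krull_dim R \<le> 1"
    unfolding krull_dim_def
  proof (rule SUP_least)
    fix k assume "k \<in> {n. \<exists>P. (\<forall>i\<le>n. primeideal (P i) R) \<and> (\<forall>i<n. P i \<subset> P (Suc i))}"
    then obtain P where P: "\<forall>i\<le>k. primeideal (P i) R" "\<forall>i<k. P i \<subset> P (Suc i)" by blast
    have "\<not> 2 \<le> k"
    proof
      assume "2 \<le> k"
      then have prime: "primeideal (P 0) R" "primeideal (P 1) R" "primeideal (P 2) R"
        and sub: "P 0 \<subset> P 1" "P 1 \<subset> P 2"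
        using P(1) P(2)[rule_format, of 0] P(2)[rule_format, of 1] by (auto simp: numeral_2_eq_2)
      have "0 \<in> P 0" using ideal_facts(2)[OF primeideal.axioms(1)[OF prime(1)]] .
      then obtain f where "f \<in> P 1" "f \<noteq> 0" using sub(1) by blast
      then show False using nonzero_prime_maximal[OF prime(2,3) sub(2)] by blast
    qed
    then show "enat k \<le> 1" by (simp add: one_enat_def)
  qed
  have "(tpow (a 0) :: 'k poly) \<in> mon_span (S - {0})" "(tpow (a 0) :: 'k poly) \<noteq> 0"
    by (simp_all add: monom_eq_0_iff)
  then have "{0} \<subset> (mon_span (S - {0}) :: 'k poly set)" using mon_span_zero by blast
  then have "1 \<in> {n. \<exists>P. (\<forall>i\<le>n. primeideal (P i) R) \<and> (\<forall>i<n. P i \<subset> P (Suc i))}"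
    using zero_ideal_prime max_ideal_prime
    by (intro CollectI exI[of _ "\<lambda>i. if i = 0 then {0} else mon_span (S - {0})"]) simp
  then show "1 \<le> krull_dim R" unfolding krull_dim_def one_enat_def by (rule SUP_upper)
qed

end

section \<open>Multiplicity and number of generators\<close>

locale semigroup_ring_module =
  numerical_semigroup_ring n a R + Module.module R M
  for n :: nat and a :: "nat \<Rightarrow> nat" and R :: "'k::field poly ring"
    and M :: "('k poly, 'm, 'z) module_scheme"
begin

abbreviation \<tau> :: "'k poly" where "\<tau> \<equiv> tpow (a 0)"

abbreviation max_ideal :: "'k poly set" where "max_ideal \<equiv> mon_span (S - {0})"

abbreviation max_ideal_power :: "nat \<Rightarrow> 'k poly set" where
  "max_ideal_power s \<equiv> mon_span (max_ideal_pow_exps s)"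

abbreviation act :: "'k poly \<Rightarrow> 'm \<Rightarrow> 'm" (infixl \<open>\<star>\<close> 70) where
  "r \<star> z \<equiv> r \<odot>\<^bsub>M\<^esub> z"

lemma tau_in_R [simp]: "\<tau> \<in> mon_span S"
  by simp

lemma smult_R_closed: "r \<in> mon_span S \<Longrightarrow> x \<in> carrier M \<Longrightarrow> r \<star> x \<in> carrier M"
  using smult_closed[of r x] by simp

lemma smult_R_assoc:
  "r \<in> mon_span S \<Longrightarrow> s \<in> mon_span S \<Longrightarrow> x \<in> carrier M \<Longrightarrow> (r * s) \<star> x = r \<star> (s \<star> x)"
  using smult_assoc1[of r s x] by simp

lemma smult_R_add:
  "r \<in> mon_span S \<Longrightarrow> s \<in> mon_span S \<Longrightarrow> x \<in> carrier M \<Longrightarrow> (r + s) \<star> x = r \<star> x \<oplus>\<^bsub>M\<^esub> s \<star> x"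
  using smult_l_distr[of r s x] by simp

lemma smult_zero_left: "x \<in> carrier M \<Longrightarrow> 0 \<star> x = \<zero>\<^bsub>M\<^esub>"
  using lmult_0[of x] by simp

lemma ideal_smult_gens: "I \<subseteq> mon_span S \<Longrightarrow> {r \<star> x | r x. r \<in> I \<and> x \<in> carrier M} \<subseteq> carrier M"
  using smult_R_closed by blast

lemma ideal_smult_submodule: "I \<subseteq> mon_span S \<Longrightarrow> submodule R (ideal_smult R I M) M"
  unfolding ideal_smult_def by (intro span_is_submodule ideal_smult_gens)

lemma ideal_smult_mem:
  assumes "I \<subseteq> mon_span S" "r \<in> I" "x \<in> carrier M"
  shows "r \<star> x \<in> ideal_smult R I M"
  unfolding ideal_smult_def
  by (rule subsetD[OF in_own_span[OF ideal_smult_gens[OF assms(1)]]]) (use assms in blast)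

lemma ideal_smult_least:
  assumes "submodule R N M" "\<And>r x. r \<in> I \<Longrightarrow> x \<in> carrier M \<Longrightarrow> r \<star> x \<in> N"
  shows "ideal_smult R I M \<subseteq> N"
  unfolding ideal_smult_def by (rule span_is_subset[OF _ assms(1)]) (use assms(2) in blast)

lemma max_ideal_sub: "max_ideal \<subseteq> mon_span S"
  by (rule mon_span_mono) blast

lemma max_ideal_power_sub: "max_ideal_power s \<subseteq> mon_span S"
  by (rule mon_span_mono) (rule max_ideal_pow_exps_sub)

subsection \<open>Maximal Cohen-Macaulay modules\<close>

text \<open>A high power of any \<open>r\<close> in the maximal ideal is a multiple of \<open>\<tau>\<close>. So \<open>\<tau>\<close> is regular on \<open>M\<close> as
  soon as some element of the maximal ideal is.\<close>

lemma tau_regularI: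
  assumes r: "r \<in> max_ideal" "\<And>x. x \<in> carrier M \<Longrightarrow> r \<star> x = \<zero>\<^bsub>M\<^esub> \<Longrightarrow> x = \<zero>\<^bsub>M\<^esub>"
    and z: "z \<in> carrier M" "\<tau> \<star> z = \<zero>\<^bsub>M\<^esub>"
  shows "z = \<zero>\<^bsub>M\<^esub>"
proof -
  obtain c where c: "\<And>u. u \<ge> c \<Longrightarrow> u \<in> S" using conductor by blast
  have rS: "r \<in> mon_span S" using r max_ideal_sub by blast
  have powS: "r ^ k \<in> mon_span S" for k by (rule mon_span_pow[OF rS]) (auto intro: S_add)
  have "r ^ k \<in> mon_span {u. u \<ge> k}" for k
  proof (induction k)
    case 0
    show ?case by (simp add: mon_span_def)
  next
    case (Suc k)
    have "r * r ^ k \<in> mon_span {u. u \<ge> Suc k}"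
      by (rule mon_span_mult[OF r(1) Suc]) auto
    then show ?case by simp
  qed
  then have "r ^ (c + a 0) \<in> mon_span {u. u \<ge> c + a 0}" .
  then obtain q where q: "q \<in> mon_span S" "r ^ (c + a 0) = \<tau> * q"
  proof (rule mon_span_shift[where e = "a 0" and F = S])
    show "a 0 \<le> i \<and> i - a 0 \<in> S" if "i \<in> {u. u \<ge> c + a 0}" for i using that by (simp add: c)
  qed
  have "r ^ (c + a 0) \<star> z = q \<star> (\<tau> \<star> z)"
    using q z(1) smult_R_assoc[of q \<tau> z] by (simp add: mult.commute)
  also have "\<dots> = \<zero>\<^bsub>M\<^esub>" using z(2) q(1) by simp
  finally have "r ^ (c + a 0) \<star> z = \<zero>\<^bsub>M\<^esub>" .
  moreover have "r ^ k \<star> z = \<zero>\<^bsub>M\<^esub> \<Longrightarrow> z = \<zero>\<^bsub>M\<^esub>" for k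
  proof (induction k)
    case 0
    then show ?case using smult_one[OF z(1)] by simp
  next
    case (Suc k)
    then show ?case
      using r(2)[OF smult_R_closed[OF powS z(1)]] smult_R_assoc[OF rS powS z(1)] by simp
  qed
  ultimately show ?thesis by blast
qed

lemma maximal_Cohen_Macaulay_facts:
  assumes "maximal_Cohen_Macaulay R (irrelevant_ideal (a ` {..<n})) M"
  shows "\<exists>X. finite X \<and> X \<subseteq> carrier M \<and> span X = carrier M"
    and "\<And>x. x \<in> carrier M \<Longrightarrow> \<tau> \<star> x = \<zero>\<^bsub>M\<^esub> \<Longrightarrow> x = \<zero>\<^bsub>M\<^esub>"
    and "carrier M \<noteq> {\<zero>\<^bsub>M\<^esub>}"
proof -
  show "\<exists>X. finite X \<and> X \<subseteq> carrier M \<and> span X = carrier M"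
    using assms unfolding maximal_Cohen_Macaulay_def by blast
  have "depth R max_ideal M = 1"
    using assms unfolding maximal_Cohen_Macaulay_def krull_dim_R irrelevant_ideal_eq by blast
  then have "\<not> (depth R max_ideal M \<le> 0)" by simp
  moreover have "depth R max_ideal M \<le> 0"
    if "\<And>rs. set rs \<subseteq> max_ideal \<Longrightarrow> regular_sequence R M rs \<Longrightarrow> rs = []"
    unfolding depth_def
  proof (rule SUP_least)
    fix rs assume "rs \<in> {rs. set rs \<subseteq> max_ideal \<and> regular_sequence R M rs}"
    then have "rs = []" using that by blast
    then show "enat (length rs) \<le> 0" by (simp add: enat_0)
  qed
  ultimately obtain rs where rs: "set rs \<subseteq> max_ideal" "regular_sequence R M rs" "rs \<noteq> []"
    by blast
  then have r: "rs ! 0 \<in> max_ideal" by (auto simp: nth_mem)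
  have sub: "ideal_smult R (Idl\<^bsub>R\<^esub> {}) M \<subseteq> {\<zero>\<^bsub>M\<^esub>}"
  proof (rule ideal_smult_least[OF submodule_zero])
    fix r x assume "r \<in> Idl\<^bsub>R\<^esub> {}" "x \<in> carrier M"
    moreover have "Idl\<^bsub>R\<^esub> {} \<subseteq> {\<zero>\<^bsub>R\<^esub>}" by (rule R.genideal_minimal[OF R.zeroideal]) blast
    ultimately show "r \<star> x \<in> {\<zero>\<^bsub>M\<^esub>}" using smult_zero_left by auto
  qed
  have "ideal (Idl\<^bsub>R\<^esub> {}) R" by (rule R.genideal_ideal) blast
  then have z: "\<zero>\<^bsub>M\<^esub> \<in> ideal_smult R (Idl\<^bsub>R\<^esub> {}) M"
    by (intro submodule.zero_closed[OF ideal_smult_submodule] ideal_facts(1))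
  have reg: "x = \<zero>\<^bsub>M\<^esub>" if "x \<in> carrier M" "rs ! 0 \<star> x = \<zero>\<^bsub>M\<^esub>" for x
  proof -
    have "\<forall>x\<in>carrier M. rs ! 0 \<star> x \<in> ideal_smult R (Idl\<^bsub>R\<^esub> {}) M \<longrightarrow> x \<in> ideal_smult R (Idl\<^bsub>R\<^esub> {}) M"
      using rs(2,3) unfolding regular_sequence_def by force
    then show ?thesis using that z sub by auto
  qed
  show "\<And>x. x \<in> carrier M \<Longrightarrow> \<tau> \<star> x = \<zero>\<^bsub>M\<^esub> \<Longrightarrow> x = \<zero>\<^bsub>M\<^esub>"
    using tau_regularI[OF r reg] by blast
  show "carrier M \<noteq> {\<zero>\<^bsub>M\<^esub>}"
  proof
    assume M: "carrier M = {\<zero>\<^bsub>M\<^esub>}"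
    have "set rs \<subseteq> carrier R" using rs(1) max_ideal_sub by auto
    then have "ideal (Idl\<^bsub>R\<^esub> (set rs)) R" by (rule R.genideal_ideal)
    then have sub: "submodule R (ideal_smult R (Idl\<^bsub>R\<^esub> (set rs)) M) M"
      by (intro ideal_smult_submodule ideal_facts(1))
    have "ideal_smult R (Idl\<^bsub>R\<^esub> (set rs)) M = carrier M"
      using submodule.subset[OF sub] submodule.zero_closed[OF sub] unfolding M by blast
    then show False using rs(2) unfolding regular_sequence_def by blast
  qed
qed

subsection \<open>Colengths\<close>

lemma submodule_monom_image:
  "u \<in> S \<Longrightarrow> submodule R X M \<Longrightarrow> submodule R ((\<star>) (tpow u) ` X) M"
  by (rule submodule_smult_image) (simp_all add: mon_span_monom)

text \<open>Over \<open>k\<close> the quotient \<open>M / t\<^sup>u M\<close> is spanned by the products \<open>t\<^sup>v x\<close> of generators \<open>x\<close> with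
  monomials of exponent below \<open>u\<close> plus the conductor.\<close>

lemma finite_colength:
  assumes u: "u \<in> S" and X: "finite X" "X \<subseteq> carrier M" "span X = carrier M"
  shows "interval_length R M ((\<star>) (tpow u) ` carrier M) (carrier M) < \<infinity>"
proof -
  let ?V = "k_space M" and ?A = "(\<star>) (tpow u) ` carrier M"
  interpret V: vectorspace class_ring ?V by (rule k_space_vectorspace) (rule module_axioms)
  obtain c where c: "\<And>u. u \<ge> c \<Longrightarrow> u \<in> S" using conductor by blast
  define G where "G = (\<lambda>(v, x). tpow v \<star> x) ` ((S \<inter> {..<c + u}) \<times> X)"
  have G: "finite G" "G \<subseteq> carrier ?V"
    unfolding G_def using X by (auto intro!: smult_R_closed mon_span_monom)
  have A: "submodule class_ring ?A ?V"
    by (rule submodule_k_space[OF submodule_monom_image[OF u submodule_carrier]])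
  have AG: "?A \<union> G \<subseteq> carrier ?V" using submodule.subset[OF A] G(2) by (rule Un_least)
  let ?W = "V.span (?A \<union> G)"
  have sub: "submodule class_ring ?W ?V" by (rule V.span_is_submodule[OF AG])
  have own: "?A \<subseteq> ?W" "G \<subseteq> ?W" using V.in_own_span[OF AG] by blast+
  have add: "x \<oplus>\<^bsub>M\<^esub> y \<in> ?W" if "x \<in> ?W" "y \<in> ?W" for x y
    using submodule.m_closed[OF sub that] by simp
  have Wsub: "?W \<subseteq> carrier M" and W0: "\<zero>\<^bsub>M\<^esub> \<in> ?W"
    using submodule.subset[OF sub] submodule.zero_closed[OF sub] by simp_all
  have smult_W: "r \<star> x \<in> ?W" if x: "x \<in> X" and r: "r \<in> mon_span S" for r x
  proof -
    have xM: "x \<in> carrier M" using x X(2) by blast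
    have "r \<in> {r \<in> mon_span S. r \<star> x \<in> ?W}"
    proof (rule poly_in_by_terms)
      show "0 \<in> {r \<in> mon_span S. r \<star> x \<in> ?W}" using W0 smult_zero_left[OF xM] by simp
      show "p + q \<in> {r \<in> mon_span S. r \<star> x \<in> ?W}"
        if "p \<in> {r \<in> mon_span S. r \<star> x \<in> ?W}" "q \<in> {r \<in> mon_span S. r \<star> x \<in> ?W}" for p q
        using that add by (simp add: smult_R_add[OF _ _ xM] mon_span_add)
      fix i assume i: "poly.coeff r i \<noteq> 0"
      define b where "b = poly.coeff r i"
      have iS: "i \<in> S" using mon_spanD[OF r i] .
      have "Polynomial.monom b i \<star> x \<in> ?W"
      proof (cases "i < c + u")
        case True
        then have "tpow i \<star> x \<in> G" unfolding G_def using iS x by force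
        then have "[:b:] \<star> (tpow i \<star> x) \<in> ?W"
          using own(2) submodule.smult_closed[OF sub, of b] by auto
        then show ?thesis
          using smult_R_assoc[of "[:b:]" "tpow i" x] iS xM
          by (simp add: mon_span_monom Polynomial.smult_monom)
      next
        case False
        then have iu: "i - u \<in> S" using c[of "i - u"] by simp
        have "Polynomial.monom b i \<star> x = tpow u \<star> (Polynomial.monom b (i - u) \<star> x)"
          using smult_R_assoc[of "tpow u" "Polynomial.monom b (i - u)" x] u iu xM False
          by (simp add: mon_span_monom mult_monom)
        moreover have "Polynomial.monom b (i - u) \<star> x \<in> carrier M"
          using iu xM by (intro smult_R_closed mon_span_monom)
        ultimately show ?thesis using own(1) by blast
      qed
      then show "Polynomial.monom (poly.coeff r i) i \<in> {r \<in> mon_span S. r \<star> x \<in> ?W}"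
        using iS by (simp add: b_def mon_span_monom)
    qed
    then show ?thesis by simp
  qed
  have "carrier M \<subseteq> ?W"
  proof
    fix z assume "z \<in> carrier M"
    then obtain b where b: "b \<in> X \<rightarrow> carrier R" "lincomb b X = z"
      using finite_in_span[OF X(1,2)] X(3) by blast
    have "(\<Oplus>\<^bsub>M\<^esub>v\<in>X. b v \<star> v) \<in> ?W"
      using b(1) by (intro finsum_in_subset[OF M.abelian_monoid_axioms Wsub W0 add X(1)] smult_W) auto
    then show "z \<in> ?W" using b(2) unfolding lincomb_def by simp
  qed
  then have "interval_length class_ring ?V ?A (carrier M) < \<infinity>"
    by (rule V.interval_length_finite[OF G A])
  then show ?thesis using interval_length_k_space[of M ?A "carrier M"] by (rule le_less_trans[rotated])
qed

lemma max_ideal_power_shift: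
  obtains c where "\<And>s. s \<ge> c \<Longrightarrow>
    ideal_smult R (max_ideal_power (Suc s)) M = (\<star>) \<tau> ` ideal_smult R (max_ideal_power s) M"
proof -
  obtain c where c: "\<And>s u. s \<ge> c \<Longrightarrow> u \<in> max_ideal_pow_exps (Suc s) \<Longrightarrow>
      a 0 \<le> u \<and> u - a 0 \<in> max_ideal_pow_exps s" using max_ideal_pow_exps_shift by blast
  show ?thesis
  proof (rule that)
    fix s assume s: "s \<ge> c"
    let ?N = "ideal_smult R (max_ideal_power s) M" and ?N' = "ideal_smult R (max_ideal_power (Suc s)) M"
    have N: "submodule R ?N M" "submodule R ?N' M"
      by (rule ideal_smult_submodule[OF max_ideal_power_sub])+
    show "?N' = (\<star>) \<tau> ` ?N"
    proof
      show "?N' \<subseteq> (\<star>) \<tau> ` ?N"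
      proof (rule ideal_smult_least)
        show "submodule R ((\<star>) \<tau> ` ?N) M" by (rule submodule_monom_image[OF a0_in_S N(1)])
        fix r x assume r: "r \<in> max_ideal_power (Suc s)" and x: "x \<in> carrier M"
        obtain q where q: "q \<in> max_ideal_power s" "r = \<tau> * q"
          using mon_span_shift[OF r c[OF s]] by blast
        then have "r \<star> x = \<tau> \<star> (q \<star> x)"
          using smult_R_assoc[of \<tau> q x] x max_ideal_power_sub by auto
        moreover have "q \<star> x \<in> ?N" using q(1) x by (rule ideal_smult_mem[OF max_ideal_power_sub])
        ultimately show "r \<star> x \<in> (\<star>) \<tau> ` ?N" by blast
      qed
      have "?N \<subseteq> {x \<in> carrier M. \<tau> \<star> x \<in> ?N'}"
      proof (rule ideal_smult_least)
        show "submodule R {x \<in> carrier M. \<tau> \<star> x \<in> ?N'} M"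
          by (rule submodule_smult_vimage[OF _ N(2)]) simp
        fix q x assume q: "q \<in> max_ideal_power s" and x: "x \<in> carrier M"
        have qS: "q \<in> mon_span S" using q max_ideal_power_sub by blast
        have "\<tau> * q \<in> max_ideal_power (Suc s)"
          using mon_span_mult[of q "max_ideal_pow_exps s" \<tau> "S - {0}" "max_ideal_pow_exps (Suc s)"] q
          by (simp add: mult.commute) blast
        then have "(\<tau> * q) \<star> x \<in> ?N'" using x by (rule ideal_smult_mem[OF max_ideal_power_sub])
        then show "q \<star> x \<in> {x \<in> carrier M. \<tau> \<star> x \<in> ?N'}"
          using smult_R_closed[OF qS x] smult_R_assoc[OF tau_in_R qS x] by simp
      qed
      then show "(\<star>) \<tau> ` ?N \<subseteq> ?N'" by blast
    qed
  qed
qed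

lemma ideal_smult_power_lower:
  "(\<star>) (tpow (s * a 0)) ` carrier M \<subseteq> ideal_smult R (max_ideal_power s) M"
proof -
  have "s * a 0 \<in> max_ideal_pow_exps s"
  proof (cases s)
    case (Suc r)
    then show ?thesis using max_ideal_pow_exps_large[of "a 0" r] by (simp add: add.commute)
  qed simp
  then show ?thesis using ideal_smult_mem[OF max_ideal_power_sub[of s]] by (auto intro: mon_span_monom)
qed

text \<open>For large \<open>s\<close> the colength of \<open>\<mm>\<^sup>s M\<close> grows in each step by the length of \<open>M / \<tau> M\<close>, because
  \<open>\<mm>\<^bsup>s+1\<^esup> M = \<tau> \<mm>\<^sup>s M\<close> and multiplication by \<open>\<tau>\<close> is injective. So this length is the
  multiplicity.\<close>

lemma multiplicity_eq:
  assumes X: "finite X" "X \<subseteq> carrier M" "span X = carrier M"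
    and reg: "\<And>x. x \<in> carrier M \<Longrightarrow> \<tau> \<star> x = \<zero>\<^bsub>M\<^esub> \<Longrightarrow> x = \<zero>\<^bsub>M\<^esub>"
  obtains l where "interval_length R M ((\<star>) \<tau> ` carrier M) (carrier M) = enat l"
    "hilbert_samuel_multiplicity R (irrelevant_ideal (a ` {..<n})) M = real l"
proof -
  let ?len = "\<lambda>A. interval_length R M A (carrier M)"
  define N where "N s = ideal_smult R (max_ideal_power s) M" for s
  have N: "submodule R (N s) M" for s
    unfolding N_def by (rule ideal_smult_submodule[OF max_ideal_power_sub])
  obtain l where l: "?len ((\<star>) \<tau> ` carrier M) = enat l"
    using finite_colength[OF a0_in_S X] by (cases "?len ((\<star>) \<tau> ` carrier M)") auto
  have "?len (N s) < \<infinity>" for s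
  proof -
    have "?len (N s) \<le> ?len ((\<star>) (tpow (s * a 0)) ` carrier M)"
      unfolding N_def by (rule interval_length_mono[OF ideal_smult_power_lower order_refl])
    also have "\<dots> < \<infinity>" by (rule finite_colength[OF S_mult[OF a0_in_S] X])
    finally show ?thesis .
  qed
  then have "\<forall>s. \<exists>k. ?len (N s) = enat k" by (metis enat_ord_simps(4) not_enat_eq less_infinityE)
  then obtain L where L: "\<And>s. ?len (N s) = enat (L s)" by metis
  obtain c where c: "\<And>s. s \<ge> c \<Longrightarrow> N (Suc s) = (\<star>) \<tau> ` N s"
    using max_ideal_power_shift unfolding N_def by blast
  have step: "L (Suc s) = L s + l" if "s \<ge> c" for s
  proof -
    have sub: "submodule R ((\<star>) \<tau> ` carrier M) M"
      by (rule submodule_monom_image[OF a0_in_S submodule_carrier])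
    have "?len (N (Suc s)) = interval_length R M (N (Suc s)) ((\<star>) \<tau> ` carrier M) + ?len ((\<star>) \<tau> ` carrier M)"
      by (rule interval_length_add[OF N sub submodule_carrier])
        (use c[OF that] submodule.subset[OF N[of s]] submodule.subset[OF sub] in auto)
    also have "interval_length R M (N (Suc s)) ((\<star>) \<tau> ` carrier M) = ?len (N s)"
      unfolding c[OF that]
      by (rule interval_length_smult[OF _ reg submodule.subset[OF N]]) simp_all
    finally show ?thesis unfolding L l by simp
  qed
  have L_eq: "L (c + d) = L c + d * l" for d
    by (induction d) (simp_all add: step)
  have "(\<lambda>s. real l + (real (L c) - real (c * l)) / real s) \<longlonglongrightarrow> real l + 0"
    by (intro tendsto_add tendsto_const lim_const_over_n)
  moreover have "\<forall>\<^sub>F s in sequentially. real l + (real (L c) - real (c * l)) / real s = real (L s) / real s"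
    using eventually_ge_at_top[of "Suc c"]
  proof eventually_elim
    case (elim s)
    then have "L s = L c + (s - c) * l" using L_eq[of "s - c"] by simp
    then have "real (L s) = real (L c) + (real s - real c) * real l" using elim by (simp add: of_nat_diff)
    then show ?case using elim by (simp add: field_simps)
  qed
  ultimately have "(\<lambda>s. real (L s) / real s) \<longlonglongrightarrow> real l + 0" by (rule Lim_transform_eventually)
  then have "lim (\<lambda>s. real (L s) / real s) = real l" by (simp add: limI)
  moreover have "module_length R (quot_module M (ideal_smult R (max_ideal [^]\<^bsub>ideals_set R\<^esub> s) M)) = enat (L s)" for s
    unfolding max_ideal_pow N_def[symmetric] module_length_quot[OF N] by (rule L)
  ultimately have "hilbert_samuel_multiplicity R (irrelevant_ideal (a ` {..<n})) M = real l"
    unfolding hilbert_samuel_multiplicity_def irrelevant_ideal_eq krull_dim_R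
    by (simp add: one_enat_def)
  with l that show ?thesis by blast
qed

subsection \<open>Number of generators\<close>

text \<open>On \<open>M / \<mm> M\<close> the ring acts through its residue field \<open>k\<close>, so length and dimension agree.\<close>

lemma num_generators_eq:
  assumes X: "finite X" "X \<subseteq> carrier M" "span X = carrier M"
  shows "interval_length R M (ideal_smult R max_ideal M) (carrier M)
    = enat (num_generators (\<lambda>c. [:c:]) R (irrelevant_ideal (a ` {..<n})) M)"
proof -
  let ?N = "ideal_smult R max_ideal M"
  have N: "submodule R ?N M" by (rule ideal_smult_submodule[OF max_ideal_sub])
  let ?Q = "quot_module M ?N"
  have Qmod: "Module.module R ?Q" by (rule quot_module_module[OF N])
  interpret V: vectorspace class_ring "k_space ?Q" by (rule k_space_vectorspace[OF Qmod])
  have act: "r \<odot>\<^bsub>?Q\<^esub> C = [:poly.coeff r 0:] \<odot>\<^bsub>?Q\<^esub> C" if r: "r \<in> mon_span S" and C: "C \<in> carrier ?Q" for r C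
  proof -
    obtain x where x: "x \<in> carrier M" "C = ?N +>\<^bsub>M\<^esub> x" using C by (rule quot_carrierE[OF N])
    have "r - [:poly.coeff r 0:] \<in> mon_span S" using r by (intro mon_span_diff) simp_all
    then have "r - [:poly.coeff r 0:] \<in> max_ideal" by (simp add: max_ideal_coeff)
    then have "(r - [:poly.coeff r 0:]) \<star> x \<in> ?N" using x(1) by (rule ideal_smult_mem[OF max_ideal_sub])
    moreover have "(r - [:poly.coeff r 0:]) \<star> x = r \<star> x \<ominus>\<^bsub>M\<^esub> [:poly.coeff r 0:] \<star> x"
    proof -
      have "r \<star> x = (r - [:poly.coeff r 0:]) \<star> x \<oplus>\<^bsub>M\<^esub> [:poly.coeff r 0:] \<star> x"
        using smult_R_add[of "r - [:poly.coeff r 0:]" "[:poly.coeff r 0:]" x] r x(1)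
        by (simp add: mon_span_diff)
      then show ?thesis
        using smult_R_closed[OF _ x(1), of "r - [:poly.coeff r 0:]"] smult_R_closed[OF _ x(1), of "[:poly.coeff r 0:]"] r
        by (simp add: mon_span_diff a_minus_def M.a_assoc M.r_neg)
    qed
    ultimately have "?N +>\<^bsub>M\<^esub> (r \<star> x) = ?N +>\<^bsub>M\<^esub> ([:poly.coeff r 0:] \<star> x)"
      using coset_eq_iff[OF N smult_R_closed[OF r x(1)] smult_R_closed[OF const_in_R x(1)]] by simp
    then show ?thesis
      unfolding x(2) using coset_smult[OF N, of r x] coset_smult[OF N, of "[:poly.coeff r 0:]" x] r x(1)
      by (simp del: quot_module_simps)
  qed
  have "submodule R Y ?Q" if Y: "submodule class_ring Y (k_space ?Q)" for Y
    unfolding submodule_def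
  proof (intro conjI allI impI)
    show "Module.module R ?Q" by (rule Qmod)
    show Ysub: "Y \<subseteq> carrier ?Q" using submodule.subset[OF Y] unfolding restrict_scalars_simps .
    show "\<zero>\<^bsub>?Q\<^esub> \<in> Y" using submodule.zero_closed[OF Y] unfolding restrict_scalars_simps .
    show "v \<oplus>\<^bsub>?Q\<^esub> w \<in> Y" if "v \<in> Y" "w \<in> Y" for v w
      using submodule.m_closed[OF Y that] unfolding restrict_scalars_simps .
    fix r v assume r: "r \<in> carrier R" and v: "v \<in> Y"
    have "poly.coeff r 0 \<odot>\<^bsub>k_space ?Q\<^esub> v \<in> Y" by (rule submodule.smult_closed[OF Y _ v]) simp
    then show "r \<odot>\<^bsub>?Q\<^esub> v \<in> Y" using act[of r v] r subsetD[OF Ysub v] unfolding restrict_scalars_simps carrier_R by simp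
  qed
  then have "interval_length class_ring (k_space ?Q) {\<zero>\<^bsub>?Q\<^esub>} (carrier ?Q) \<le> interval_length R ?Q {\<zero>\<^bsub>?Q\<^esub>} (carrier ?Q)"
    by (intro interval_length_le_map[where F = "\<lambda>X. X"]) (auto simp del: quot_module_simps)
  then have eq: "module_length R ?Q = module_length class_ring (k_space ?Q)"
    using interval_length_k_space[of ?Q "{\<zero>\<^bsub>?Q\<^esub>}" "carrier ?Q"]
    unfolding module_length_eq restrict_scalars_simps by (rule antisym[rotated])
  have "V.fin_dim"
    unfolding V.fin_dim_def
  proof (intro exI conjI)
    let ?G = "(\<lambda>x. ?N +>\<^bsub>M\<^esub> x) ` X"
    show "finite ?G" using X(1) by simp
    show G: "?G \<subseteq> carrier (k_space ?Q)"
      unfolding restrict_scalars_simps using quot_ops(1)[OF N] X(2) by blast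
    have sub: "submodule class_ring (V.span ?G) (k_space ?Q)" by (rule V.span_is_submodule[OF G])
    have subR: "submodule R (V.span ?G) ?Q"
      by (fact \<open>\<And>Y. submodule class_ring Y (k_space ?Q) \<Longrightarrow> submodule R Y ?Q\<close>[OF sub])
    have "submodule R {x \<in> carrier M. ?N +>\<^bsub>M\<^esub> x \<in> V.span ?G} M" by (rule submodule_preimage_coset[OF N subR])
    moreover have "X \<subseteq> {x \<in> carrier M. ?N +>\<^bsub>M\<^esub> x \<in> V.span ?G}" using V.in_own_span[OF G] X(2) by blast
    ultimately have "span X \<subseteq> {x \<in> carrier M. ?N +>\<^bsub>M\<^esub> x \<in> V.span ?G}" by (intro span_is_subset)
    then have all: "?N +>\<^bsub>M\<^esub> x \<in> V.span ?G" if "x \<in> carrier M" for x using that X(3) by blast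
    have "carrier ?Q \<subseteq> V.span ?G"
    proof
      fix C assume "C \<in> carrier ?Q"
      then show "C \<in> V.span ?G" by (rule quot_carrierE[OF N]) (use all in simp)
    qed
    then show "V.span ?G = carrier (k_space ?Q)"
      using submodule.subset[OF sub] unfolding restrict_scalars_simps by blast
  qed
  then have "module_length class_ring (k_space ?Q) = enat V.dim" by (rule V.module_length_eq_dim)
  then show ?thesis
    unfolding num_generators_def irrelevant_ideal_eq eq[symmetric] module_length_quot[OF N] .
qed

text \<open>Both \<open>M / \<tau> M\<close> and its quotient \<open>M / \<mm> M\<close> have length \<open>e(M) = \<mu>(M)\<close>.\<close>

lemma Ulrich_max_ideal_smult:
  assumes "Ulrich_module (\<lambda>c. [:c:]) R (irrelevant_ideal (a ` {..<n})) M"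
  shows "ideal_smult R max_ideal M = (\<star>) \<tau> ` carrier M"
proof -
  have mcm: "maximal_Cohen_Macaulay R (irrelevant_ideal (a ` {..<n})) M"
    and mult: "hilbert_samuel_multiplicity R (irrelevant_ideal (a ` {..<n})) M
      = real (num_generators (\<lambda>c. [:c:]) R (irrelevant_ideal (a ` {..<n})) M)"
    using assms unfolding Ulrich_module_def by blast+
  obtain X where X: "finite X" "X \<subseteq> carrier M" "span X = carrier M"
    using maximal_Cohen_Macaulay_facts(1)[OF mcm] by blast
  let ?A = "(\<star>) \<tau> ` carrier M" and ?B = "ideal_smult R max_ideal M"
  have A: "submodule R ?A M" by (rule submodule_monom_image[OF a0_in_S submodule_carrier])
  have B: "submodule R ?B M" by (rule ideal_smult_submodule[OF max_ideal_sub])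
  have AB: "?A \<subseteq> ?B" using ideal_smult_mem[OF max_ideal_sub, of \<tau>] by auto
  obtain l where "interval_length R M ?A (carrier M) = enat l"
    "hilbert_samuel_multiplicity R (irrelevant_ideal (a ` {..<n})) M = real l"
    using multiplicity_eq[OF X maximal_Cohen_Macaulay_facts(2)[OF mcm]] by blast
  then have "interval_length R M ?A (carrier M) = enat l" "interval_length R M ?B (carrier M) = enat l"
    using mult num_generators_eq[OF X] by simp_all
  then have "interval_length R M ?A ?B = 0"
    using interval_length_add[OF A B submodule_carrier AB submodule.subset[OF B]]
    by (cases "interval_length R M ?A ?B") (auto simp: enat_0)
  moreover have "interval_length R M ?A ?A + 1 \<le> interval_length R M ?A ?B" if "?A \<noteq> ?B"
    using that AB by (intro interval_length_step[OF A B order_refl _ A]) blast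
  ultimately show ?thesis by fastforce
qed

end

section \<open>Syzygies of homogeneous generators\<close>

lemma finsum_delta:
  assumes "abelian_monoid M" "finite A" "i \<in> A" "z \<in> carrier M"
  shows "(\<Oplus>\<^bsub>M\<^esub>j\<in>A. if j = i then z else \<zero>\<^bsub>M\<^esub>) = z"
proof -
  interpret abelian_monoid M by fact
  have "(\<Oplus>\<^bsub>M\<^esub>j\<in>A. if j = i then z else \<zero>\<^bsub>M\<^esub>) = (\<Oplus>\<^bsub>M\<^esub>j\<in>A. if i = j then z else \<zero>\<^bsub>M\<^esub>)"
    by (rule finsum_cong') (use assms in auto)
  also have "\<dots> = z" using finsum_singleton[OF assms(3,2), of "\<lambda>_. z"] assms(4) by simp
  finally show ?thesis .
qed

context semigroup_ring_module
begin

definition combination :: "nat \<Rightarrow> (nat \<Rightarrow> 'm) \<Rightarrow> (nat \<Rightarrow> 'k poly) \<Rightarrow> 'm" where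
  "combination m x c = (\<Oplus>\<^bsub>M\<^esub>i\<in>{..<m}. c i \<star> x i)"

definition coeffs :: "nat \<Rightarrow> (nat \<Rightarrow> 'k poly) \<Rightarrow> bool" where
  "coeffs m c \<longleftrightarrow> (\<forall>i<m. c i \<in> mon_span S)"

definition syzygy :: "nat \<Rightarrow> (nat \<Rightarrow> 'm) \<Rightarrow> (nat \<Rightarrow> 'k poly) \<Rightarrow> bool" where
  "syzygy m x c \<longleftrightarrow> coeffs m c \<and> combination m x c = \<zero>\<^bsub>M\<^esub>"

lemma coordinateI: "syzygy m x c \<Longrightarrow> c i \<in> {c i | c. syzygy m x c}"
  by (intro CollectI exI[of _ c]) simp

lemma coeffsD: "coeffs m c \<Longrightarrow> i < m \<Longrightarrow> c i \<in> mon_span S"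
  unfolding coeffs_def by simp

lemma coeffs_add: "coeffs m c \<Longrightarrow> coeffs m d \<Longrightarrow> coeffs m (\<lambda>i. c i + d i)"
  unfolding coeffs_def by (simp add: mon_span_add)

lemma coeffs_smult: "r \<in> mon_span S \<Longrightarrow> coeffs m c \<Longrightarrow> coeffs m (\<lambda>i. r * c i)"
  unfolding coeffs_def by (simp add: mult_in_R)

lemma coeffs_unit: "r \<in> mon_span S \<Longrightarrow> coeffs m (\<lambda>j. if j = i then r else 0)"
  unfolding coeffs_def by simp

lemma coeffs_sum: "(\<And>d. d \<in> D \<Longrightarrow> coeffs m (f d)) \<Longrightarrow> coeffs m (\<lambda>i. \<Sum>d\<in>D. f d i)"
  unfolding coeffs_def by (auto intro: mon_span_sum)

context
  fixes m :: nat and x :: "nat \<Rightarrow> 'm"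
  assumes x_Pi: "x \<in> {..<m} \<rightarrow> carrier M"
begin

lemma x_mem: "i < m \<Longrightarrow> x i \<in> carrier M"
  using x_Pi by auto

lemma terms_closed: "coeffs m c \<Longrightarrow> (\<lambda>i. c i \<star> x i) \<in> {..<m} \<rightarrow> carrier M"
  using x_mem by (auto intro: smult_R_closed coeffsD)

lemma combination_closed: "coeffs m c \<Longrightarrow> combination m x c \<in> carrier M"
  unfolding combination_def by (rule M.finsum_closed) (rule terms_closed)

lemma combination_cong: "coeffs m d \<Longrightarrow> (\<And>i. i < m \<Longrightarrow> c i = d i) \<Longrightarrow> combination m x c = combination m x d"
  unfolding combination_def using terms_closed[of d] by (intro M.finsum_cong') auto

lemma combination_add:
  assumes "coeffs m c" "coeffs m d"
  shows "combination m x (\<lambda>i. c i + d i) = combination m x c \<oplus>\<^bsub>M\<^esub> combination m x d"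
proof -
  have "combination m x (\<lambda>i. c i + d i) = (\<Oplus>\<^bsub>M\<^esub>i\<in>{..<m}. c i \<star> x i \<oplus>\<^bsub>M\<^esub> d i \<star> x i)"
    unfolding combination_def using x_mem assms
    by (intro M.finsum_cong') (auto intro!: smult_R_add M.a_closed smult_R_closed coeffsD)
  also have "\<dots> = combination m x c \<oplus>\<^bsub>M\<^esub> combination m x d"
    unfolding combination_def by (intro M.finsum_addf terms_closed assms)
  finally show ?thesis .
qed

lemma combination_smult:
  assumes "r \<in> mon_span S" "coeffs m c"
  shows "combination m x (\<lambda>i. r * c i) = r \<star> combination m x c"
proof -
  have "combination m x (\<lambda>i. r * c i) = (\<Oplus>\<^bsub>M\<^esub>i\<in>{..<m}. r \<star> (c i \<star> x i))"
    unfolding combination_def using x_mem assms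
    by (intro M.finsum_cong') (auto intro!: smult_R_assoc smult_R_closed coeffsD)
  also have "\<dots> = r \<star> combination m x c"
    unfolding combination_def using assms terms_closed by (intro finsum_smult[symmetric]) simp_all
  finally show ?thesis .
qed

lemma combination_zero: "combination m x (\<lambda>i. 0) = \<zero>\<^bsub>M\<^esub>"
  unfolding combination_def using smult_zero_left x_mem by (intro M.add.finprod_one_eqI) simp

lemma combination_unit:
  assumes "i < m" "r \<in> mon_span S"
  shows "combination m x (\<lambda>j. if j = i then r else 0) = r \<star> x i"
proof -
  have "combination m x (\<lambda>j. if j = i then r else 0) =
      (\<Oplus>\<^bsub>M\<^esub>j\<in>{..<m}. if j = i then r \<star> x i else \<zero>\<^bsub>M\<^esub>)"
    unfolding combination_def using assms x_mem smult_zero_left smult_R_closed by (intro M.finsum_cong') auto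
  also have "\<dots> = r \<star> x i"
    by (rule finsum_delta[OF M.abelian_monoid_axioms]) (use assms x_mem smult_R_closed in auto)
  finally show ?thesis .
qed

lemma combination_sum:
  assumes "finite D" "\<And>d. d \<in> D \<Longrightarrow> coeffs m (f d)"
  shows "combination m x (\<lambda>i. \<Sum>d\<in>D. f d i) = (\<Oplus>\<^bsub>M\<^esub>d\<in>D. combination m x (f d))"
  using assms
proof induction
  case (insert d D)
  then have "combination m x (\<lambda>i. \<Sum>d\<in>insert d D. f d i)
      = combination m x (f d) \<oplus>\<^bsub>M\<^esub> combination m x (\<lambda>i. \<Sum>d\<in>D. f d i)"
    by (simp add: combination_add coeffs_sum)
  also have "combination m x (\<lambda>i. \<Sum>d\<in>D. f d i) = (\<Oplus>\<^bsub>M\<^esub>d\<in>D. combination m x (f d))"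
    by (rule insert.IH) (use insert.prems in blast)
  also have "combination m x (f d) \<oplus>\<^bsub>M\<^esub> \<dots> = (\<Oplus>\<^bsub>M\<^esub>d\<in>insert d D. combination m x (f d))"
    using insert combination_closed by (intro M.finsum_insert[symmetric]) auto
  finally show ?case .
qed (simp add: combination_zero)

lemma span_combination:
  assumes "J \<subseteq> {..<m}"
  shows "span (x ` J) = {combination m x c | c. coeffs m c \<and> (\<forall>i\<in>{..<m} - J. c i = 0)}"
proof
  let ?C = "{combination m x c | c. coeffs m c \<and> (\<forall>i\<in>{..<m} - J. c i = 0)}"
  have xJ: "x ` J \<subseteq> carrier M" using x_mem assms by blast
  have "submodule R ?C M"
    unfolding submodule_def
  proof (intro conjI allI impI)
    show "Module.module R M" by (rule module_axioms)
    show "?C \<subseteq> carrier M" using combination_closed by blast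
    show "\<zero>\<^bsub>M\<^esub> \<in> ?C"
      by (intro CollectI exI[of _ "\<lambda>i. 0"]) (simp add: combination_zero coeffs_def)
    fix v w assume "v \<in> ?C" "w \<in> ?C"
    then obtain c d where "coeffs m c" "coeffs m d" "\<forall>i\<in>{..<m} - J. c i = 0" "\<forall>i\<in>{..<m} - J. d i = 0"
      "v = combination m x c" "w = combination m x d" by blast
    then show "v \<oplus>\<^bsub>M\<^esub> w \<in> ?C"
      by (intro CollectI exI[of _ "\<lambda>i. c i + d i"]) (simp add: combination_add coeffs_add)
  next
    fix r v assume "r \<in> carrier R" "v \<in> ?C"
    then obtain c where "coeffs m c" "\<forall>i\<in>{..<m} - J. c i = 0" "v = combination m x c" by blast
    then show "r \<star> v \<in> ?C" using \<open>r \<in> carrier R\<close>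
      by (intro CollectI exI[of _ "\<lambda>i. r * c i"]) (simp add: combination_smult coeffs_smult)
  qed
  moreover have "x ` J \<subseteq> ?C"
  proof
    fix z assume "z \<in> x ` J"
    then obtain i where i: "i \<in> J" "z = x i" by blast
    then have "combination m x (\<lambda>j. if j = i then 1 else 0) = z"
      using combination_unit[of i 1] assms x_mem smult_one by auto
    then show "z \<in> ?C" using i
      by (intro CollectI exI[of _ "\<lambda>j. if j = i then 1 else 0"]) (auto intro: coeffs_unit)
  qed
  ultimately show "span (x ` J) \<subseteq> ?C" by (intro span_is_subset)
  show "?C \<subseteq> span (x ` J)"
  proof
    fix z assume "z \<in> ?C"
    then obtain c where c: "coeffs m c" "\<forall>i\<in>{..<m} - J. c i = 0" "z = combination m x c" by blast
    have sub: "submodule R (span (x ` J)) M" by (rule span_is_submodule[OF xJ])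
    show "z \<in> span (x ` J)"
      unfolding c(3) combination_def
    proof (rule finsum_in_subset[OF M.abelian_monoid_axioms submodule.subset[OF sub]
          submodule.zero_closed[OF sub] submodule.m_closed[OF sub]])
      fix i assume i: "i \<in> {..<m}"
      show "c i \<star> x i \<in> span (x ` J)"
      proof (cases "i \<in> J")
        case True
        then have "x i \<in> span (x ` J)" using in_own_span[OF xJ] by blast
        then show ?thesis using coeffsD[OF c(1), of i] i by (intro submodule.smult_closed[OF sub]) auto
      next
        case False
        then show ?thesis using c(2) i x_mem[of i] smult_zero_left submodule.zero_closed[OF sub] by simp
      qed
    qed simp_all
  qed
qed

text \<open>Moving all terms to one side turns an expression of \<open>r x i\<close> by the other generators into a
  syzygy with \<open>i\<close>-th coordinate \<open>r\<close>.\<close>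

lemma colon_eq_coordinates:
  assumes i: "i < m"
  shows "colon R M (span (x ` ({..<m} - {i}))) (x i) = {c i | c. syzygy m x c}"
proof (intro equalityI subsetI)
  fix r assume "r \<in> colon R M (span (x ` ({..<m} - {i}))) (x i)"
  then have r: "r \<in> mon_span S" "r \<star> x i \<in> span (x ` ({..<m} - {i}))" unfolding colon_def by auto
  have "{..<m} - {i} \<subseteq> {..<m}" by blast
  from r(2)[unfolded span_combination[OF this]] obtain c
    where c: "r \<star> x i = combination m x c" "coeffs m c" "c i = 0" using i by auto
  let ?d = "\<lambda>j. (if j = i then r else 0) + (-1) * c j"
  have m1: "(-1 :: 'k poly) \<in> mon_span S" by (intro mon_span_uminus one_in_R)
  have "combination m x ?d = r \<star> x i \<oplus>\<^bsub>M\<^esub> (-1) \<star> (r \<star> x i)"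
    unfolding combination_add[OF coeffs_unit[OF r(1)] coeffs_smult[OF m1 c(2)]]
      combination_unit[OF i r(1)] combination_smult[OF m1 c(2)] c(1) ..
  also have "(-1) \<star> (r \<star> x i) = \<ominus>\<^bsub>M\<^esub> (r \<star> x i)"
    using smult_minus_1[OF smult_R_closed[OF r(1) x_mem[OF i]]] by simp
  also have "r \<star> x i \<oplus>\<^bsub>M\<^esub> \<ominus>\<^bsub>M\<^esub> (r \<star> x i) = \<zero>\<^bsub>M\<^esub>"
    by (rule M.r_neg[OF smult_R_closed[OF r(1) x_mem[OF i]]])
  finally have "syzygy m x ?d"
    unfolding syzygy_def using coeffs_add[OF coeffs_unit[OF r(1)] coeffs_smult[OF m1 c(2)]] by blast
  then show "r \<in> {c i | c. syzygy m x c}" using c(3) by (intro CollectI exI[of _ ?d]) simp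
next
  fix r assume "r \<in> {c i | c. syzygy m x c}"
  then obtain c where c: "coeffs m c" "combination m x c = \<zero>\<^bsub>M\<^esub>" "r = c i" unfolding syzygy_def by blast
  have r: "r \<in> mon_span S" using coeffsD[OF c(1) i] c(3) by simp
  have m1: "(-1 :: 'k poly) \<in> mon_span S" by (intro mon_span_uminus one_in_R)
  let ?d = "\<lambda>j. (if j = i then r else 0) + (-1) * c j"
  have d: "coeffs m ?d" by (rule coeffs_add[OF coeffs_unit[OF r] coeffs_smult[OF m1 c(1)]])
  have "combination m x ?d = r \<star> x i \<oplus>\<^bsub>M\<^esub> (-1) \<star> \<zero>\<^bsub>M\<^esub>"
    unfolding combination_add[OF coeffs_unit[OF r] coeffs_smult[OF m1 c(1)]]
      combination_unit[OF i r] combination_smult[OF m1 c(1)] c(2) ..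
  also have "\<dots> = r \<star> x i" using m1 smult_R_closed[OF r x_mem[OF i]] by simp
  finally have "r \<star> x i \<in> span (x ` ({..<m} - {i}))"
    using d c(3) i by (subst span_combination) (blast, intro CollectI exI[of _ ?d], auto)
  then show "r \<in> colon R M (span (x ` ({..<m} - {i}))) (x i)" unfolding colon_def using r by simp
qed

lemma colon_ideal:
  assumes i: "i < m"
  shows "ideal {c i | c. syzygy m x c} R"
proof (rule idealI)
  let ?I = "{c i | c. syzygy m x c}"
  have sub: "?I \<subseteq> mon_span S" unfolding syzygy_def using coeffsD i by blast
  have smult: "r * p \<in> ?I" if r: "r \<in> mon_span S" and "p \<in> ?I" for r p
  proof -
    obtain c where c: "coeffs m c" "combination m x c = \<zero>\<^bsub>M\<^esub>" "p = c i"
      using \<open>p \<in> ?I\<close> unfolding syzygy_def by blast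
    then have "syzygy m x (\<lambda>j. r * c j)"
      unfolding syzygy_def using r by (simp add: coeffs_smult combination_smult)
    then show ?thesis using c(3) by (intro CollectI exI[of _ "\<lambda>j. r * c j"]) simp
  qed
  show "ring R" by (rule R.ring_axioms)
  show "subgroup ?I (add_monoid R)"
  proof (rule R.add.subgroupI)
    show "?I \<subseteq> carrier R" using sub by simp
    have "syzygy m x (\<lambda>i. 0)" unfolding syzygy_def coeffs_def by (simp add: combination_zero)
    then show "?I \<noteq> {}" by blast
    fix p q assume p: "p \<in> ?I" and "q \<in> ?I"
    then obtain c d where "coeffs m c" "combination m x c = \<zero>\<^bsub>M\<^esub>" "p = c i"
      "coeffs m d" "combination m x d = \<zero>\<^bsub>M\<^esub>" "q = d i" unfolding syzygy_def by blast
    then have "syzygy m x (\<lambda>j. c j + d j)" "p \<oplus>\<^bsub>R\<^esub> q = c i + d i"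
      unfolding syzygy_def by (simp_all add: coeffs_add combination_add)
    then show "p \<oplus>\<^bsub>R\<^esub> q \<in> ?I" by (intro CollectI exI[of _ "\<lambda>j. c j + d j"]) simp
  next
    fix p assume p: "p \<in> ?I"
    then have "\<ominus>\<^bsub>R\<^esub> p = (-1) * p" using sub by (simp add: subset_iff)
    then show "\<ominus>\<^bsub>R\<^esub> p \<in> ?I" using smult[OF mon_span_uminus[OF one_in_R] p] by simp
  qed
  fix p r assume "p \<in> ?I" "r \<in> carrier R"
  then show "r \<otimes>\<^bsub>R\<^esub> p \<in> ?I" "p \<otimes>\<^bsub>R\<^esub> r \<in> ?I" using smult[of r p] by (simp_all add: mult.commute)
qed

end

end

subsection \<open>Homogeneous components\<close>

locale graded_semigroup_ring_module = semigroup_ring_module n a R M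
  for n :: nat and a :: "nat \<Rightarrow> nat" and R :: "'k::field poly ring"
    and M :: "('k poly, 'm, 'z) module_scheme" +
  fixes MM :: "int \<Rightarrow> 'm set"
  assumes graded: "graded_module R M (semigroup_ring_grading (a ` {..<n})) MM"
begin

lemma MM_subgroup: "additive_subgroup (MM d) M"
  by (rule graded_module.component_subgroup[OF graded])

lemma MM_carrier: "z \<in> MM d \<Longrightarrow> z \<in> carrier M"
  using additive_subgroup.a_subset[OF MM_subgroup[of d]] by blast

lemma MM_zero: "\<zero>\<^bsub>M\<^esub> \<in> MM d"
  by (rule additive_subgroup.zero_closed[OF MM_subgroup])

text \<open>The component of degree \<open>q\<close>, which vanishes for negative \<open>q\<close>.\<close>

definition hom_part :: "'k poly \<Rightarrow> int \<Rightarrow> 'k poly" where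
  "hom_part p q = (if q \<ge> 0 then Polynomial.monom (poly.coeff p (nat q)) (nat q) else 0)"

lemma hom_part_in_R: "p \<in> mon_span S \<Longrightarrow> hom_part p q \<in> mon_span S"
  unfolding hom_part_def
  by (cases "poly.coeff p (nat q) = 0") (auto intro: mon_span_monom mon_spanD)

lemma hom_part_grading:
  assumes "p \<in> mon_span S" shows "hom_part p q \<in> semigroup_ring_grading (a ` {..<n}) q"
  using hom_part_in_R[OF assms, of q] unfolding semigroup_ring_grading_def R_eq[symmetric]
  by (auto simp: hom_part_def split: if_splits)

lemma sum_hom_part:
  assumes "finite Q" "\<And>i. poly.coeff p i \<noteq> 0 \<Longrightarrow> int i \<in> Q"
  shows "(\<Sum>q\<in>Q. hom_part p q) = p"
proof (rule poly_eqI)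
  fix i
  have "poly.coeff (\<Sum>q\<in>Q. hom_part p q) i = (\<Sum>q\<in>Q. if q = int i then poly.coeff p i else 0)"
    unfolding coeff_sum by (rule sum.cong) (auto simp: hom_part_def)
  also have "\<dots> = poly.coeff p i" using assms by (auto simp: sum.delta)
  finally show "poly.coeff (\<Sum>q\<in>Q. hom_part p q) i = poly.coeff p i" .
qed

text \<open>Sorting the relation by degrees expresses \<open>0\<close> as a sum of homogeneous elements of distinct
  degrees, which vanish because the decomposition is unique.\<close>

lemma syzygy_hom_part:
  assumes x: "\<And>i. i < m \<Longrightarrow> x i \<in> MM (e i)" and c: "syzygy m x c"
  shows "syzygy m x (\<lambda>i. hom_part (c i) (d - e i))"
proof -
  have xM: "x \<in> {..<m} \<rightarrow> carrier M" using x MM_carrier by blast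
  have cc: "coeffs m c" and c0: "combination m x c = \<zero>\<^bsub>M\<^esub>" using c unfolding syzygy_def by blast+
  define f where "f d i = hom_part (c i) (d - e i)" for d i
  have fc: "coeffs m (f d)" for d
    unfolding f_def coeffs_def using hom_part_in_R coeffsD[OF cc] by blast
  define Z where "Z d = combination m x (f d)" for d
  have ZM: "Z d \<in> carrier M" for d unfolding Z_def by (rule combination_closed[OF xM fc])
  have Z_MM: "Z d \<in> MM d" for d
    unfolding Z_def combination_def
  proof (rule finsum_in_subset[OF M.abelian_monoid_axioms])
    show "MM d \<subseteq> carrier M" using MM_carrier by blast
    show "\<zero>\<^bsub>M\<^esub> \<in> MM d" by (rule MM_zero)
    show "z \<oplus>\<^bsub>M\<^esub> w \<in> MM d" if "z \<in> MM d" "w \<in> MM d" for z w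
      using additive_subgroup.a_closed[OF MM_subgroup that] .
    fix i assume i: "i \<in> {..<m}"
    then have "f d i \<in> semigroup_ring_grading (a ` {..<n}) (d - e i)"
      unfolding f_def using hom_part_grading coeffsD[OF cc] by simp
    then have "f d i \<star> x i \<in> MM ((d - e i) + e i)"
      using graded_module.smult_component[OF graded _ x] i by blast
    then show "f d i \<star> x i \<in> MM d" by simp
  qed simp
  define D where "D = (\<Union>i<m. (\<lambda>j. int j + e i) ` {..degree (c i)})"
  have finD: "finite D" unfolding D_def by simp
  have outside: "Z d = \<zero>\<^bsub>M\<^esub>" if "d \<notin> D" for d
  proof -
    have "f d i = 0" if i: "i < m" for i
    proof (rule ccontr)
      assume "f d i \<noteq> 0"
      then have nz: "d - e i \<ge> 0" "poly.coeff (c i) (nat (d - e i)) \<noteq> 0"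
        unfolding f_def hom_part_def by (auto split: if_splits)
      then have "nat (d - e i) \<le> degree (c i)" by (intro le_degree)
      moreover have "d = int (nat (d - e i)) + e i" using nz(1) by simp
      ultimately have "d \<in> D" unfolding D_def using i by blast
      with \<open>d \<notin> D\<close> show False by blast
    qed
    then have "combination m x (f d) = combination m x (\<lambda>i. 0)"
      by (intro combination_cong[OF xM]) (simp_all add: coeffs_def)
    then show ?thesis unfolding Z_def combination_zero[OF xM] .
  qed
  have "(\<Oplus>\<^bsub>M\<^esub>d\<in>D. Z d) = combination m x (\<lambda>i. \<Sum>d\<in>D. f d i)"
    unfolding Z_def by (rule combination_sum[OF xM finD fc, symmetric])
  also have "\<dots> = combination m x c"
  proof (rule combination_cong[OF xM cc])
    fix i assume i: "i < m"
    have "(\<Sum>d\<in>D. f d i) = (\<Sum>q\<in>(\<lambda>d. d - e i) ` D. hom_part (c i) q)"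
      unfolding f_def by (subst sum.reindex) (auto simp: inj_on_def)
    also have "\<dots> = c i"
    proof (rule sum_hom_part)
      fix j assume "poly.coeff (c i) j \<noteq> 0"
      then have "int j + e i \<in> D" unfolding D_def using i le_degree by blast
      then show "int j \<in> (\<lambda>d. d - e i) ` D" by (rule rev_image_eqI) simp
    qed (simp add: finD)
    finally show "(\<Sum>d\<in>D. f d i) = c i" .
  qed
  finally have sum0: "(\<Oplus>\<^bsub>M\<^esub>d\<in>D. Z d) = \<zero>\<^bsub>M\<^esub>" using c0 by simp
  have supp: "{d. Z d \<noteq> \<zero>\<^bsub>M\<^esub>} \<subseteq> D" using outside by blast
  have "(\<Oplus>\<^bsub>M\<^esub>d\<in>{d. Z d \<noteq> \<zero>\<^bsub>M\<^esub>}. Z d) = (\<Oplus>\<^bsub>M\<^esub>d\<in>D. Z d)"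
    by (rule M.add.finprod_mono_neutral_cong_left[OF finD supp]) (use ZM in auto)
  note sumZ = this
  define Q where "Q f \<longleftrightarrow> (\<forall>d. f d \<in> MM d) \<and> finite {d. f d \<noteq> \<zero>\<^bsub>M\<^esub>} \<and>
      (\<Oplus>\<^bsub>M\<^esub>d\<in>{d. f d \<noteq> \<zero>\<^bsub>M\<^esub>}. f d) = \<zero>\<^bsub>M\<^esub>" for f
  have "Q Z" unfolding Q_def using Z_MM finite_subset[OF supp finD] sumZ sum0 by simp
  moreover have "Q (\<lambda>_. \<zero>\<^bsub>M\<^esub>)" unfolding Q_def using MM_zero by simp
  moreover have "\<exists>!f. Q f" unfolding Q_def by (rule graded_module.decomposition[OF graded M.zero_closed])
  ultimately have "Z = (\<lambda>_. \<zero>\<^bsub>M\<^esub>)" by metis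
  then have "Z d = \<zero>\<^bsub>M\<^esub>" by simp
  then show ?thesis using fc[of d] unfolding Z_def syzygy_def f_def by blast
qed

end

section \<open>Ulrich modules\<close>

locale graded_Ulrich_module = graded_semigroup_ring_module n a R M MM
  for n :: nat and a :: "nat \<Rightarrow> nat" and R :: "'k::field poly ring"
    and M :: "('k poly, 'm, 'z) module_scheme" and MM :: "int \<Rightarrow> 'm set" +
  assumes Ulrich: "Ulrich_module (\<lambda>c. [:c:]) R (irrelevant_ideal (a ` {..<n})) M"
begin

lemma MCM: "maximal_Cohen_Macaulay R (irrelevant_ideal (a ` {..<n})) M"
  using Ulrich unfolding Ulrich_module_def by blast

lemmas tau_regular = maximal_Cohen_Macaulay_facts(2)[OF MCM]

lemma max_ideal_smult: "r \<in> max_ideal \<Longrightarrow> x \<in> carrier M \<Longrightarrow> \<exists>z\<in>carrier M. r \<star> x = \<tau> \<star> z"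
  using ideal_smult_mem[OF max_ideal_sub, of r x] unfolding Ulrich_max_ideal_smult[OF Ulrich] by blast

text \<open>For minimal homogeneous generators the union is an ideal, since the coordinate ideals of the
  single positions form a chain.\<close>

definition coord_ideal :: "nat \<Rightarrow> (nat \<Rightarrow> 'm) \<Rightarrow> 'k poly set" where
  "coord_ideal m x = (\<Union>i<m. {c i | c. syzygy m x c})"

lemma coord_idealI: "syzygy m x c \<Longrightarrow> i < m \<Longrightarrow> c i \<in> coord_ideal m x"
  unfolding coord_ideal_def using coordinateI by blast

lemma coord_idealE:
  assumes "r \<in> coord_ideal m x"
  obtains i c where "i < m" "syzygy m x c" "r = c i"
  using assms unfolding coord_ideal_def by blast

context
  fixes m :: nat and x :: "nat \<Rightarrow> 'm"
  assumes gens: "minimal_homogeneous_generators R M MM m x"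
begin

lemma gens_degrees: obtains e where "\<And>i. i < m \<Longrightarrow> x i \<in> MM (e i)"
proof -
  have "\<forall>i. \<exists>d. i < m \<longrightarrow> x i \<in> MM d"
    using gens unfolding minimal_homogeneous_generators_def by blast
  then show ?thesis using that by metis
qed

lemma gens_mem: "i < m \<Longrightarrow> x i \<in> carrier M"
  using gens_degrees MM_carrier by metis

lemma gens_carrier: "x \<in> {..<m} \<rightarrow> carrier M"
  using gens_mem by blast

lemma gens_span: "span (x ` {..<m}) = carrier M"
  using gens unfolding minimal_homogeneous_generators_def by blast

lemma gens_minimal: "i < m \<Longrightarrow> x i \<notin> span (x ` ({..<m} - {i}))"
proof
  assume i: "i < m" and mem: "x i \<in> span (x ` ({..<m} - {i}))"
  have sub: "x ` ({..<m} - {i}) \<subseteq> carrier M" using gens_mem by blast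
  have "x ` {..<m} \<subseteq> span (x ` ({..<m} - {i}))"
  proof
    fix z assume "z \<in> x ` {..<m}"
    then show "z \<in> span (x ` ({..<m} - {i}))" using mem in_own_span[OF sub] by blast
  qed
  then have "carrier M \<subseteq> span (x ` ({..<m} - {i}))"
    unfolding gens_span[symmetric] by (rule span_is_subset[OF _ span_is_submodule[OF sub]])
  then have "span (x ` ({..<m} - {i})) = carrier M" using span_is_subset2[OF sub] by blast
  moreover have "{..<m} - {i} \<subset> {..<m}" using i by blast
  ultimately show False using gens unfolding minimal_homogeneous_generators_def by blast
qed

lemma gens_nonempty: "m > 0"
proof (rule ccontr)
  assume "\<not> m > 0"
  then have "carrier M = span {}" using gens_span by simp
  also have "span {} \<subseteq> {\<zero>\<^bsub>M\<^esub>}" by (rule span_is_subset[OF _ submodule_zero]) blast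
  finally show False using maximal_Cohen_Macaulay_facts(3)[OF MCM] M.zero_closed by blast
qed

lemma gens_combination:
  assumes "z \<in> carrier M" shows "\<exists>c. coeffs m c \<and> combination m x c = z"
proof -
  have "z \<in> span (x ` {..<m})" using assms gens_span by simp
  then show ?thesis unfolding span_combination[OF gens_carrier order_refl] by blast
qed

text \<open>A coordinate with a nonzero constant term has, as a homogeneous component, a nonzero
  constant, which would make \<open>x i\<close> redundant.\<close>

lemma syzygy_coordinate:
  assumes c: "syzygy m x c" and i: "i < m"
  shows "c i \<in> max_ideal"
proof (rule ccontr)
  assume not: "c i \<notin> max_ideal"
  have ci: "c i \<in> mon_span S" using c i coeffsD unfolding syzygy_def by blast
  define b where "b = poly.coeff (c i) 0"
  have b: "b \<noteq> 0" using not max_ideal_coeff[OF ci] unfolding b_def by simp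
  obtain e where e: "\<And>i. i < m \<Longrightarrow> x i \<in> MM (e i)" using gens_degrees by blast
  have "syzygy m x (\<lambda>j. hom_part (c j) (e i - e j))" 
    by (rule syzygy_hom_part[where e = e, OF _ c]) (rule e)
  from coordinateI[OF this, of i] have "hom_part (c i) (e i - e i) \<in> {c i | c. syzygy m x c}" .
  then have "[:b:] \<in> {c i | c. syzygy m x c}" by (simp add: hom_part_def b_def monom_0)
  from ideal_facts(5)[OF colon_ideal[OF gens_carrier i] this, of "[:inverse b:]"]
  have "[:inverse b:] * [:b:] \<in> {c i | c. syzygy m x c}" by simp
  then have "1 \<in> colon R M (span (x ` ({..<m} - {i}))) (x i)"
    unfolding colon_eq_coordinates[OF gens_carrier i] using b by (simp add: one_pCons)
  then show False using gens_minimal[OF i] smult_one[OF gens_mem[OF i]] unfolding colon_def by simp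
qed

text \<open>Since \<open>\<mm> M = \<tau> M\<close>, one can write \<open>t\<^bsup>a j\<^esup> x i = \<tau> (b\<^sub>1 x\<^sub>1 + \<dots>)\<close>. In degree \<open>a j\<close> the coefficient
  \<open>\<tau> b\<^sub>i\<close> of \<open>x i\<close> has no term, because \<open>a j - a 0\<close> is not in the semigroup. So the corresponding
  component of this relation is a syzygy with \<open>i\<close>-th coordinate \<open>t\<^bsup>a j\<^esup>\<close>.\<close>

lemma generator_is_coordinate:
  assumes i: "i < m" and j: "1 \<le> j" "j < n"
  shows "tpow (a j) \<in> {c i | c. syzygy m x c}"
proof -
  let ?t = "(tpow (a j) :: 'k poly)"
  have t: "?t \<in> max_ideal" using a_in_S[OF j(2)] a_pos[OF j(2)] by simp
  then have tS: "?t \<in> mon_span S" using max_ideal_sub by blast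
  obtain z where z: "z \<in> carrier M" "?t \<star> x i = \<tau> \<star> z"
    using max_ideal_smult[OF t gens_mem[OF i]] by blast
  obtain b where b: "coeffs m b" "combination m x b = z" using gens_combination[OF z(1)] by blast
  have mt: "- \<tau> \<in> mon_span S" by (rule mon_span_uminus) simp
  let ?c = "\<lambda>l. (if l = i then ?t else 0) + (- \<tau>) * b l"
  have cc: "coeffs m ?c" by (rule coeffs_add[OF coeffs_unit[OF tS] coeffs_smult[OF mt b(1)]])
  have "combination m x ?c = ?t \<star> x i \<oplus>\<^bsub>M\<^esub> (- \<tau>) \<star> z"
    unfolding combination_add[OF gens_carrier coeffs_unit[OF tS] coeffs_smult[OF mt b(1)]]
      combination_unit[OF gens_carrier i tS] combination_smult[OF gens_carrier mt b(1)] b(2) ..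
  also have "\<dots> = (\<tau> + (- \<tau>)) \<star> z" unfolding z(2) using smult_R_add[OF tau_in_R mt z(1)] by simp
  also have "\<dots> = \<zero>\<^bsub>M\<^esub>" using smult_zero_left[OF z(1)] by simp
  finally have syz: "syzygy m x ?c" unfolding syzygy_def using cc by blast
  obtain e where e: "\<And>i. i < m \<Longrightarrow> x i \<in> MM (e i)" using gens_degrees by blast
  have "syzygy m x (\<lambda>l. hom_part (?c l) (int (a j) + e i - e l))" 
    by (rule syzygy_hom_part[where e = e, OF _ syz]) (rule e)
  from coordinateI[OF this, of i]
  have "hom_part (?c i) (int (a j) + e i - e i) \<in> {c i | c. syzygy m x c}" .
  moreover have "poly.coeff (?c i) (a j) = 1"
  proof -
    have "a 0 < a j" using a_strict_mono[of 0 j] j by simp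
    have "a j - a 0 \<notin> S" using generator_not_shifted[of j "a j - a 0"] j \<open>a 0 < a j\<close> by auto
    then have "poly.coeff (b i) (a j - a 0) = 0" using mon_span_coeff[OF coeffsD[OF b(1) i]] by blast
    then show ?thesis by (simp add: coeff_monom_mult)
  qed
  ultimately show ?thesis by (simp add: hom_part_def)
qed

lemma coordinates_power_ideal:
  assumes i: "i < m"
  shows "\<exists>d. {c i | c. syzygy m x c} = power_ideal n a d"
  using ideal_eq_power_ideal[OF colon_ideal[OF gens_carrier i] generator_is_coordinate[OF i]] by blast

lemma coord_ideal_eq:
  assumes "\<And>i. i < m \<Longrightarrow> {c i | c. syzygy m x c} = power_ideal n a (d i)"
  shows "coord_ideal m x = power_ideal n a (Min (d ` {..<m}))"
proof -
  let ?p = "Min (d ` {..<m})"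
  have "?p \<in> d ` {..<m}" using gens_nonempty by (intro Min_in) auto
  then obtain i where i: "i < m" "d i = ?p" by auto
  have "coord_ideal m x = (\<Union>i<m. power_ideal n a (d i))" unfolding coord_ideal_def using assms by simp
  also have "\<dots> = power_ideal n a ?p"
  proof
    show "(\<Union>i<m. power_ideal n a (d i)) \<subseteq> (power_ideal n a ?p :: 'k poly set)"
      by (intro UN_least power_ideal_antimono Min_le) auto
    have "power_ideal n a (d i) \<subseteq> (\<Union>i<m. power_ideal n a (d i) :: 'k poly set)"
      by (rule UN_upper) (use i in simp)
    then show "(power_ideal n a ?p :: 'k poly set) \<subseteq> (\<Union>i<m. power_ideal n a (d i))" unfolding i(2) .
  qed
  finally show ?thesis .
qed

lemma coord_ideal_power_ideal: "\<exists>p. coord_ideal m x = power_ideal n a p"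
proof -
  have "\<forall>i. \<exists>d. i < m \<longrightarrow> {c i | c. syzygy m x c} = power_ideal n a d"
    using coordinates_power_ideal by blast
  from choice[OF this] obtain d where "\<forall>i. i < m \<longrightarrow> {c i | c. syzygy m x c} = power_ideal n a (d i)" ..
  then have "coord_ideal m x = power_ideal n a (Min (d ` {..<m}))" by (intro coord_ideal_eq) simp
  then show ?thesis ..
qed

lemma coord_ideal_max_ideal: "coord_ideal m x \<subseteq> max_ideal"
  unfolding coord_ideal_def using syzygy_coordinate by blast

end

text \<open>Used in both directions, this shows that the coordinate ideal, written \<open>C x\<close> here, does not
  depend on the chosen generators. Writing \<open>x = V y\<close> and
  \<open>y = U x\<close>, a syzygy \<open>c\<close> of \<open>x\<close> decomposes as \<open>c = c (1 - V U) + (c V) U\<close>. The rows of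
  \<open>1 - V U\<close> are syzygies of \<open>x\<close> and have entries in \<open>\<mm>\<close>, and \<open>c V\<close> is a syzygy of \<open>y\<close>; so
  \<open>C x \<subseteq> \<mm> (C x) + C y\<close>. Comparing the least power of \<open>\<tau>\<close> on both sides replaces Nakayama's
  lemma.\<close>

lemma coord_ideal_le:
  assumes gx: "minimal_homogeneous_generators R M MM m x"
    and gy: "minimal_homogeneous_generators R M MM m' y"
  shows "coord_ideal m x \<subseteq> coord_ideal m' y"
proof -
  note xM = gens_carrier[OF gx] and yM = gens_carrier[OF gy]
    and x_mem = gens_mem[OF gx] and y_mem = gens_mem[OF gy]
  obtain p where p: "coord_ideal m x = mon_span (pow_exps p)"
    using coord_ideal_power_ideal[OF gx] unfolding power_ideal_eq by blast
  obtain q where q: "coord_ideal m' y = mon_span (pow_exps q)"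
    using coord_ideal_power_ideal[OF gy] unfolding power_ideal_eq by blast
  have "\<forall>l. \<exists>v. l < m \<longrightarrow> coeffs m' v \<and> combination m' y v = x l"
    using gens_combination[OF gy] x_mem by blast
  then obtain V where V: "\<And>l. l < m \<Longrightarrow> coeffs m' (V l)" "\<And>l. l < m \<Longrightarrow> combination m' y (V l) = x l"
    by metis
  have "\<forall>k. \<exists>u. k < m' \<longrightarrow> coeffs m u \<and> combination m x u = y k"
    using gens_combination[OF gx] y_mem by blast
  then obtain U where U: "\<And>k. k < m' \<Longrightarrow> coeffs m (U k)" "\<And>k. k < m' \<Longrightarrow> combination m x (U k) = y k"
    by metis
  have "tpow (p * a 0) \<in> coord_ideal m x"
    unfolding p by (rule mon_span_monom[OF pow_exps_mult])
  then obtain i c where i: "i < m" and c: "syzygy m x c" and ci: "c i = tpow (p * a 0)"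
    by (rule coord_idealE) simp
  have cc: "coeffs m c" and c0: "combination m x c = \<zero>\<^bsub>M\<^esub>" using c unfolding syzygy_def by blast+
  define cV where "cV k = (\<Sum>l<m. c l * V l k)" for k
  have cVc: "coeffs m' (\<lambda>k. c l * V l k)" if "l \<in> {..<m}" for l
    using that V(1) coeffsD[OF cc] by (intro coeffs_smult) auto
  have "combination m' y cV = (\<Oplus>\<^bsub>M\<^esub>l\<in>{..<m}. combination m' y (\<lambda>k. c l * V l k))"
    unfolding cV_def by (rule combination_sum[OF yM _ cVc]) simp_all
  also have "\<dots> = combination m x c"
    unfolding combination_def[of m x]
  proof (rule M.finsum_cong')
    fix l assume "l \<in> {..<m}"
    then show "combination m' y (\<lambda>k. c l * V l k) = c l \<star> x l"
      using combination_smult[OF yM coeffsD[OF cc] V(1)] V(2) by simp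
  qed (use terms_closed[OF xM cc] in simp_all)
  finally have cV: "syzygy m' y cV"
    unfolding syzygy_def using coeffs_sum[of "{..<m}", OF cVc] c0 unfolding cV_def by simp
  define W where "W l j = (if j = l then 1 else 0) + (-1) * (\<Sum>k<m'. V l k * U k j)" for l j
  have W: "syzygy m x (W l)" if l: "l < m" for l
  proof -
    have VU: "coeffs m (\<lambda>j. V l k * U k j)" if "k \<in> {..<m'}" for k
      using that U(1) coeffsD[OF V(1)[OF l]] by (intro coeffs_smult) auto
    have m1: "(-1 :: 'k poly) \<in> mon_span S" by (intro mon_span_uminus one_in_R)
    have VUs: "coeffs m (\<lambda>j. \<Sum>k<m'. V l k * U k j)" by (rule coeffs_sum[OF VU])
    have "combination m x (\<lambda>j. \<Sum>k<m'. V l k * U k j) = (\<Oplus>\<^bsub>M\<^esub>k\<in>{..<m'}. combination m x (\<lambda>j. V l k * U k j))"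
      by (rule combination_sum[OF xM _ VU]) simp_all
    also have "\<dots> = combination m' y (V l)"
      unfolding combination_def[of m' y]
    proof (rule M.finsum_cong')
      fix k assume "k \<in> {..<m'}"
      then show "combination m x (\<lambda>j. V l k * U k j) = V l k \<star> y k"
        using combination_smult[OF xM coeffsD[OF V(1)[OF l]] U(1)] U(2) by simp
    qed (use terms_closed[OF yM V(1)[OF l]] in simp_all)
    also have "\<dots> = x l" by (rule V(2)[OF l])
    finally have VUx: "combination m x (\<lambda>j. \<Sum>k<m'. V l k * U k j) = x l" .
    have "combination m x (W l) = 1 \<star> x l \<oplus>\<^bsub>M\<^esub> (-1) \<star> x l"
      unfolding W_def combination_add[OF xM coeffs_unit[OF one_in_R] coeffs_smult[OF m1 VUs]]
        combination_unit[OF xM l one_in_R] combination_smult[OF xM m1 VUs] VUx ..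
    also have "\<dots> = (1 + (-1)) \<star> x l" by (rule smult_R_add[OF one_in_R m1 x_mem[OF l], symmetric])
    also have "\<dots> = \<zero>\<^bsub>M\<^esub>" using smult_zero_left[OF x_mem[OF l]] by simp
    finally show ?thesis
      unfolding syzygy_def W_def using coeffs_add[OF coeffs_unit[OF one_in_R] coeffs_smult[OF m1 VUs]] by blast
  qed
  define E where "E = {u + s | u s. u \<in> pow_exps p \<and> s \<in> S - {0}}"
  have "(\<Sum>l<m. c l * W l i) = (\<Sum>l<m. (if i = l then c l else 0)) - (\<Sum>l<m. \<Sum>k<m'. c l * V l k * U k i)"
    unfolding sum_subtractf[symmetric]
  proof (rule sum.cong)
    fix l
    have "c l * (\<Sum>k<m'. V l k * U k i) = (\<Sum>k<m'. c l * V l k * U k i)"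
      by (simp add: sum_distrib_left mult.assoc)
    then show "c l * W l i = (if i = l then c l else 0) - (\<Sum>k<m'. c l * V l k * U k i)"
      unfolding W_def by (auto simp: right_diff_distrib)
  qed simp
  also have "(\<Sum>l<m. (if i = l then c l else 0)) = c i" using i by simp
  also have "(\<Sum>l<m. \<Sum>k<m'. c l * V l k * U k i) = (\<Sum>k<m'. cV k * U k i)"
    unfolding cV_def sum_distrib_right by (rule sum.swap)
  finally have "c i = (\<Sum>l<m. c l * W l i) + (\<Sum>k<m'. cV k * U k i)" by simp
  moreover have "(\<Sum>l<m. c l * W l i) \<in> mon_span (E \<union> pow_exps q)"
  proof (rule mon_span_sum)
    fix l assume l: "l \<in> {..<m}"
    then have "c l \<in> mon_span (pow_exps p)" unfolding p[symmetric] using coord_idealI[OF c] by simp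
    moreover have "W l i \<in> max_ideal" using syzygy_coordinate[OF gx W i] l by simp
    ultimately show "c l * W l i \<in> mon_span (E \<union> pow_exps q)"
      by (rule mon_span_mult) (unfold E_def, blast)
  qed
  moreover have "(\<Sum>k<m'. cV k * U k i) \<in> mon_span (E \<union> pow_exps q)"
  proof (rule mon_span_sum)
    fix k assume k: "k \<in> {..<m'}"
    then have "cV k \<in> mon_span (pow_exps q)" unfolding q[symmetric] using coord_idealI[OF cV] by simp
    moreover have "U k i \<in> mon_span S" using coeffsD[OF U(1) i] k by simp
    ultimately show "cV k * U k i \<in> mon_span (E \<union> pow_exps q)"
      by (rule mon_span_mult) (use pow_exps_add in blast)
  qed
  ultimately have "c i \<in> mon_span (E \<union> pow_exps q)" by (simp add: mon_span_add)
  then have "p * a 0 \<in> E \<union> pow_exps q" unfolding ci by simp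
  then have pq: "p * a 0 \<in> pow_exps q"
  proof
    assume "p * a 0 \<in> E"
    then obtain g s s' where g: "g \<in> insert (p * a 0) (a ` {1..<n})" "s' \<in> S" "s \<in> S" "s \<noteq> 0"
      "p * a 0 = g + s' + s" unfolding E_def pow_exps_def by blast
    then have "g \<in> a ` {1..<n}" by auto
    then show ?thesis
      using pow_exps_generator[of _ q] g by (auto intro!: pow_exps_add)
  qed
  have "pow_exps p \<subseteq> pow_exps q"
  proof
    fix u assume "u \<in> pow_exps p"
    then obtain g s where "g \<in> insert (p * a 0) (a ` {1..<n})" "s \<in> S" "u = g + s"
      unfolding pow_exps_def by blast
    then show "u \<in> pow_exps q" using pq pow_exps_generator[of _ q] by (auto intro!: pow_exps_add)
  qed
  then show ?thesis unfolding p q by (rule mon_span_mono)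
qed

section \<open>The syzygy module\<close>

lemma syzygy_module_carrier:
  "c \<in> carrier (syzygy_module R M m x) \<longleftrightarrow> c \<in> extensional {..<m} \<and> syzygy m x c"
  unfolding syzygy_module_def syzygy_def coeffs_def combination_def PiE_def Pi_def by auto

lemma syzygy_module_ops:
  "add (syzygy_module R M m x) f g = restrict (\<lambda>i. f i + g i) {..<m}"
  "smult (syzygy_module R M m x) r f = restrict (\<lambda>i. r * f i) {..<m}"
  "zero (syzygy_module R M m x) = restrict (\<lambda>i. 0) {..<m}"
  unfolding syzygy_module_def by (simp_all add: R.func_space_def)

context
  fixes m :: nat and x :: "nat \<Rightarrow> 'm"
  assumes x: "x \<in> {..<m} \<rightarrow> carrier M"
begin

abbreviation Syz :: "('k poly, nat \<Rightarrow> 'k poly) module" where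
  "Syz \<equiv> syzygy_module R M m x"

lemma syzygy_restrict:
  assumes "syzygy m x c" shows "restrict c {..<m} \<in> carrier Syz"
proof -
  have c: "coeffs m c" using assms unfolding syzygy_def by blast
  then have "coeffs m (restrict c {..<m})" unfolding coeffs_def by simp
  moreover have "combination m x (restrict c {..<m}) = combination m x c"
    by (rule combination_cong[OF x c]) simp
  ultimately show ?thesis using assms unfolding syzygy_module_carrier syzygy_def by simp
qed

lemma syzygy_add: "syzygy m x c \<Longrightarrow> syzygy m x d \<Longrightarrow> syzygy m x (\<lambda>i. c i + d i)"
  unfolding syzygy_def using combination_add[OF x] coeffs_add by simp

lemma syzygy_smult: "r \<in> mon_span S \<Longrightarrow> syzygy m x c \<Longrightarrow> syzygy m x (\<lambda>i. r * c i)"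
  unfolding syzygy_def using combination_smult[OF x] coeffs_smult by simp

lemma syzygy_module_module: "Module.module R Syz"
proof -
  let ?F = "R.func_space {..<m} :: ('k poly, nat \<Rightarrow> 'k poly) module"
  interpret F: Module.module R ?F by (rule R.func_space_is_module)
  have Syz: "Syz = ?F\<lparr>carrier := carrier Syz\<rparr>" unfolding syzygy_module_def by simp
  have "submodule R (carrier Syz) ?F"
    unfolding submodule_def
  proof (intro conjI allI impI)
    show "Module.module R ?F" by (rule F.module_axioms)
    show "carrier Syz \<subseteq> carrier ?F" unfolding syzygy_module_def R.func_space_def by auto
    have "syzygy m x (\<lambda>i. 0)" unfolding syzygy_def coeffs_def using combination_zero[OF x] by simp
    then show "\<zero>\<^bsub>?F\<^esub> \<in> carrier Syz" using syzygy_restrict by (simp add: R.func_space_def)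
    show "v \<oplus>\<^bsub>?F\<^esub> w \<in> carrier Syz" if "v \<in> carrier Syz" "w \<in> carrier Syz" for v w
      using that syzygy_restrict[OF syzygy_add, of v w] by (simp add: R.func_space_def syzygy_module_carrier)
    show "r \<odot>\<^bsub>?F\<^esub> v \<in> carrier Syz" if "r \<in> carrier R" "v \<in> carrier Syz" for r v
      using that syzygy_restrict[OF syzygy_smult, of r v] by (simp add: R.func_space_def syzygy_module_carrier)
  qed
  then show ?thesis using F.submodule_is_module Syz by metis
qed

lemma coordinate_hom:
  assumes "i < m" shows "(\<lambda>c. c i) \<in> module_hom R Syz (ring_as_module R)"
  unfolding module_hom_def using assms
  by (auto simp: syzygy_module_ops syzygy_module_carrier syzygy_def coeffs_def)

text \<open>The socle monomial \<open>t\<^sup>w\<close> maps syzygies, whose coordinates lie in \<open>\<mm>\<close>, into \<open>\<tau> R\<^sup>m\<close>, and hence into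
  \<open>\<tau>\<close> times syzygies. So \<open>t\<^sup>w f z\<close> is a multiple of \<open>\<tau>\<close> for every functional \<open>f\<close>, which is
  impossible if \<open>f z\<close> has a constant term. In particular the syzygies have no free summand.\<close>

lemma syzygy_functional_max_ideal:
  assumes coords: "coord_ideal m x \<subseteq> max_ideal"
    and f: "f \<in> module_hom R Syz (ring_as_module R)" and z: "z \<in> carrier Syz"
  shows "f z \<in> max_ideal"
proof -
  obtain w where w: "w \<in> S" "\<And>x. x \<in> S \<Longrightarrow> w \<noteq> a 0 + x"
    "\<And>s. s \<in> S \<Longrightarrow> s \<noteq> 0 \<Longrightarrow> \<exists>x\<in>S. w + s = a 0 + x" using socle_exponent by blast
  let ?\<sigma> = "(tpow w :: 'k poly)"
  have \<sigma>: "?\<sigma> \<in> mon_span S" using w(1) by simp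
  have zs: "syzygy m x z" using z unfolding syzygy_module_carrier by blast
  have "\<exists>q. q \<in> mon_span S \<and> ?\<sigma> * z i = \<tau> * q" if i: "i < m" for i
  proof -
    have "?\<sigma> * z i \<in> mon_span {w + s | s. s \<in> S - {0}}"
      by (rule mon_span_mult[of _ "{w}", OF _ subsetD[OF coords coord_idealI[OF zs i]]]) auto
    then show ?thesis
    proof (rule mon_span_shift[where e = "a 0" and F = S])
      fix u assume "u \<in> {w + s | s. s \<in> S - {0}}"
      then obtain s where "s \<in> S" "s \<noteq> 0" "u = w + s" by blast
      then obtain r where "r \<in> S" "u = a 0 + r" using w(3) by metis
      then show "a 0 \<le> u \<and> u - a 0 \<in> S" by simp
    qed blast
  qed
  then obtain y where y: "\<And>i. i < m \<Longrightarrow> y i \<in> mon_span S" "\<And>i. i < m \<Longrightarrow> ?\<sigma> * z i = \<tau> * y i"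
    by metis
  have yc: "coeffs m y" unfolding coeffs_def using y(1) by blast
  have "\<tau> \<star> combination m x y = combination m x (\<lambda>i. \<tau> * y i)"
    by (rule combination_smult[OF x tau_in_R yc, symmetric])
  also have "\<dots> = combination m x (\<lambda>i. ?\<sigma> * z i)"
    by (rule combination_cong[OF x]) (use coeffs_smult[OF \<sigma>] zs y(2) in \<open>auto simp: syzygy_def\<close>)
  also have "\<dots> = \<zero>\<^bsub>M\<^esub>" using syzygy_smult[OF \<sigma> zs] unfolding syzygy_def by blast
  finally have "combination m x y = \<zero>\<^bsub>M\<^esub>" using tau_regular combination_closed[OF x yc] by blast
  then have "syzygy m x y" unfolding syzygy_def using yc by blast
  then have yS: "restrict y {..<m} \<in> carrier Syz" by (rule syzygy_restrict)
  have "?\<sigma> \<odot>\<^bsub>Syz\<^esub> z = \<tau> \<odot>\<^bsub>Syz\<^esub> restrict y {..<m}"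
    unfolding syzygy_module_ops by (rule restrict_ext) (simp add: y(2))
  then have "f (?\<sigma> \<odot>\<^bsub>Syz\<^esub> z) = f (\<tau> \<odot>\<^bsub>Syz\<^esub> restrict y {..<m})" by simp
  then have eq: "?\<sigma> * f z = \<tau> * f (restrict y {..<m})"
    using module_hom_smult[OF f, of ?\<sigma> z] module_hom_smult[OF f, of \<tau> "restrict y {..<m}"] z yS \<sigma> by simp
  have fz: "f z \<in> mon_span S" and fy: "f (restrict y {..<m}) \<in> mon_span S"
    using module_hom_closed[OF f] z yS by auto
  \<comment> \<open>In degree \<open>w\<close> the left-hand side has the constant term of \<open>f z\<close>, and the right-hand side
    has no term, since \<open>w\<close> is not in \<open>a 0 + S\<close>.\<close>
  have "poly.coeff (\<tau> * f (restrict y {..<m})) w = 0"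
  proof (rule ccontr)
    assume "poly.coeff (\<tau> * f (restrict y {..<m})) w \<noteq> 0"
    then have "a 0 \<le> w" "poly.coeff (f (restrict y {..<m})) (w - a 0) \<noteq> 0"
      by (auto simp: coeff_monom_mult split: if_splits)
    then have "w - a 0 \<in> S" "w = a 0 + (w - a 0)" using mon_spanD[OF fy] by auto
    then show False using w(2) by blast
  qed
  then have "poly.coeff (f z) 0 = 0" unfolding eq[symmetric] by (simp add: coeff_monom_mult)
  then show ?thesis using max_ideal_coeff[OF fz] by simp
qed

end

text \<open>The columns of the matrix generate the syzygies, so each coordinate of a syzygy is a
  combination of matrix entries.\<close>

lemma entry_ideal_coord_ideal:
  assumes "minimal_presentation_matrix R (semigroup_ring_grading (a ` {..<n})) M MM A"
  obtains y where "minimal_homogeneous_generators R M MM (dim_row A) y"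
    "entry_ideal R A = coord_ideal (dim_row A) y"
proof -
  let ?m = "dim_row A" and ?col = "\<lambda>j. \<lambda>i\<in>{..<dim_row A}. A $$ (i, j)"
  obtain y e where gy: "minimal_homogeneous_generators R M MM ?m y"
    and gS: "minimal_homogeneous_generators R (syzygy_module R M ?m y)
      (syzygy_grading R (semigroup_ring_grading (a ` {..<n})) M ?m y e) (dim_col A) ?col"
    using assms unfolding minimal_presentation_matrix_def by blast
  note yM = gens_carrier[OF gy]
  let ?Z = "syzygy_module R M ?m y"
  interpret Z: Module.module R ?Z by (rule syzygy_module_module[OF yM])
  have col: "?col j \<in> carrier ?Z" if "j < dim_col A" for j
    using gS that unfolding minimal_homogeneous_generators_def syzygy_grading_def by blast
  have Zspan: "Z.span (?col ` {..<dim_col A}) = carrier ?Z"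
    using gS unfolding minimal_homogeneous_generators_def by blast
  have entry: "A $$ (i, j) \<in> coord_ideal ?m y" if "i < ?m" "j < dim_col A" for i j
  proof -
    have "syzygy ?m y (?col j)" using col[OF that(2)] unfolding syzygy_module_carrier by blast
    then have "?col j i \<in> coord_ideal ?m y" using that(1) by (rule coord_idealI)
    then show ?thesis using that(1) by simp
  qed
  obtain p where p: "coord_ideal ?m y = power_ideal n a p" using coord_ideal_power_ideal[OF gy] by blast
  have ideal: "ideal (coord_ideal ?m y) R" unfolding p by (rule power_ideal_ideal)
  have sub: "elements_mat A \<subseteq> coord_ideal ?m y"
  proof
    fix r assume "r \<in> elements_mat A"
    then show "r \<in> coord_ideal ?m y" using entry elements_matD by blast
  qed
  then have sub': "elements_mat A \<subseteq> carrier R" using ideal_facts(1)[OF ideal] by auto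
  let ?I = "Idl\<^bsub>R\<^esub> (elements_mat A)"
  note If = ideal_facts[OF R.genideal_ideal[OF sub']]
  have "submodule R {c \<in> carrier ?Z. \<forall>i<?m. c i \<in> ?I} ?Z"
    unfolding submodule_def
  proof (intro conjI allI impI)
    show "Module.module R ?Z" by (rule Z.module_axioms)
    show "\<zero>\<^bsub>?Z\<^esub> \<in> {c \<in> carrier ?Z. \<forall>i<?m. c i \<in> ?I}"
      using Z.M.zero_closed If(2) by (simp add: syzygy_module_ops(3))
    show "v \<oplus>\<^bsub>?Z\<^esub> w \<in> {c \<in> carrier ?Z. \<forall>i<?m. c i \<in> ?I}"
      if "v \<in> {c \<in> carrier ?Z. \<forall>i<?m. c i \<in> ?I}" "w \<in> {c \<in> carrier ?Z. \<forall>i<?m. c i \<in> ?I}" for v w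
      using that Z.M.a_closed[of v w] If(3) by (simp add: syzygy_module_ops(1))
    show "r \<odot>\<^bsub>?Z\<^esub> v \<in> {c \<in> carrier ?Z. \<forall>i<?m. c i \<in> ?I}"
      if "r \<in> carrier R" "v \<in> {c \<in> carrier ?Z. \<forall>i<?m. c i \<in> ?I}" for r v
      using that Z.smult_closed[of r v] If(5)[of _ r] by (simp add: syzygy_module_ops(2))
  qed blast
  moreover have "?col ` {..<dim_col A} \<subseteq> {c \<in> carrier ?Z. \<forall>i<?m. c i \<in> ?I}"
  proof
    fix c assume "c \<in> ?col ` {..<dim_col A}"
    then obtain j where j: "j < dim_col A" "c = ?col j" by blast
    have "A $$ (i, j) \<in> ?I" if "i < ?m" for i
      using R.genideal_self[OF sub'] elements_matI[of A ?m "dim_col A" i j] that j(1) by auto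
    then show "c \<in> {c \<in> carrier ?Z. \<forall>i<?m. c i \<in> ?I}" using col[OF j(1)] j(2) by simp
  qed
  ultimately have "carrier ?Z \<subseteq> {c \<in> carrier ?Z. \<forall>i<?m. c i \<in> ?I}"
    unfolding Zspan[symmetric] by (intro Z.span_is_subset)
  then have all: "c i \<in> ?I" if "c \<in> carrier ?Z" "i < ?m" for c i using that by blast
  have "coord_ideal ?m y \<subseteq> ?I"
  proof
    fix r assume "r \<in> coord_ideal ?m y"
    then obtain i c where ic: "i < ?m" "syzygy ?m y c" "r = c i" by (rule coord_idealE)
    then show "r \<in> ?I" using all[OF syzygy_restrict[OF yM ic(2)] ic(1)] by simp
  qed
  moreover have "?I \<subseteq> coord_ideal ?m y" by (rule R.genideal_minimal[OF ideal sub])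
  ultimately show ?thesis using that[OF gy] unfolding entry_ideal_def by blast
qed

text \<open>The trace ideal lies between the coordinate ideal and \<open>\<mm>\<close>, so it is a power ideal with a positive
  exponent \<open>d\<close>. If \<open>d > p\<close>, then it equals the power ideal of \<open>p\<close>, and \<open>p\<close> can serve as exponent.\<close>

lemma trace_ideal_syzygies:
  assumes g: "minimal_homogeneous_generators R M MM m x"
    and p: "coord_ideal m x = power_ideal n a p"
  obtains d where "1 \<le> d" "d \<le> p" "trace_ideal R (syzygy_module R M m x) = power_ideal n a d"
proof -
  note xM = gens_carrier[OF g]
  let ?Z = "syzygy_module R M m x"
  let ?T = "{f y | f y. f \<in> module_hom R ?Z (ring_as_module R) \<and> y \<in> carrier ?Z}"
  have T: "?T \<subseteq> max_ideal"
  proof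
    fix r assume "r \<in> ?T"
    then obtain f y where "f \<in> module_hom R ?Z (ring_as_module R)" "y \<in> carrier ?Z" "r = f y" by blast
    then show "r \<in> max_ideal"
      using syzygy_functional_max_ideal[OF xM coord_ideal_max_ideal[OF g]] by simp
  qed
  then have TR: "?T \<subseteq> carrier R" using max_ideal_sub by auto
  have tr: "trace_ideal R ?Z = Idl\<^bsub>R\<^esub> ?T" unfolding trace_ideal_def ..
  have ideal: "ideal (trace_ideal R ?Z) R" unfolding tr by (rule R.genideal_ideal[OF TR])
  have le: "trace_ideal R ?Z \<subseteq> max_ideal" unfolding tr by (rule R.genideal_minimal[OF max_ideal_ideal T])
  have ge: "coord_ideal m x \<subseteq> trace_ideal R ?Z"
  proof
    fix r assume "r \<in> coord_ideal m x"
    then obtain i c where ic: "i < m" "syzygy m x c" "r = c i" by (rule coord_idealE)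
    have "restrict c {..<m} \<in> carrier ?Z" by (rule syzygy_restrict[OF xM ic(2)])
    then have "r \<in> ?T" using coordinate_hom[OF xM ic(1)] ic(1,3)
      by (intro CollectI exI[of _ "\<lambda>c. c i"] exI[of _ "restrict c {..<m}"]) simp
    then show "r \<in> trace_ideal R ?Z" unfolding tr using R.genideal_self[OF TR] by blast
  qed
  have "tpow (a j) \<in> trace_ideal R ?Z" if "1 \<le> j" "j < n" for j
    using generator_is_coordinate[OF g gens_nonempty[OF g] that] gens_nonempty[OF g] ge
    unfolding coord_ideal_def by blast
  then obtain d where d: "trace_ideal R ?Z = power_ideal n a d"
    using ideal_eq_power_ideal[OF ideal] by blast
  have pos: "1 \<le> d'" if "power_ideal n a d' \<subseteq> max_ideal" for d'
  proof (rule ccontr)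
    assume "\<not> 1 \<le> d'"
    then have "d' = 0" by simp
    then have "0 \<in> pow_exps d'" using pow_exps_mult[of 0] by simp
    then have "(1 :: 'k poly) \<in> power_ideal n a d'"
      using mon_span_monom[of 0 "pow_exps d'" 1] unfolding power_ideal_eq by (simp add: monom_eq_1)
    then have "(1 :: 'k poly) \<in> max_ideal" using that by blast
    then show False using max_ideal_coeff[of "1 :: 'k poly"] by simp
  qed
  show ?thesis
  proof (cases "d \<le> p")
    case True
    then show ?thesis using that[OF pos True d] le d by simp
  next
    case False
    then have "power_ideal n a d \<subseteq> (power_ideal n a p :: 'k poly set)" by (intro power_ideal_antimono) simp
    then have eq: "trace_ideal R ?Z = power_ideal n a p" using ge d p by blast
    then show ?thesis using that[OF pos order_refl eq] le by simp
  qed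
qed

end

theorem theorem3p9:
  fixes n m :: nat and a :: "nat \<Rightarrow> nat"
    and R :: "'k::field poly ring" and M :: "('k poly, 'm) module"
    and MM :: "int \<Rightarrow> 'm set" and x :: "nat \<Rightarrow> 'm"
  assumes "minimal_semigroup_generators n a" and "n \<ge> 2"
    and "R = semigroup_ring (a ` {..<n})"
    and "graded_module R M (semigroup_ring_grading (a ` {..<n})) MM"
    and "Ulrich_module (\<lambda>c. [:c:]) R (irrelevant_ideal (a ` {..<n})) M"
    and "minimal_homogeneous_generators R M MM m x"
  shows "(\<forall>i<m. \<exists>d. colon R M (module.span R M (x ` ({..<m} - {i}))) (x i) = power_ideal n a d) \<and>
    (\<forall>d. (\<forall>i<m. colon R M (module.span R M (x ` ({..<m} - {i}))) (x i) = power_ideal n a (d i)) \<longrightarrow>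
      (\<forall>A. minimal_presentation_matrix R (semigroup_ring_grading (a ` {..<n})) M MM A \<longrightarrow>
        entry_ideal R A = power_ideal n a (Min (d ` {..<m}))) \<and>
      (\<exists>d'. 1 \<le> d' \<and> d' \<le> Min (d ` {..<m}) \<and>
        trace_ideal R (syzygy_module R M m x) = power_ideal n a d'))"
proof -
  interpret graded_Ulrich_module n a R M MM
  proof (intro graded_Ulrich_module.intro graded_semigroup_ring_module.intro semigroup_ring_module.intro
      numerical_semigroup_ring.intro graded_semigroup_ring_module_axioms.intro graded_Ulrich_module_axioms.intro)
    show "Module.module R M" using assms(4) unfolding graded_module_def by blast
  qed (rule assms)+
  note g = assms(6)
  note colon = colon_eq_coordinates[OF gens_carrier[OF g]]
  show ?thesis
  proof (intro conjI allI impI)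
    fix i assume i: "i < m"
    show "\<exists>d. colon R M (span (x ` ({..<m} - {i}))) (x i) = power_ideal n a d"
      unfolding colon[OF i] by (rule coordinates_power_ideal[OF g i])
  next
    fix d A
    assume d: "\<forall>i<m. colon R M (span (x ` ({..<m} - {i}))) (x i) = power_ideal n a (d i)"
      and A: "minimal_presentation_matrix R (semigroup_ring_grading (a ` {..<n})) M MM A"
    have coord: "coord_ideal m x = power_ideal n a (Min (d ` {..<m}))"
      by (rule coord_ideal_eq[OF g]) (use d colon in simp)
    obtain y where y: "minimal_homogeneous_generators R M MM (dim_row A) y"
      "entry_ideal R A = coord_ideal (dim_row A) y" using entry_ideal_coord_ideal[OF A] by blast
    show "entry_ideal R A = power_ideal n a (Min (d ` {..<m}))"
      unfolding y(2) coord[symmetric] by (rule antisym[OF coord_ideal_le[OF y(1) g] coord_ideal_le[OF g y(1)]])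
  next
    fix d
    assume d: "\<forall>i<m. colon R M (span (x ` ({..<m} - {i}))) (x i) = power_ideal n a (d i)"
    have coord: "coord_ideal m x = power_ideal n a (Min (d ` {..<m}))"
      by (rule coord_ideal_eq[OF g]) (use d colon in simp)
    show "\<exists>d'. 1 \<le> d' \<and> d' \<le> Min (d ` {..<m}) \<and> trace_ideal R (syzygy_module R M m x) = power_ideal n a d'"
      using trace_ideal_syzygies[OF g coord] by blast
  qed
qed

end
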